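(* Let $\Phi$ be a stationary Poisson process on $\mathbb R^d$ of non-zero intensity $\gamma$. For $k\in\mathbb N$, let $\Phi_k$ be the $k$-th iterate of Lloyd's algorithm applied to $\Phi$. Then, for all $k\in\mathbb N$, $$\lim_{r\to\infty}\lambda_d(B_r)^{-1}\operatorname{Var}[\Phi_k(B_r)]=\lim_{r\to\infty}\lambda_d(B_r)^{-1}\operatorname{Var}[\Phi(B_r)]=\gamma .$$
   Context: $\lambda_d$ is Lebesgue measure on $\mathbb R^d$; $B_r$ is the ball of radius $r$ centred at $0$. For a locally finite simple counting measure $\varphi\ne0$ on $\mathbb R^d$ (identified with its support) and $x\in\mathbb R^d$, $N(x,\varphi)$ denotes the nearest neighbour of $x$ in $\varphi$, i.e. the point $p\in\varphi$ minimizing $\|x-p\|$ (the lexicographically smallest in case of ties). The Voronoi cell of $x$ with respect to $\varphi$ is $C(x,\varphi):=\{y\in\mathbb R^d:N(y,\varphi)=N(x,\varphi)\}$. For a bounded convex set $A$ of positive volume, $\mathrm m(A):=\lambda_d(A)^{-1}\int_Ax\,\mathrm dx$ is its centre of mass, and $\mathrm m(x,\varphi):=\mathrm m(C(x,\varphi))$. The iterates of Lloyd's algorithm applied to $\varphi$ are defined by $$\varphi_0:=\varphi,\qquad\varphi_k:=\sum_{x\in\varphi_{k-1}}\delta_{\mathrm m(x,\varphi_{k-1})},\quad k\ge1 .$$ (These are a.s. well-defined for $\varphi=\Phi$.) *)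

theory Defs
  imports "HOL-Probability.Probability" "HOL-Library.Fun_Lexorder"
begin

section \<open>Point processes\<close>

text \<open>
  A point process is a random element of the space of locally finite counting measures,
  equipped with the sigma-algebra generated by the counts of Borel sets. As usual, simplicity is
  not part of the definition; a stationary Poisson process is almost surely simple.
\<close>

definition locally_finite_counting_measure :: "'a::euclidean_space measure \<Rightarrow> bool" where
  "locally_finite_counting_measure \<phi> \<longleftrightarrow>
     sets \<phi> = sets borel \<and>
     (\<forall>B\<in>sets borel. bounded B \<longrightarrow> (\<exists>n::nat. emeasure \<phi> B = of_nat n))"

definition configuration_algebra :: "'a::euclidean_space measure measure" where
  "configuration_algebra =
     (SUP B\<in>sets borel.
        vimage_algebra {\<phi>. locally_finite_counting_measure \<phi>} (\<lambda>\<phi>. emeasure \<phi> B) borel)"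

definition point_process :: "'w measure \<Rightarrow> ('w \<Rightarrow> 'a::euclidean_space measure) \<Rightarrow> bool" where
  "point_process M \<Phi> \<longleftrightarrow> prob_space M \<and> \<Phi> \<in> M \<rightarrow>\<^sub>M configuration_algebra"

text \<open>
  The Poisson weights are written out because the library's \<open>poisson_pmf\<close> is only specified for
  a positive rate, whereas sets with \<open>emeasure \<Lambda> B = 0\<close> have to be covered, too.
\<close>

definition poisson_process ::
  "'w measure \<Rightarrow> 'a::euclidean_space measure \<Rightarrow> ('w \<Rightarrow> 'a measure) \<Rightarrow> bool" where
  "poisson_process M \<Lambda> \<Phi> \<longleftrightarrow>
     point_process M \<Phi> \<and>
     sets \<Lambda> = sets borel \<and>
     (\<forall>B\<in>sets borel. bounded B \<longrightarrow> emeasure \<Lambda> B < \<infinity>) \<and>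
     (\<forall>B\<in>sets borel. emeasure \<Lambda> B < \<infinity> \<longrightarrow>
        (\<forall>n::nat. measure M {\<omega>\<in>space M. emeasure (\<Phi> \<omega>) B = of_nat n} =
           measure \<Lambda> B ^ n / fact n * exp (- measure \<Lambda> B))) \<and>
     (\<forall>(n::nat) B. (\<forall>i<n. B i \<in> sets borel) \<longrightarrow> disjoint_family_on B {..<n} \<longrightarrow>
        prob_space.indep_vars M (\<lambda>_. borel) (\<lambda>i \<omega>. emeasure (\<Phi> \<omega>) (B i)) {..<n})"

definition stationary :: "'w measure \<Rightarrow> ('w \<Rightarrow> 'a::euclidean_space measure) \<Rightarrow> bool" where
  "stationary M \<Phi> \<longleftrightarrow>
     (\<forall>t. distr M configuration_algebra (\<lambda>\<omega>. distr (\<Phi> \<omega>) borel (\<lambda>x. x + t)) =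
          distr M configuration_algebra \<Phi>)"

definition intensity :: "'w measure \<Rightarrow> ('w \<Rightarrow> 'a::euclidean_space measure) \<Rightarrow> ennreal" where
  "intensity M \<Phi> = (\<integral>\<^sup>+\<omega>. emeasure (\<Phi> \<omega>) (cbox 0 One) \<partial>M)"


section \<open>Lloyd's algorithm\<close>

definition points :: "'a::euclidean_space measure \<Rightarrow> 'a set" where
  "points \<phi> = {x. emeasure \<phi> {x} \<noteq> 0}"

text \<open>
  The linear order on the index type \<open>'d\<close> serves to order the coordinates lexicographically;
  the order of the library on \<open>real ^ 'd\<close> is the componentwise one.
\<close>

definition nearest_neighbour ::
  "real ^ ('d::{finite,linorder}) \<Rightarrow> (real ^ ('d::{finite,linorder})) measure \<Rightarrow> real ^ ('d::{finite,linorder})" where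
  "nearest_neighbour x \<phi> =
     (THE p. p \<in> points \<phi> \<and>
        (\<forall>q\<in>points \<phi>. dist x p \<le> dist x q) \<and>
        (\<forall>q\<in>points \<phi>. dist x q = dist x p \<longrightarrow> q \<noteq> p \<longrightarrow> less_fun (($) p) (($) q)))"

definition voronoi_cell ::
  "real ^ ('d::{finite,linorder}) \<Rightarrow> (real ^ ('d::{finite,linorder})) measure \<Rightarrow> (real ^ ('d::{finite,linorder})) set" where
  "voronoi_cell x \<phi> = {y. nearest_neighbour y \<phi> = nearest_neighbour x \<phi>}"

definition centre_of_mass :: "'a::euclidean_space set \<Rightarrow> 'a" where
  "centre_of_mass A = inverse (measure lborel A) *\<^sub>R (LINT x:A|lborel. x)"

text \<open>
  The push-forward of the counting measure on \<open>points \<phi>\<close> is the sum over all points \<open>x\<close> of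
  \<open>\<phi>\<close> of the Dirac measures at the centres of mass of the cells of \<open>x\<close>; multiplicities are kept.
\<close>

definition lloyd_step ::
  "(real ^ ('d::{finite,linorder})) measure \<Rightarrow> (real ^ ('d::{finite,linorder})) measure" where
  "lloyd_step \<phi> =
     distr (count_space (points \<phi>)) borel (\<lambda>x. centre_of_mass (voronoi_cell x \<phi>))"

primrec lloyd ::
  "nat \<Rightarrow> (real ^ ('d::{finite,linorder})) measure \<Rightarrow> (real ^ ('d::{finite,linorder})) measure" where
  "lloyd 0 \<phi> = \<phi>"
| "lloyd (Suc k) \<phi> = lloyd_step (lloyd k \<phi>)"


section \<open>Variance of counts\<close>

text \<open>
  The iterates are only almost surely well-defined (for instance, on a null event cells may be
  unbounded), so a count is a random variable only up to null sets. Its variance is therefore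
  taken in the completed probability space; for random variables on \<open>M\<close> itself the completion
  does not change the variance.
\<close>

definition count_variance :: "'w measure \<Rightarrow> ('w \<Rightarrow> 'a::euclidean_space measure) \<Rightarrow> 'a set \<Rightarrow> real"
  where
  "count_variance M \<Psi> B = prob_space.variance (completion M) (\<lambda>\<omega>. measure (\<Psi> \<omega>) B)"

end

theory Submission
  imports Defs
begin

text \<open>
  Almost surely all holes of the process in a ball of radius \<open>n\<close> are much smaller than \<open>n\<close>. Then the
  centre of mass of every cell is strictly closer to the nucleus of the cell than to all other points,
  so Lloyd's algorithm moves distinct particles to distinct places and \<open>\<Phi>\<^sub>k(B\<^sub>r)\<close> is the number of
  particles that are in \<open>B\<^sub>r\<close> after \<open>k\<close> steps. If every cube of side \<open>s\<close> near \<open>B\<^sub>r\<close> contains a point, where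
  \<open>s\<close> is a small power of \<open>r\<close>, a particle moves by \<open>O(s)\<close> and its position depends only on the points
  within distance \<open>O(s)\<close>. So \<open>\<Phi>\<^sub>k(B\<^sub>r) - \<Phi>(B\<^sub>r)\<close> is a sum of contributions of the cubes within distance
  \<open>O(s)\<close> of the boundary sphere, and contributions of cubes further than \<open>O(s)\<close> apart are independent.
  The variance of the sum is therefore \<open>O(r ^ (d - 1) * s ^ (d + 1)) = o(r ^ d)\<close>. An empty cube occurs
  with a probability that decays faster than every power of \<open>r\<close>; the fourth moment of the Poisson
  distribution then makes the error on this event negligible in \<open>L\<^sup>2\<close>. By the Cauchy-Schwarz
  inequality \<open>Var \<Phi>\<^sub>k(B\<^sub>r) = Var \<Phi>(B\<^sub>r) + o(r ^ d)\<close>.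
\<close>

section \<open>Voronoi cells and their centres\<close>

text \<open>Particles are followed by their starting points, so the two counts differ only by
  particles that cross the sphere, and each of these can be charged to the cube in which it started.
  Membership in the ball after \<open>k\<close> steps has no a priori domain of dependence, however:
  in a configuration with a large hole, particles from far away may end in the ball. Two devices
  answer this. The contribution of a cube is computed from the points of a window only, so distant
  contributions are independent without conditioning on the absence of holes. On the exceptional
  event everything is bounded, up to a constant, by the number of points in a ball whose radius is
  the first later scale without large holes; almost surely there is one, and the sum over its
  possible values converges. The choice \<open>scale n ^ (d + 1) = sqrt n\<close> makes the relative
  variance of the boundary term of order \<open>1 / sqrt r\<close>. Measurability rests on void
  events: they determine a locally finite set, they are stable under intersection, and their
  independence for disjoint sets carries over to everything computed from disjoint windows.\<close>

definition vcell :: "'a::euclidean_space \<Rightarrow> 'a set \<Rightarrow> 'a set" where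
  "vcell x P = {y. \<forall>q\<in>P. dist y x \<le> dist y q}"

text \<open>The fallback \<open>x\<close> keeps the centre inside the cell in every case. It matters for the finite
  configurations seen through a window, whose outer cells are unbounded, so that
  \<open>centre_of_mass\<close> returns a junk value.\<close>

definition cell_centre :: "'a::euclidean_space \<Rightarrow> 'a set \<Rightarrow> 'a" where
  "cell_centre x P =
     (let c = centre_of_mass (vcell x P) in if c \<in> vcell x P then c else x)"

text \<open>The position after \<open>j\<close> steps of Lloyd's algorithm of the particle that starts at \<open>x\<close>.\<close>

primrec track :: "'a::euclidean_space set \<Rightarrow> nat \<Rightarrow> 'a \<Rightarrow> 'a" where
  "track P 0 x = x"
| "track P (Suc j) x = cell_centre (track P j x) (track P j ` P)"

definition good_in :: "'a::euclidean_space \<Rightarrow> real \<Rightarrow> real \<Rightarrow> 'a set \<Rightarrow> bool" where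
  "good_in c \<rho> a P \<longleftrightarrow> finite (P \<inter> cball c \<rho>) \<and> (\<forall>y\<in>cball c \<rho>. \<exists>p\<in>P. dist y p \<le> a)"

text \<open>The holes of the configuration in a ball of radius \<open>R\<close> around the origin are of size \<open>o(R)\<close>. This
  property survives a step of the algorithm, because \<open>C\<close> is arbitrary.\<close>

definition globally_good :: "'a::euclidean_space set \<Rightarrow> bool" where
  "globally_good P \<longleftrightarrow> (\<forall>C\<ge>0. \<forall>R. \<exists>a>0. good_in 0 (R + C * a) a P)"

lemma good_in_finite: "good_in c \<rho> a P \<Longrightarrow> finite (P \<inter> cball c \<rho>)"
  by (simp add: good_in_def)

lemma good_inE:
  assumes "good_in c \<rho> a P" "dist c y \<le> \<rho>"
  obtains p where "p \<in> P" "dist y p \<le> a"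
  using assms unfolding good_in_def by (metis mem_cball)

text \<open>The squares of \<open>y\<close> cancel: whether \<open>y\<close> is nearer to
  \<open>x\<close> or to \<open>q\<close> is decided by an affine function of \<open>y\<close>. So
  cells are intersections of half-spaces, bisectors are hyperplanes, and the comparison is
  compatible with taking means.\<close>

lemma dist_sq_diff:
  fixes x y q :: "'a::euclidean_space"
  shows "(dist y q)\<^sup>2 - (dist y x)\<^sup>2 = 2 * (y \<bullet> (x - q)) - (x \<bullet> x - q \<bullet> q)"
  by (simp add: dist_norm power2_norm_eq_inner inner_diff_left inner_diff_right inner_commute)

lemma dist_le_iff_inner:
  fixes x y q :: "'a::euclidean_space"
  shows "dist y x \<le> dist y q \<longleftrightarrow> 0 \<le> 2 * (y \<bullet> (x - q)) - (x \<bullet> x - q \<bullet> q)"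
  unfolding dist_sq_diff[symmetric] by (simp add: abs_le_square_iff[symmetric])

lemma dist_less_iff_inner:
  fixes x y q :: "'a::euclidean_space"
  shows "dist y x < dist y q \<longleftrightarrow> 0 < 2 * (y \<bullet> (x - q)) - (x \<bullet> x - q \<bullet> q)"
  using dist_le_iff_inner[of y q x] by (simp add: not_le[symmetric] inner_diff_right del: not_le) linarith

lemma closed_vcell: "closed (vcell x P)"
proof -
  have "vcell x P = (\<Inter>q\<in>P. {y. dist y x \<le> dist y q})" by (auto simp: vcell_def)
  then show ?thesis
    by (auto intro!: closed_INT closed_Collect_le continuous_intros)
qed

lemma vcell_borel [measurable, simp]: "vcell x P \<in> sets borel"
  by (rule borel_closed[OF closed_vcell])

lemma self_in_vcell [simp]: "x \<in> vcell x P"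
  by (simp add: vcell_def)

lemma cell_centre_in_vcell: "cell_centre x P \<in> vcell x P"
  by (auto simp: cell_centre_def Let_def)

text \<open>On a segment an affine function is bounded below by its smaller end value.
  Star-shapedness about \<open>x\<close> is the form of convexity that lets a far point of the cell
  be pulled back to a prescribed distance.\<close>

lemma vcell_segment:
  assumes "y \<in> vcell x P" "0 \<le> t" "t \<le> 1"
  shows "x + t *\<^sub>R (y - x) \<in> vcell x P"
  unfolding vcell_def
proof (clarify)
  fix q assume "q \<in> P"
  then have "dist y x \<le> dist y q" using assms(1) by (simp add: vcell_def)
  then have 1: "0 \<le> 2 * (y \<bullet> (x - q)) - (x \<bullet> x - q \<bullet> q)" by (simp add: dist_le_iff_inner)
  have 2: "0 \<le> 2 * (x \<bullet> (x - q)) - (x \<bullet> x - q \<bullet> q)"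
    using dist_le_iff_inner[of x x q] by simp
  have "2 * ((x + t *\<^sub>R (y - x)) \<bullet> (x - q)) - (x \<bullet> x - q \<bullet> q) =
     t * (2 * (y \<bullet> (x - q)) - (x \<bullet> x - q \<bullet> q)) + (1 - t) * (2 * (x \<bullet> (x - q)) - (x \<bullet> x - q \<bullet> q))"
    by (simp add: algebra_simps inner_add_left inner_diff_left)
  also have "\<dots> \<ge> 0" using 1 2 assms by auto
  finally show "dist (x + t *\<^sub>R (y - x)) x \<le> dist (x + t *\<^sub>R (y - x)) q"
    by (simp only: dist_le_iff_inner)
qed

text \<open>A point of the cell further than \<open>a\<close> from \<open>x\<close> can be pulled
  towards \<open>x\<close> until its distance lies in \<open>(a, 2 * a]\<close>. It is then in the
  region without large holes, so some point of \<open>P\<close> within \<open>a\<close> is strictly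
  nearer to it than \<open>x\<close>.\<close>

lemma vcell_subset_cball:
  assumes "0 < a" "good_in c \<rho> a P" "dist c x \<le> \<rho> - 2 * a"
  shows "vcell x P \<subseteq> cball x a"
proof (rule ccontr)
  assume "\<not> ?thesis"
  then obtain y where y: "y \<in> vcell x P" "dist x y > a" by (auto simp: subset_eq not_le)
  define t where "t = min 1 (2 * a / dist x y)"
  define z where "z = x + t *\<^sub>R (y - x)"
  have t: "0 \<le> t" "t \<le> 1" using \<open>a > 0\<close> by (auto simp: t_def)
  have d: "dist z x = t * dist x y"
    using t by (simp add: z_def dist_norm norm_minus_commute)
  have gt: "a < dist z x" and le: "dist z x \<le> 2 * a"
    using y(2) \<open>a > 0\<close> by (auto simp: d t_def min_def field_simps)
  have "z \<in> vcell x P" unfolding z_def by (rule vcell_segment[OF y(1) t])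
  have "dist c z \<le> \<rho>" using assms(3) le dist_triangle[of c z x] by (simp add: dist_commute)
  then obtain p where "p \<in> P" "dist z p \<le> a" using good_inE[OF assms(2)] by metis
  then show False using \<open>z \<in> vcell x P\<close> gt by (force simp: vcell_def)
qed

text \<open>\<open>(dist y q)\<^sup>2 - (dist y x)\<^sup>2\<close> is affine in \<open>y\<close>; its mean over the cell, which is its value at the
  centre of mass, is positive because the cell contains a ball around \<open>x\<close>.\<close>

lemma centre_of_mass_strictly_nearest:
  fixes x :: "'a::euclidean_space"
  assumes "0 < e" and sep: "\<And>q. q \<in> P \<Longrightarrow> q \<noteq> x \<Longrightarrow> e \<le> dist x q"
    and bd: "vcell x P \<subseteq> cball x a" and q: "q \<in> P" "q \<noteq> x"
  shows "dist (centre_of_mass (vcell x P)) x < dist (centre_of_mass (vcell x P)) q"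
proof -
  define A where "A = vcell x P"
  define c where "c = centre_of_mass A"
  have [measurable]: "A \<in> sets borel" by (simp add: A_def)
  have bA: "bounded A" using bd bounded_cball bounded_subset unfolding A_def by blast
  have fin: "emeasure lborel A < \<infinity>"
    by (rule emeasure_bounded_finite[OF bA])
  have mball: "ball x (e/4) \<subseteq> A"
  proof
    fix y assume y: "y \<in> ball x (e/4)"
    show "y \<in> A" unfolding A_def vcell_def
    proof clarify
      fix q assume "q \<in> P"
      show "dist y x \<le> dist y q"
      proof (cases "q = x")
        case False
        with sep[OF \<open>q \<in> P\<close>] have "e \<le> dist x q" by blast
        then show ?thesis using y \<open>e > 0\<close> dist_triangle[of x q y] dist_commute[of x y] mem_ball[of y x "e/4"]
          by linarith
      qed simp
    qed
  qed
  have pos: "0 < measure lborel (ball x (e/4))"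
    using \<open>e > 0\<close> by (simp add: content_ball_pos)
  have mA: "0 < measure lborel A"
  proof -
    have "A \<in> fmeasurable lborel" using fin by (intro fmeasurableI) auto
    then have "measure lborel (ball x (e/4)) \<le> measure lborel A"
      by (intro measure_mono_fmeasurable[OF mball]) auto
    then show ?thesis using pos by linarith
  qed
  obtain B where B: "\<And>y. y \<in> A \<Longrightarrow> norm y \<le> B" using bA unfolding bounded_iff by auto
  have int: "set_integrable lborel A (\<lambda>y. y)"
    unfolding set_integrable_def
  proof (rule integrableI_bounded_set[where A=A and B=B])
    show "AE y in lborel. y \<in> A \<longrightarrow> norm (indicator A y *\<^sub>R y) \<le> B"
      using B by (auto simp: indicator_def)
  qed (use fin in \<open>auto simp: indicator_def\<close>)
  define g where "g y = 2 * (y \<bullet> (x - q)) - (x \<bullet> x - q \<bullet> q)" for y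
  have g_def': "g y = (dist y q)\<^sup>2 - (dist y x)\<^sup>2" for y
    by (simp add: g_def dist_sq_diff)
  have i1: "integrable lborel (\<lambda>y. indicator A y *\<^sub>R y)" using int by (simp add: set_integrable_def)
  have i2: "integrable lborel (\<lambda>y. (indicator A y :: real))"
    using fin by (intro integrable_real_indicator) auto
  have i3: "integrable lborel (\<lambda>y. indicator A y * g y)"
  proof -
    have "integrable lborel (\<lambda>y. 2 * ((indicator A y *\<^sub>R y) \<bullet> (x - q)) - (x \<bullet> x - q \<bullet> q) * indicator A y)"
      using i1 i2 by (intro Bochner_Integration.integrable_diff integrable_mult_right integrable_inner_left) auto
    then show ?thesis by (simp add: g_def algebra_simps)
  qed
  have "(\<integral>y. indicator A y * g y \<partial>lborel)
     = (\<integral>y. 2 * ((indicator A y *\<^sub>R y) \<bullet> (x - q)) - (x \<bullet> x - q \<bullet> q) * indicator A y \<partial>lborel)"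
    by (rule Bochner_Integration.integral_cong) (auto simp: g_def algebra_simps)
  also have "\<dots> = 2 * ((\<integral>y. indicator A y *\<^sub>R y \<partial>lborel) \<bullet> (x - q)) - (x \<bullet> x - q \<bullet> q) * measure lborel A"
  proof -
    have j1: "integrable lborel (\<lambda>y. (indicator A y *\<^sub>R y) \<bullet> (x - q))"
      using i1 by (intro integrable_inner_left)
    have j2: "(\<integral>y. (indicator A y *\<^sub>R y) \<bullet> (x - q) \<partial>lborel) = (\<integral>y. indicator A y *\<^sub>R y \<partial>lborel) \<bullet> (x - q)"
      using i1 by (intro integral_inner_left)
    show ?thesis
      unfolding Bochner_Integration.integral_diff[OF integrable_mult_right[OF j1] integrable_mult_right[OF i2]]
        integral_mult_right_zero j2 by simp
  qed
  also have "(\<integral>y. indicator A y *\<^sub>R y \<partial>lborel) = measure lborel A *\<^sub>R c"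
    using mA by (simp add: c_def centre_of_mass_def set_lebesgue_integral_def)
  also have "2 * ((measure lborel A *\<^sub>R c) \<bullet> (x - q)) - (x \<bullet> x - q \<bullet> q) * measure lborel A = measure lborel A * g c"
    by (simp add: g_def algebra_simps)
  finally have eq: "(\<integral>y. indicator A y * g y \<partial>lborel) = measure lborel A * g c" .
  have "(e\<^sup>2/2) * measure lborel (ball x (e/4)) = (\<integral>y. (e\<^sup>2/2) * indicator (ball x (e/4)) y \<partial>lborel)"
    by simp
  also have "\<dots> \<le> (\<integral>y. indicator A y * g y \<partial>lborel)"
  proof (rule integral_mono[OF _ i3])
    show "integrable lborel (\<lambda>y. (e\<^sup>2/2) * indicator (ball x (e/4)) y)"
      by (intro integrable_mult_right integrable_real_indicator) (auto simp: emeasure_lborel_ball_finite[unfolded infinity_ennreal_def])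
    fix y
    have nn: "0 \<le> g y" if "y \<in> A"
      using that q dist_le_iff_inner[of y x q] by (auto simp: A_def vcell_def g_def)
    show "(e\<^sup>2/2) * indicator (ball x (e/4)) y \<le> indicator A y * g y"
    \<comment> \<open>Inside the small ball the distances to \<open>x\<close> and \<open>q\<close>
      are at most \<open>e / 4\<close> and at least \<open>3 * e / 4\<close>, so \<open>g\<close> is
      at least \<open>(9/16 - 1/16) * e ^ 2\<close>; on the rest of the cell it is
      non-negative.\<close>
    proof (cases "y \<in> ball x (e/4)")
      case True
      have 1: "dist y x \<le> e/4" using True by (simp add: dist_commute)
      have 2: "3*e/4 \<le> dist y q"
        using sep[OF q] True dist_triangle[of x q y] by (simp add: dist_commute)
      have "(3*e/4)\<^sup>2 \<le> (dist y q)\<^sup>2" using 2 \<open>e > 0\<close> by (intro power_mono) auto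
      moreover have "(dist y x)\<^sup>2 \<le> (e/4)\<^sup>2" using 1 by (intro power_mono) auto
      ultimately have "e\<^sup>2/2 \<le> g y" unfolding g_def' by (simp add: power2_eq_square)
      then show ?thesis using True mball by (auto simp: indicator_def)
    qed (use nn in \<open>auto simp: indicator_def\<close>)
  qed
  finally have "0 < measure lborel A * g c"
    using pos \<open>e > 0\<close> unfolding eq by (smt (verit) mult_pos_pos zero_less_power half_gt_zero)
  then have "0 < g c" using mA zero_less_mult_pos by blast
  then show ?thesis
    unfolding c_def[symmetric] A_def[symmetric] dist_less_iff_inner g_def .
qed

text \<open>Outside \<open>cball c \<rho>\<close> nothing is known about \<open>P\<close>, but
  points there are at least \<open>\<rho> - dist c x\<close> away from \<open>x\<close>; inside
  there are only finitely many.\<close>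

lemma good_in_separated:
  assumes "good_in c \<rho> a P" "dist c x < \<rho>"
  obtains e where "0 < e" "\<And>q. q \<in> P \<Longrightarrow> q \<noteq> x \<Longrightarrow> e \<le> dist x q"
proof -
  have "finite (P \<inter> cball c \<rho>)" using assms by (simp add: good_in_def)
  from finite_set_avoid[OF this, of x] obtain d
    where d: "0 < d" "\<forall>q\<in>P \<inter> cball c \<rho>. q \<noteq> x \<longrightarrow> d \<le> dist x q" by auto
  show ?thesis
  proof (rule that[of "min d (\<rho> - dist c x)"])
    show "0 < min d (\<rho> - dist c x)" using d assms by auto
    fix q assume q: "q \<in> P" "q \<noteq> x"
    then show "min d (\<rho> - dist c x) \<le> dist x q"
      using d dist_triangle[of c q x] by (cases "q \<in> cball c \<rho>") (auto simp: min_le_iff_disj)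
  qed
qed

lemma cell_centre_nearest:
  assumes "0 < a" "good_in c \<rho> a P" "dist c x \<le> \<rho> - 2 * a"
  shows "cell_centre x P = centre_of_mass (vcell x P)"
    and "dist (cell_centre x P) x \<le> a"
    and "\<And>q. q \<in> P \<Longrightarrow> q \<noteq> x \<Longrightarrow> dist (cell_centre x P) x < dist (cell_centre x P) q"
proof -
  have bd: "vcell x P \<subseteq> cball x a" by (rule vcell_subset_cball[OF assms])
  obtain e where e: "0 < e" "\<And>q. q \<in> P \<Longrightarrow> q \<noteq> x \<Longrightarrow> e \<le> dist x q"
    using good_in_separated[OF assms(2), of x] assms by auto
  have strict: "dist (centre_of_mass (vcell x P)) x < dist (centre_of_mass (vcell x P)) q"
    if "q \<in> P" "q \<noteq> x" for q
    by (rule centre_of_mass_strictly_nearest[OF e bd that])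
  have "centre_of_mass (vcell x P) \<in> vcell x P"
    unfolding vcell_def[of x P, THEN eqset_imp_iff, of "centre_of_mass (vcell x P)"] mem_Collect_eq
    using strict by (metis less_eq_real_def)
  then show eq: "cell_centre x P = centre_of_mass (vcell x P)"
    by (simp add: cell_centre_def Let_def)
  show "dist (cell_centre x P) x \<le> a"
    using cell_centre_in_vcell[of x P] bd by (auto simp: dist_commute)
  show "\<And>q. q \<in> P \<Longrightarrow> q \<noteq> x \<Longrightarrow> dist (cell_centre x P) x < dist (cell_centre x P) q"
    using strict eq by simp
qed

section \<open>Locality of one step and the growth of holes\<close>

lemma good_in_shrink:
  assumes "0 < a" "good_in c \<rho> a R" "R \<inter> cball c \<rho> = S \<inter> cball c \<rho>"
  shows "good_in c (\<rho> - a) a S"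
  unfolding good_in_def
proof (intro conjI ballI)
  have "finite (R \<inter> cball c \<rho>)" using assms(2) by (simp add: good_in_def)
  moreover have "S \<inter> cball c (\<rho> - a) \<subseteq> R \<inter> cball c \<rho>" unfolding assms(3) using assms(1) by auto
  ultimately show "finite (S \<inter> cball c (\<rho> - a))" by (rule rev_finite_subset)
  fix y assume y: "y \<in> cball c (\<rho> - a)"
  then have "y \<in> cball c \<rho>" using assms(1) by simp
  then obtain p where p: "p \<in> R" "dist y p \<le> a" using assms(2) unfolding good_in_def by blast
  then have "p \<in> cball c \<rho>" using y dist_triangle[of c p y] by simp
  then show "\<exists>p\<in>S. dist y p \<le> a" using p assms(3) by blast
qed

text \<open>Only points near a cell can cut it. Of the margin \<open>4 * a\<close>, one
  \<open>a\<close> pays for transferring goodness to \<open>P'\<close>, and two more confine the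
  cell with respect to \<open>P'\<close> to \<open>cball x a\<close>.\<close>

lemma vcell_cong_local:
  assumes "0 < a" "good_in c \<rho> a P" "P \<inter> cball c \<rho> = P' \<inter> cball c \<rho>"
    "dist c x \<le> \<rho> - 4 * a"
  shows "vcell x P = vcell x P'"
proof -
  have good': "good_in c (\<rho> - a) a P'"
    by (rule good_in_shrink[OF assms(1-3)])
  have 1: "vcell x P \<subseteq> cball x a" using assms by (intro vcell_subset_cball[of a c \<rho>]) auto
  have 2: "vcell x P' \<subseteq> cball x a" using assms by (intro vcell_subset_cball[OF _ good']) auto
  have sub: "vcell x R \<subseteq> vcell x S" if "vcell x R \<subseteq> cball x a" "R \<inter> cball c \<rho> = S \<inter> cball c \<rho>" for R S
  proof
    fix y assume y: "y \<in> vcell x R"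
    then have ya: "dist y x \<le> a" using that(1) by (auto simp: dist_commute)
    show "y \<in> vcell x S" unfolding vcell_def
    proof clarify
      fix q assume q: "q \<in> S"
      show "dist y x \<le> dist y q"
      proof (cases "q \<in> cball c \<rho>")
        case True
        then have "q \<in> R" using q that(2) by blast
        then show ?thesis using y by (simp add: vcell_def)
      next
        \<comment> \<open>A point \<open>q\<close> outside the common ball is more than
          \<open>3 * a\<close> away from \<open>y\<close>, while \<open>x\<close> is within
          \<open>a\<close> of \<open>y\<close>.\<close>
        case False
        have "dist c q \<le> dist c x + dist x y + dist y q"
          using dist_triangle[of c q x] dist_triangle[of x q y] by linarith
        then show ?thesis using False ya assms(1,4) by (simp add: dist_commute)
      qed
    qed
  qed
  show ?thesis using sub[OF 1 assms(3)] sub[OF 2 assms(3)[symmetric]] by auto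
qed

lemma cell_centre_cong_local:
  assumes "0 < a" "good_in c \<rho> a P" "P \<inter> cball c \<rho> = P' \<inter> cball c \<rho>"
    "dist c x \<le> \<rho> - 4 * a"
  shows "cell_centre x P = cell_centre x P'"
  using vcell_cong_local[OF assms] by (simp add: cell_centre_def)

text \<open>The centre lies in the cell of \<open>x\<close>, so \<open>x\<close> is at least as near
  to it as the point of \<open>P\<close> that fills the gap there. Only the new position has to be
  in the good region; this is what excludes intruders from far away.\<close>

lemma cell_centre_back:
  assumes "good_in c \<rho> a P" "dist c (cell_centre x P) \<le> \<rho>"
  shows "dist (cell_centre x P) x \<le> a"
proof -
  have "cell_centre x P \<in> cball c \<rho>" using assms(2) by simp
  then obtain p where "p \<in> P" "dist (cell_centre x P) p \<le> a"
    using assms(1) unfolding good_in_def by blast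
  then show ?thesis using cell_centre_in_vcell[of x P] by (force simp: vcell_def)
qed

text \<open>A point within \<open>a\<close> of \<open>y\<close> moves by at most \<open>a\<close>,
  so holes at most double. The lost radius \<open>6 * a\<close> is shared with
  \<open>image_agree_step\<close>, where a displacement \<open>a\<close> and the margin
  \<open>4 * a\<close> of \<open>cell_centre_cong_local\<close> have to be absorbed.\<close>

lemma good_in_step:
  assumes "0 < a" "good_in c \<rho> a P"
  shows "good_in c (\<rho> - 6 * a) (2 * a) ((\<lambda>x. cell_centre x P) ` P)"
  unfolding good_in_def
proof (intro conjI ballI)
  let ?f = "\<lambda>x. cell_centre x P"
  have "?f ` P \<inter> cball c (\<rho> - 6 * a) \<subseteq> ?f ` (P \<inter> cball c \<rho>)"
  proof clarsimp
    fix x assume x: "x \<in> P" "dist c (?f x) \<le> \<rho> - 6 * a"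
    then have "dist (?f x) x \<le> a" using assms by (intro cell_centre_back[of c \<rho>]) auto
    then have "dist c x \<le> \<rho>" using x dist_triangle[of c x "?f x"] assms(1) by linarith
    then show "?f x \<in> ?f ` (P \<inter> cball c \<rho>)" using x by auto
  qed
  then show "finite (?f ` P \<inter> cball c (\<rho> - 6 * a))"
    by (rule finite_subset) (simp add: good_in_finite[OF assms(2)])
  fix y assume y: "y \<in> cball c (\<rho> - 6 * a)"
  then obtain p where p: "p \<in> P" "dist y p \<le> a" using assms by (force simp: good_in_def)
  have "dist c p \<le> \<rho> - 2 * a" using y p dist_triangle[of c p y] assms(1) by auto
  then have "dist (?f p) p \<le> a" by (rule cell_centre_nearest(2)[OF assms])
  then have "dist y (?f p) \<le> 2 * a" using p dist_triangle[of y "?f p" p] by (simp add: dist_commute)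
  then show "\<exists>p\<in>?f ` P. dist y p \<le> 2 * a" using p by blast
qed

text \<open>By \<open>cell_centre_back\<close>, a new point in the smaller ball started in the zone
  where the cells with respect to both configurations agree. The inclusion \<open>sub\<close> asks
  for goodness with radius \<open>\<rho> - a\<close> only, which both configurations have.\<close>

lemma image_agree_step:
  assumes "0 < a" "good_in c \<rho> a P" "P \<inter> cball c \<rho> = P' \<inter> cball c \<rho>"
  shows "(\<lambda>x. cell_centre x P) ` P \<inter> cball c (\<rho> - 6 * a)
       = (\<lambda>x. cell_centre x P') ` P' \<inter> cball c (\<rho> - 6 * a)"
proof -
  have sub: "(\<lambda>x. cell_centre x R) ` R \<inter> cball c (\<rho> - 6 * a) \<subseteq> (\<lambda>x. cell_centre x S) ` S"
    if "good_in c (\<rho> - a) a R" "R \<inter> cball c \<rho> = S \<inter> cball c \<rho>"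
      "\<And>x. dist c x \<le> \<rho> - 4 * a \<Longrightarrow> cell_centre x R = cell_centre x S" for R S
  proof clarsimp
    fix x assume x: "x \<in> R" "dist c (cell_centre x R) \<le> \<rho> - 6 * a"
    then have "dist (cell_centre x R) x \<le> a"
      using that(1) assms(1) by (intro cell_centre_back[of c "\<rho> - a"]) auto
    then have d: "dist c x \<le> \<rho> - 4 * a" using x dist_triangle[of c x "cell_centre x R"] assms(1) by linarith
    then have "x \<in> cball c \<rho>" using assms(1) by simp
    then have "x \<in> S" using x(1) that(2) by blast
    then show "cell_centre x R \<in> (\<lambda>x. cell_centre x S) ` S" using that(3)[OF d] by (rule rev_image_eqI)
  qed
  note cong = cell_centre_cong_local[OF assms]
  have "(\<lambda>x. cell_centre x P) ` P \<inter> cball c (\<rho> - 6 * a) \<subseteq> (\<lambda>x. cell_centre x P') ` P'"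
  proof (rule sub[OF _ assms(3)])
    show "good_in c (\<rho> - a) a P" by (rule good_in_shrink[OF assms(1,2) refl])
  qed (rule cong)
  moreover have "(\<lambda>x. cell_centre x P') ` P' \<inter> cball c (\<rho> - 6 * a) \<subseteq> (\<lambda>x. cell_centre x P) ` P"
  proof (rule sub[OF _ assms(3)[symmetric]])
    show "good_in c (\<rho> - a) a P'" by (rule good_in_shrink[OF assms(1-3)])
  qed (rule cong[symmetric])
  ultimately show ?thesis by blast
qed

section \<open>Several steps: displacement and domain of dependence\<close>

lemma track_image_Suc: "track P (Suc j) ` P = (\<lambda>x. cell_centre x (track P j ` P)) ` (track P j ` P)"
  by (auto simp: image_image)

text \<open>The hole size doubles in every step. Summing the geometric series gives the radius
  \<open>6 * (1 + ... + 2 ^ (j - 1)) * a\<close> lost so far and the displacement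
  \<open>(1 + ... + 2 ^ (j - 1)) * a\<close>. The claims are proved together because the next cells
  depend on the whole image of \<open>P\<close>. The last claim treats particles of which only the
  final position is known.\<close>

lemma track_local_aux:
  fixes P P' :: "'a::euclidean_space set"
  assumes "0 < a" "good_in c \<rho> a P" "P \<inter> cball c \<rho> = P' \<inter> cball c \<rho>"
  defines "s \<equiv> \<lambda>j. \<rho> - 6 * (2 ^ j - 1) * a"
  shows "good_in c (s j) (2 ^ j * a) (track P j ` P) \<and>
    track P j ` P \<inter> cball c (s j) = track P' j ` P' \<inter> cball c (s j) \<and>
    (\<forall>x\<in>P. dist c x \<le> s j \<longrightarrow> track P' j x = track P j x \<and> dist (track P j x) x \<le> (2 ^ j - 1) * a) \<and>
    (\<forall>x\<in>P. dist c (track P j x) \<le> s j \<longrightarrow> dist (track P j x) x \<le> (2 ^ j - 1) * a)"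
proof (induction j)
  case 0
  then show ?case using assms by simp
next
  case (Suc j)
  define b where "b = 2 ^ j * a"
  have b: "a \<le> b" "0 < b" using \<open>a > 0\<close> by (auto simp: b_def)
  have s: "s (Suc j) = s j - 6 * b" by (simp add: s_def b_def algebra_simps)
  have e1: "(2 ^ j - 1) * a = b - a" by (simp add: b_def algebra_simps)
  have e2: "(2 ^ Suc j - 1) * a = 2 * b - a" by (simp add: b_def algebra_simps)
  have e3: "2 ^ Suc j * a = 2 * b" by (simp add: b_def)
  define Q where "Q = track P j ` P"
  define Q' where "Q' = track P' j ` P'"
  from Suc have IH: "good_in c (s j) b Q" "Q \<inter> cball c (s j) = Q' \<inter> cball c (s j)"
    "\<And>x. x \<in> P \<Longrightarrow> dist c x \<le> s j \<Longrightarrow> track P' j x = track P j x \<and> dist (track P j x) x \<le> b - a"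
    "\<And>x. x \<in> P \<Longrightarrow> dist c (track P j x) \<le> s j \<Longrightarrow> dist (track P j x) x \<le> b - a"
    unfolding b_def[symmetric] Q_def[symmetric] Q'_def[symmetric] e1 by blast+
  show ?case
    unfolding e2 e3 track_image_Suc Q_def[symmetric] Q'_def[symmetric] s
  proof (intro conjI ballI impI)
    show "good_in c (s j - 6 * b) (2 * b) ((\<lambda>x. cell_centre x Q) ` Q)"
      by (rule good_in_step[OF b(2) IH(1)])
    show "(\<lambda>x. cell_centre x Q) ` Q \<inter> cball c (s j - 6 * b) = (\<lambda>x. cell_centre x Q') ` Q' \<inter> cball c (s j - 6 * b)"
      by (rule image_agree_step[OF b(2) IH(1,2)])
  next
    fix x assume x: "x \<in> P" "dist c x \<le> s j - 6 * b"
    then have 1: "track P' j x = track P j x" "dist (track P j x) x \<le> b - a"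
      using IH(3)[of x] b by auto
    have "dist c (track P j x) \<le> s j - 4 * b"
      using 1 x b dist_triangle[of c "track P j x" x] \<open>a > 0\<close> by (simp add: dist_commute)
    then have 2: "cell_centre (track P j x) Q = cell_centre (track P j x) Q'"
      by (rule cell_centre_cong_local[OF b(2) IH(1,2)])
    have 3: "dist (cell_centre (track P j x) Q) (track P j x) \<le> b"
      by (rule cell_centre_nearest(2)[OF b(2) IH(1)])
        (use \<open>dist c (track P j x) \<le> s j - 4 * b\<close> b in auto)
    show "track P' (Suc j) x = track P (Suc j) x" using 1 2 by (simp add: Q_def Q'_def)
    show "dist (track P (Suc j) x) x \<le> 2 * b - a"
      using 1 3 dist_triangle[of "cell_centre (track P j x) Q" x "track P j x"] by (simp add: Q_def)
  next
    fix x assume x: "x \<in> P" "dist c (track P (Suc j) x) \<le> s j - 6 * b"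
    then have 1: "dist (cell_centre (track P j x) Q) (track P j x) \<le> b"
      using b by (intro cell_centre_back[OF IH(1)]) (auto simp: Q_def)
    then have "dist c (track P j x) \<le> s j"
      using x b dist_triangle[of c "track P j x" "cell_centre (track P j x) Q"] by (simp add: Q_def)
    then have "dist (track P j x) x \<le> b - a" by (rule IH(4)[OF x(1)])
    then show "dist (track P (Suc j) x) x \<le> 2 * b - a"
      using 1 dist_triangle[of "cell_centre (track P j x) Q" x "track P j x"] by (simp add: Q_def)
  qed
qed

lemma track_local:
  assumes "0 < a" "good_in x (6 * 2 ^ k * a) a P" "P \<inter> cball x (6 * 2 ^ k * a) = P' \<inter> cball x (6 * 2 ^ k * a)"
    "x \<in> P"
  shows "track P' k x = track P k x"
proof -
  have "dist x x \<le> 6 * 2 ^ k * a - 6 * (2 ^ k - 1) * a" using assms(1) by (simp add: algebra_simps)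
  then show ?thesis using track_local_aux[OF assms(1-3), of k] assms(4) by blast
qed

text \<open>The alternative in the hypothesis covers both directions in which a particle can cross
  the sphere of radius \<open>\<rho>\<close> around \<open>c\<close>.\<close>

lemma track_near:
  assumes "0 < a" "good_in c (\<rho> + 6 * 2 ^ k * a) a P" "x \<in> P"
    "dist c x \<le> \<rho> \<or> dist c (track P k x) \<le> \<rho>"
  shows "dist (track P k x) x \<le> 2 ^ k * a"
proof -
  have "\<rho> \<le> \<rho> + 6 * 2 ^ k * a - 6 * (2 ^ k - 1) * a" using assms(1) by (simp add: algebra_simps)
  then have "dist (track P k x) x \<le> (2 ^ k - 1) * a"
    using track_local_aux[OF assms(1,2) refl, of k] assms(3,4) by fastforce
  then show ?thesis using assms(1) by (simp add: algebra_simps)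
qed

section \<open>Configurations with holes of sublinear size\<close>

lemma globally_good_step:
  assumes "globally_good P"
  shows "globally_good ((\<lambda>x. cell_centre x P) ` P)"
  unfolding globally_good_def
proof (intro allI impI)
  fix C R :: real assume C: "0 \<le> C"
  \<comment> \<open>\<open>2 * C\<close> because the hole size doubles, \<open>6\<close> for the
    radius lost in the step.\<close>
  then have "0 \<le> 2 * C + 6" by simp
  then obtain a where a: "a > 0" "good_in 0 (R + (2 * C + 6) * a) a P"
    using assms unfolding globally_good_def by blast
  have eq: "R + C * (2 * a) = R + (2 * C + 6) * a - 6 * a" by (simp add: algebra_simps)
  have "good_in 0 (R + C * (2 * a)) (2 * a) ((\<lambda>x. cell_centre x P) ` P)"
    unfolding eq by (rule good_in_step[OF a])
  then show "\<exists>a>0. good_in 0 (R + C * a) a ((\<lambda>x. cell_centre x P) ` P)"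
    using a(1) by (intro exI[of _ "2 * a"]) auto
qed

lemma globally_good_track: "globally_good P \<Longrightarrow> globally_good (track P k ` P)"
proof (induction k)
  case (Suc k)
  then show ?case unfolding track_image_Suc by (intro globally_good_step)
qed simp

lemma globally_goodE:
  assumes "globally_good P" "0 \<le> C"
  obtains a where "0 < a" "good_in 0 (R + C * a) a P"
  using assms unfolding globally_good_def by blast

lemma globally_good_centre:
  assumes "globally_good P"
  shows "cell_centre x P = centre_of_mass (vcell x P)"
    and "q \<in> P \<Longrightarrow> q \<noteq> x \<Longrightarrow> dist (cell_centre x P) x < dist (cell_centre x P) q"
proof -
  obtain a where a: "0 < a" "good_in 0 (norm x + 2 * a) a P"
    using globally_goodE[OF assms, of 2 "norm x"] by auto
  show "cell_centre x P = centre_of_mass (vcell x P)"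
    by (rule cell_centre_nearest(1)[OF a]) simp
  show "q \<in> P \<Longrightarrow> q \<noteq> x \<Longrightarrow> dist (cell_centre x P) x < dist (cell_centre x P) q"
    by (rule cell_centre_nearest(3)[OF a]) auto
qed

text \<open>A common centre would be strictly nearer to \<open>x\<close> than to \<open>y\<close>
  and strictly nearer to \<open>y\<close> than to \<open>x\<close>.\<close>

lemma globally_good_inj:
  assumes "globally_good P"
  shows "inj_on (\<lambda>x. cell_centre x P) P"
proof (rule inj_onI, rule ccontr)
  fix x y assume "x \<in> P" "y \<in> P" "cell_centre x P = cell_centre y P" "x \<noteq> y"
  then show False
    using globally_good_centre(2)[OF assms, of y x] globally_good_centre(2)[OF assms, of x y] by auto
qed

lemma globally_good_track_inj:
  assumes "globally_good P"
  shows "inj_on (track P k) P"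
proof (induction k)
  case (Suc k)
  have "inj_on ((\<lambda>x. cell_centre x (track P k ` P)) \<circ> track P k) P"
    by (rule comp_inj_on[OF Suc globally_good_inj[OF globally_good_track[OF assms]]])
  then show ?case by (simp add: comp_def)
qed auto

lemma globally_good_finite:
  assumes "globally_good P" "bounded S"
  shows "finite (P \<inter> S)"
proof -
  obtain R where R: "S \<subseteq> cball 0 R" using bounded_subset_ballD[OF assms(2), of 0] ball_subset_cball by blast
  obtain a where a: "0 < a" "good_in 0 (R + 0 * a) a P"
    using globally_goodE[OF assms(1), of 0 R] by auto
  then have "finite (P \<inter> cball 0 R)" by (simp add: good_in_def)
  then show ?thesis by (rule rev_finite_subset) (use R in auto)
qed

lemma globally_good_nonempty: "globally_good P \<Longrightarrow> P \<noteq> {}"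
  using globally_goodE[of P 0 0] by (force simp: good_in_def)

section \<open>Lloyd's algorithm on good configurations\<close>

lemma globally_good_countable:
  fixes P :: "'a::euclidean_space set"
  assumes "globally_good P"
  shows "countable P"
proof -
  have "P = (\<Union>n::nat. P \<inter> cball 0 (real n))"
  proof (rule set_eqI)
    fix x :: 'a
    obtain n :: nat where "norm x \<le> real n" using real_arch_simple by blast
    then have "x \<in> cball 0 (real n)" by simp
    then show "x \<in> P \<longleftrightarrow> x \<in> (\<Union>n::nat. P \<inter> cball 0 (real n))" by blast
  qed
  moreover have "countable (\<Union>n::nat. P \<inter> cball 0 (real n))"
    by (rule countable_UN) (auto intro!: countable_finite[OF globally_good_finite[OF assms]])
  ultimately show ?thesis by (rule ssubst)
qed

section \<open>Nearest neighbours and ties\<close>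

lemma finite_less_fun_minimum:
  fixes N :: "(real ^ ('d::{finite,linorder})) set"
  assumes "finite N" "N \<noteq> {}"
  shows "\<exists>m\<in>N. \<forall>q\<in>N. q \<noteq> m \<longrightarrow> less_fun (($) m) (($) q)"
  using assms
proof (induction N rule: finite_ne_induct)
  case (insert x F)
  then obtain m where m: "m \<in> F" "\<forall>q\<in>F. q \<noteq> m \<longrightarrow> less_fun (($) m) (($) q)" by blast
  have "less_fun (($) x) (($) m) \<or> ($) x = ($) m \<or> less_fun (($) m) (($) x)"
    by (rule less_fun_trichotomy) simp
  moreover have "x \<noteq> m" using insert m by auto
  then have "($) x \<noteq> ($) m" by (simp add: vec_eq_iff fun_eq_iff)
  ultimately consider "less_fun (($) x) (($) m)" | "less_fun (($) m) (($) x)" by blast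
  then show ?case
  proof cases
    case 1
    have "\<forall>q\<in>insert x F. q \<noteq> x \<longrightarrow> less_fun (($) x) (($) q)"
    proof (intro ballI impI)
      fix q assume "q \<in> insert x F" "q \<noteq> x"
      then show "less_fun (($) x) (($) q)" using 1 m(2) less_fun_trans[OF 1] by (cases "q = m") auto
    qed
    then show ?thesis by blast
  next
    case 2
    then show ?thesis using m by blast
  qed
qed simp

definition lex_nearest ::
  "(real ^ ('d::{finite,linorder})) set \<Rightarrow> real ^ ('d::{finite,linorder}) \<Rightarrow> real ^ ('d::{finite,linorder}) \<Rightarrow> bool" where
  "lex_nearest P x p \<longleftrightarrow> p \<in> P \<and> (\<forall>q\<in>P. dist x p \<le> dist x q) \<and>
     (\<forall>q\<in>P. dist x q = dist x p \<longrightarrow> q \<noteq> p \<longrightarrow> less_fun (($) p) (($) q))"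

lemma lex_nearest_ex1:
  fixes P :: "(real ^ ('d::{finite,linorder})) set"
  assumes "globally_good P"
  shows "\<exists>!p. lex_nearest P x p"
proof -
  obtain p0 where p0: "p0 \<in> P" using globally_good_nonempty[OF assms] by blast
  define F where "F = P \<inter> cball x (dist x p0)"
  have F: "finite F" "p0 \<in> F" using globally_good_finite[OF assms] p0 by (auto simp: F_def)
  define m where "m = Min (dist x ` F)"
  define N where "N = {p\<in>F. dist x p = m}"
  have "m \<in> dist x ` F" unfolding m_def using F by (intro Min_in) auto
  then have "N \<noteq> {}" "finite N" using F by (auto simp: N_def)
  then obtain p where p: "p \<in> N" "\<forall>q\<in>N. q \<noteq> p \<longrightarrow> less_fun (($) p) (($) q)"
    using finite_less_fun_minimum by blast
  have le: "m \<le> dist x q" if "q \<in> P" for q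
  proof (cases "q \<in> F")
    case True
    then show ?thesis unfolding m_def using F by auto
  next
    case False
    then have "dist x p0 < dist x q" using that by (auto simp: F_def)
    moreover have "m \<le> dist x p0" unfolding m_def using F by auto
    ultimately show ?thesis by simp
  qed
  show ?thesis
  proof (rule ex1I)
    show "lex_nearest P x p" unfolding lex_nearest_def
    proof (intro conjI ballI impI)
      show "p \<in> P" using p by (simp add: N_def F_def)
      show "dist x p \<le> dist x q" if "q \<in> P" for q using le[OF that] p by (simp add: N_def)
      fix q assume q: "q \<in> P" "dist x q = dist x p" "q \<noteq> p"
      then have "q \<in> N" using p by (auto simp: N_def F_def)
      then show "less_fun (($) p) (($) q)" using p q by blast
    qed
  next
    fix p' assume "lex_nearest P x p'"
    moreover have "lex_nearest P x p" unfolding lex_nearest_def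
      using p le by (auto simp: N_def F_def)
    ultimately show "p' = p" unfolding lex_nearest_def
      by (metis less_fun_asym order_antisym)
  qed
qed

lemma nearest_neighbour_eq_iff:
  assumes "globally_good (points \<phi>)"
  shows "nearest_neighbour x \<phi> = p \<longleftrightarrow> lex_nearest (points \<phi>) x p"
proof -
  have "nearest_neighbour x \<phi> = (THE p. lex_nearest (points \<phi>) x p)"
    by (simp add: nearest_neighbour_def lex_nearest_def)
  then show ?thesis using lex_nearest_ex1[OF assms, of x] by (metis theI')
qed

lemma voronoi_cell_eq:
  assumes "globally_good (points \<phi>)" "x \<in> points \<phi>"
  shows "voronoi_cell x \<phi> = {y. lex_nearest (points \<phi>) y x}"
proof -
  have "lex_nearest (points \<phi>) x x" using assms(2) by (auto simp: lex_nearest_def)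
  then have eq: "nearest_neighbour x \<phi> = x" using nearest_neighbour_eq_iff[OF assms(1)] by blast
  show ?thesis
    unfolding voronoi_cell_def eq by (simp add: nearest_neighbour_eq_iff[OF assms(1)])
qed

lemma AE_not_bisector:
  fixes x q :: "'a::euclidean_space"
  assumes "q \<noteq> x"
  shows "AE y in lborel. dist y q \<noteq> dist y x"
proof -
  have "{y. dist y q = dist y x} = {y. (2 *\<^sub>R (x - q)) \<bullet> y = x \<bullet> x - q \<bullet> q}"
  proof (intro Collect_cong)
    fix y show "dist y q = dist y x \<longleftrightarrow> (2 *\<^sub>R (x - q)) \<bullet> y = x \<bullet> x - q \<bullet> q"
      using dist_less_iff_inner[of y x q] dist_less_iff_inner[of y q x]
      by (simp add: inner_diff_right inner_diff_left inner_commute algebra_simps) linarith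
  qed
  also have "negligible \<dots>" using assms by (intro negligible_hyperplane) auto
  finally have "{y. dist y q = dist y x} \<in> null_sets lebesgue" by (simp add: negligible_iff_null_sets)
  then have "{y. dist y q = dist y x} \<in> null_sets lborel"
    by (subst (asm) null_sets_completion_iff) simp_all
  then show ?thesis by (rule AE_I') auto
qed

text \<open>The lexicographic rule matters only on the bisectors of \<open>x\<close> with the
  countably many other points. These form a null set, so the cell may be replaced by the closed one
  without changing volume or mean.\<close>

lemma centre_of_mass_voronoi_cell:
  assumes good: "globally_good (points \<phi>)" and x: "x \<in> points \<phi>"
  shows "centre_of_mass (voronoi_cell x \<phi>) = cell_centre x (points \<phi>)"
proof -
  define P where "P = points \<phi>"
  define V where "V = {y. lex_nearest P y x}"
  have cP: "countable P" using globally_good_countable[OF good] by (simp add: P_def)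
  \<comment> \<open>Stating the tie rule separately for each \<open>q\<close> shows that
    \<open>V\<close> is Borel: each factor is the whole space or an open half-space.\<close>
  have "V = vcell x P \<inter> (\<Inter>q\<in>P. {y. less_fun (($) x) (($) q) \<or> q = x \<or> dist y x < dist y q})"
  proof (rule set_eqI)
    fix y
    have tie: "(dist y q = dist y x \<longrightarrow> q \<noteq> x \<longrightarrow> less_fun (($) x) (($) q)) \<longleftrightarrow>
        less_fun (($) x) (($) q) \<or> q = x \<or> dist y x < dist y q" if "dist y x \<le> dist y q" for q
      using that by linarith
    have "x \<in> P" using x by (simp add: P_def)
    then show "y \<in> V \<longleftrightarrow> y \<in> vcell x P \<inter> (\<Inter>q\<in>P. {y. less_fun (($) x) (($) q) \<or> q = x \<or> dist y x < dist y q})"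
      unfolding V_def lex_nearest_def vcell_def Int_iff INT_iff mem_Collect_eq using tie by blast
  qed
  also have "\<dots> \<in> sets borel"
  proof (rule sets.Int[OF vcell_borel sets.countable_INT'[OF cP]])
    show "P \<noteq> {}" using x by (auto simp: P_def)
    have "open {y. dist y x < dist y q}" for q
      by (intro open_Collect_less continuous_intros)
    then have "{y. less_fun (($) x) (($) q) \<or> q = x \<or> dist y x < dist y q} \<in> sets borel" for q
      by (cases "less_fun (($) x) (($) q) \<or> q = x") (simp_all add: borel_open)
    then show "(\<lambda>q. {y. less_fun (($) x) (($) q) \<or> q = x \<or> dist y x < dist y q}) ` P \<subseteq> sets borel" by blast
  qed
  finally have [measurable]: "V \<in> sets borel" .
  have "AE y in lborel. \<forall>q\<in>P. q \<noteq> x \<longrightarrow> dist y q \<noteq> dist y x"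
    using AE_not_bisector by (subst AE_ball_countable[OF cP]) auto
  then have ae: "AE y in lborel. y \<in> V \<longleftrightarrow> y \<in> vcell x P"
    by eventually_elim (use x in \<open>auto simp: V_def lex_nearest_def P_def vcell_def\<close>)
  have "measure lborel V = measure lborel (vcell x P)"
    using ae by (intro measure_eq_AE) auto
  moreover have "(LINT y:V|lborel. y) = (LINT y:vcell x P|lborel. y)"
    unfolding set_lebesgue_integral_def
    using ae by (intro integral_cong_AE) (auto simp: indicator_def elim!: eventually_mono)
  ultimately have "centre_of_mass V = centre_of_mass (vcell x P)"
    by (simp add: centre_of_mass_def)
  then show ?thesis
    using voronoi_cell_eq[OF good x] globally_good_centre(1)[OF good, of x]
    by (simp add: V_def P_def)
qed

section \<open>The iterates as images under the particle tracks\<close>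

lemma emeasure_lloyd_step:
  "emeasure (lloyd_step \<psi>) B =
     (if B \<in> sets borel then emeasure (count_space (points \<psi>)) {x\<in>points \<psi>. centre_of_mass (voronoi_cell x \<psi>) \<in> B} else 0)"
proof (cases "B \<in> sets borel")
  case True
  then show ?thesis
    unfolding lloyd_step_def by (subst emeasure_distr) (auto intro!: arg_cong2[where f=emeasure])
next
  case False
  then show ?thesis by (simp add: emeasure_notin_sets lloyd_step_def)
qed

lemma points_lloyd_step:
  "points (lloyd_step \<psi>) = (\<lambda>x. centre_of_mass (voronoi_cell x \<psi>)) ` points \<psi>"
proof -
  have "emeasure (lloyd_step \<psi>) {z} \<noteq> 0 \<longleftrightarrow> (\<exists>x\<in>points \<psi>. centre_of_mass (voronoi_cell x \<psi>) = z)" for z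
    unfolding emeasure_lloyd_step by (auto simp: emeasure_count_space_eq_0)
  then show ?thesis by (auto simp: points_def image_iff)
qed

lemma points_lloyd:
  assumes "globally_good (points \<phi>)"
  shows "points (lloyd k \<phi>) = track (points \<phi>) k ` points \<phi>"
proof (induction k)
  case (Suc k)
  have good: "globally_good (points (lloyd k \<phi>))"
    unfolding Suc by (rule globally_good_track[OF assms])
  have "points (lloyd (Suc k) \<phi>) = (\<lambda>x. cell_centre x (points (lloyd k \<phi>))) ` points (lloyd k \<phi>)"
    by (simp add: points_lloyd_step centre_of_mass_voronoi_cell[OF good])
  then show ?case unfolding Suc track_image_Suc .
qed simp

text \<open>A step gives unit mass to each point of the preceding iterate, and injectivity of the
  track turns the count of those points into a count of starting points. The zeroth iterate is
  excluded because it is \<open>\<phi>\<close> itself, whose atoms may be heavier than one.\<close>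

lemma measure_lloyd_Suc:
  assumes good: "globally_good (points \<phi>)" and "B \<in> sets borel"
  shows "measure (lloyd (Suc k) \<phi>) B = card {x\<in>points \<phi>. track (points \<phi>) (Suc k) x \<in> B}"
proof -
  let ?P = "points \<phi>" let ?Q = "track ?P k ` ?P"
  have goodk: "globally_good (points (lloyd k \<phi>))"
    unfolding points_lloyd[OF good] by (rule globally_good_track[OF good])
  have "{x\<in>points (lloyd k \<phi>). centre_of_mass (voronoi_cell x (lloyd k \<phi>)) \<in> B}
     = {y\<in>?Q. cell_centre y ?Q \<in> B}"
    using centre_of_mass_voronoi_cell[OF goodk] by (auto simp: points_lloyd[OF good])
  also have "\<dots> = track ?P k ` {x\<in>?P. track ?P (Suc k) x \<in> B}" by auto
  finally have *: "{x\<in>points (lloyd k \<phi>). centre_of_mass (voronoi_cell x (lloyd k \<phi>)) \<in> B}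
     = track ?P k ` {x\<in>?P. track ?P (Suc k) x \<in> B}" .
  have inj: "inj_on (track ?P k) {x\<in>?P. track ?P (Suc k) x \<in> B}"
    by (rule inj_on_subset[OF globally_good_track_inj[OF good]]) auto
  have "emeasure (lloyd (Suc k) \<phi>) B =
      emeasure (count_space (points (lloyd k \<phi>))) (track ?P k ` {x\<in>?P. track ?P (Suc k) x \<in> B})"
    using assms(2) by (simp only: lloyd.simps emeasure_lloyd_step if_True *)
  then have "measure (lloyd (Suc k) \<phi>) B =
      measure (count_space (points (lloyd k \<phi>))) (track ?P k ` {x\<in>?P. track ?P (Suc k) x \<in> B})"
    by (simp add: measure_def)
  also have "\<dots> = card (track ?P k ` {x\<in>?P. track ?P (Suc k) x \<in> B})"
  proof -
    have "track ?P k ` {x\<in>?P. track ?P (Suc k) x \<in> B} \<subseteq> points (lloyd k \<phi>)"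
      unfolding points_lloyd[OF good] by blast
    then show ?thesis by (simp add: measure_def emeasure_count_space del: track.simps)
  qed
  also have "\<dots> = card {x\<in>?P. track ?P (Suc k) x \<in> B}"
    using card_image[OF inj] by simp
  finally show ?thesis .
qed

section \<open>Random sets with measurable void events\<close>

text \<open>Stated for an arbitrary sigma-algebra, so that the same measurability results serve the
  whole process, its restriction to a window with the sigma-algebra of that window, and compositions
  with projections.\<close>

definition void_measurable :: "'n measure \<Rightarrow> ('n \<Rightarrow> 'a::euclidean_space set) \<Rightarrow> bool" where
  "void_measurable N P \<longleftrightarrow> (\<forall>\<omega>\<in>space N. \<forall>B. bounded B \<longrightarrow> finite (P \<omega> \<inter> B)) \<and>
     (\<forall>B\<in>sets borel. {\<omega>\<in>space N. P \<omega> \<inter> B = {}} \<in> sets N)"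

lemma void_measurable_finite:
  "void_measurable N P \<Longrightarrow> \<omega> \<in> space N \<Longrightarrow> bounded B \<Longrightarrow> finite (P \<omega> \<inter> B)"
  by (auto simp: void_measurable_def)

lemma void_measurable_sets:
  "void_measurable N P \<Longrightarrow> B \<in> sets borel \<Longrightarrow> {\<omega>\<in>space N. P \<omega> \<inter> B = {}} \<in> sets N"
  by (auto simp: void_measurable_def)

lemma void_measurable_compose:
  assumes "void_measurable N P" "f \<in> L \<rightarrow>\<^sub>M N"
  shows "void_measurable L (\<lambda>z. P (f z))"
  unfolding void_measurable_def
proof (intro conjI ballI allI impI)
  show "finite (P (f z) \<inter> B)" if "z \<in> space L" "bounded B" for z B
    using void_measurable_finite[OF assms(1) measurable_space[OF assms(2) that(1)] that(2)] .
  fix B :: "'b set" assume "B \<in> sets borel"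
  from measurable_sets[OF assms(2) void_measurable_sets[OF assms(1) this]]
  show "{z \<in> space L. P (f z) \<inter> B = {}} \<in> sets L"
    by (rule back_subst[of "\<lambda>A. A \<in> sets L"]) (use measurable_space[OF assms(2)] in auto)
qed

text \<open>This expresses the counts through countably many void events.\<close>

lemma card_ge_iff_disjoint_basis:
  fixes S :: "'a::metric_space set"
  assumes "topological_basis \<B>" "finite S"
  shows "n \<le> card S \<longleftrightarrow>
    (\<exists>F. F \<subseteq> \<B> \<and> finite F \<and> card F = n \<and> disjoint F \<and> (\<forall>U\<in>F. S \<inter> U \<noteq> {}))"
proof
  assume "n \<le> card S"
  then obtain T where T: "T \<subseteq> S" "card T = n" "finite T"
    using obtain_subset_with_card_n by metis
  \<comment> \<open>The factor \<open>2\<close> makes the neighbourhoods of different points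
    disjoint: a common point would violate the triangle inequality.\<close>
  have "\<exists>U\<in>\<B>. t \<in> U \<and> U \<inter> T = {t} \<and> (\<forall>s\<in>T. s \<noteq> t \<longrightarrow> (\<forall>u\<in>U. 2 * dist t u < dist t s))" if t: "t \<in> T" for t
  proof -
    from finite_set_avoid[OF T(3), of t] obtain d where d: "d > 0" "\<forall>x\<in>T. x \<noteq> t \<longrightarrow> d \<le> dist t x" by blast
    obtain U where U: "U \<in> \<B>" "t \<in> U" "U \<subseteq> ball t (d / 2)"
      using topological_basisE[OF assms(1) open_ball, of t t "d/2"] d by auto
    have less: "2 * dist t u < dist t s" if "s \<in> T" "s \<noteq> t" "u \<in> U" for s u
      using d(2) U(3) that by (force simp: subset_eq)
    have "s = t" if "s \<in> U" "s \<in> T" for s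
      using less[of s s] that zero_le_dist[of t s] by (cases "s = t") auto
    then have "U \<inter> T = {t}" using t U(2) by blast
    then show ?thesis using U(1,2) less by (intro bexI[of _ U]) simp_all
  qed
  then obtain U where U: "\<And>t. t \<in> T \<Longrightarrow> U t \<in> \<B> \<and> t \<in> U t \<and> U t \<inter> T = {t} \<and>
     (\<forall>s\<in>T. s \<noteq> t \<longrightarrow> (\<forall>u\<in>U t. 2 * dist t u < dist t s))" by metis
  have disj: "U t \<inter> U s = {}" if "t \<in> T" "s \<in> T" "s \<noteq> t" for s t
  proof (rule ccontr)
    assume "U t \<inter> U s \<noteq> {}"
    then obtain u where "u \<in> U t" "u \<in> U s" by blast
    then have "2 * dist t u < dist t s" "2 * dist s u < dist s t" using U that by metis+
    then show False using dist_triangle[of t s u] by (simp add: dist_commute)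
  qed
  have "inj_on U T" by (rule inj_onI) (use U in blast)
  then have "card (U ` T) = n" using T by (simp add: card_image)
  moreover have "disjoint (U ` T)" using disj by (auto simp: disjoint_def)
  moreover have "\<forall>V\<in>U ` T. S \<inter> V \<noteq> {}" using U T by blast
  ultimately show "\<exists>F. F \<subseteq> \<B> \<and> finite F \<and> card F = n \<and> disjoint F \<and> (\<forall>U\<in>F. S \<inter> U \<noteq> {})"
    using U T(3) by (intro exI[of _ "U ` T"]) auto
next
  assume "\<exists>F. F \<subseteq> \<B> \<and> finite F \<and> card F = n \<and> disjoint F \<and> (\<forall>U\<in>F. S \<inter> U \<noteq> {})"
  then obtain F where F: "finite F" "card F = n" "disjoint F" "\<forall>U\<in>F. S \<inter> U \<noteq> {}" by blast
  then have "\<forall>U\<in>F. \<exists>x. x \<in> S \<inter> U" by blast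
  then obtain f where "\<forall>U\<in>F. f U \<in> S \<inter> U" using bchoice by metis
  then have f: "\<And>U. U \<in> F \<Longrightarrow> f U \<in> S \<inter> U" by blast
  have "inj_on f F"
    by (rule inj_onI) (use F(3) f in \<open>unfold disjoint_def, metis IntD2 IntI empty_iff\<close>)
  then have "card F \<le> card S"
    by (rule card_inj_on_le) (use f assms(2) in auto)
  then show "n \<le> card S" using F by simp
qed

lemma measurable_card_void:
  assumes "void_measurable N P" "B \<in> sets borel" "bounded B"
  shows "(\<lambda>\<omega>. card (P \<omega> \<inter> B)) \<in> N \<rightarrow>\<^sub>M count_space UNIV"
proof -
  obtain \<B> :: "'b set set" where \<B>: "countable \<B>" "topological_basis \<B>"
    using ex_countable_basis by blast
  have ge: "{\<omega>\<in>space N. n \<le> card (P \<omega> \<inter> B)} \<in> sets N" for n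
  proof -
    define \<F> where "\<F> = {F \<in> {F. F \<subseteq> \<B> \<and> finite F}. card F = n \<and> disjoint F}"
    have "countable {F. F \<subseteq> \<B> \<and> finite F}"
      using countable_Collect_finite_subset[OF \<B>(1)] by (simp add: conj_commute)
    then have c: "countable \<F>" unfolding \<F>_def by (rule countable_Collect)
    have "{\<omega>\<in>space N. n \<le> card (P \<omega> \<inter> B)} =
       (\<Union>F\<in>\<F>. {\<omega>\<in>space N. \<forall>U\<in>F. P \<omega> \<inter> (B \<inter> U) \<noteq> {}})"
      using card_ge_iff_disjoint_basis[OF \<B>(2) void_measurable_finite[OF assms(1) _ assms(3)]]
      by (auto simp: \<F>_def Int_assoc)
    also have "\<dots> \<in> sets N"
    proof (rule sets.countable_UN''[OF c])
      fix F assume F: "F \<in> \<F>"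
      then have fin: "finite F" and F\<B>: "F \<subseteq> \<B>" by (auto simp: \<F>_def)
      have "{\<omega>\<in>space N. P \<omega> \<inter> (B \<inter> U) \<noteq> {}} \<in> sets N" if "U \<in> F" for U
      proof -
        have "open U" using that F\<B> \<B>(2) topological_basis_open by blast
        then have "B \<inter> U \<in> sets borel" using assms(2) by auto
        from void_measurable_sets[OF assms(1) this] show ?thesis
          by (rule sets.sets_Collect_neg)
      qed
      then show "{\<omega>\<in>space N. \<forall>U\<in>F. P \<omega> \<inter> (B \<inter> U) \<noteq> {}} \<in> sets N"
        using fin by (intro sets.sets_Collect_finite_All)
    qed
    finally show ?thesis .
  qed
  have "(\<lambda>\<omega>. card (P \<omega> \<inter> B)) -` {n} \<inter> space N \<in> sets N" for n :: nat
  proof -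
    have "(\<lambda>\<omega>. card (P \<omega> \<inter> B)) -` {n} \<inter> space N =
       {\<omega>\<in>space N. n \<le> card (P \<omega> \<inter> B)} - {\<omega>\<in>space N. Suc n \<le> card (P \<omega> \<inter> B)}" by auto
    then show ?thesis using ge by auto
  qed
  then show ?thesis by (subst measurable_count_space_eq2_countable) auto
qed

text \<open>A sigma-additive count that is infinite on infinite sets, where \<open>card\<close>
  would return zero.\<close>

definition pcount :: "'a set \<Rightarrow> ennreal" where
  "pcount S = emeasure (count_space UNIV) S"

lemma pcount_finite [simp]: "finite S \<Longrightarrow> pcount S = of_nat (card S)"
  by (simp add: pcount_def)

text \<open>A Dynkin argument over the rectangles that generate the product. The bounded set
  \<open>B\<close> keeps all counts finite, so that the count for a complement is obtained by
  subtraction.\<close>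

lemma measurable_pcount_section_bounded:
  assumes P: "void_measurable N P" and B: "B \<in> sets borel" "bounded B" and S: "S \<in> sets (N \<Otimes>\<^sub>M borel)"
  shows "(\<lambda>\<omega>. pcount (P \<omega> \<inter> B \<inter> Pair \<omega> -` S)) \<in> borel_measurable N"
proof -
  have fin: "finite (P \<omega> \<inter> B)" if "\<omega> \<in> space N" for \<omega>
    using void_measurable_finite[OF P that B(2)] .
  have S': "S \<in> sigma_sets (space N \<times> space borel) {a \<times> b |a b. a \<in> sets N \<and> b \<in> sets borel}"
    using S by (simp add: sets_pair_measure)
  show ?thesis
    using Int_stable_pair_measure_generator pair_measure_closed S'
  proof (induct rule: sigma_sets_induct_disjoint)
    case (basic A)
    then obtain a b where ab: "A = a \<times> b" "a \<in> sets N" "b \<in> sets borel" by auto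
    have "(\<lambda>\<omega>. indicator a \<omega> * of_nat (card (P \<omega> \<inter> (B \<inter> b))) :: ennreal) \<in> borel_measurable N"
    proof -
      have "(\<lambda>\<omega>. card (P \<omega> \<inter> (B \<inter> b))) \<in> N \<rightarrow>\<^sub>M count_space UNIV"
        using P B ab by (intro measurable_card_void) (auto intro: bounded_Int)
      then have [measurable]: "(\<lambda>\<omega>. of_nat (card (P \<omega> \<inter> (B \<inter> b))) :: ennreal) \<in> borel_measurable N"
        by (rule measurable_compose) simp
      have "(indicator a :: _ \<Rightarrow> ennreal) \<in> borel_measurable N" using ab(2) by simp
      then show ?thesis by (rule borel_measurable_times_ennreal) fact
    qed
    moreover have "pcount (P \<omega> \<inter> B \<inter> Pair \<omega> -` A) = indicator a \<omega> * of_nat (card (P \<omega> \<inter> (B \<inter> b)))"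
      if "\<omega> \<in> space N" for \<omega>
    proof (cases "\<omega> \<in> a")
      case True
      then have "P \<omega> \<inter> B \<inter> Pair \<omega> -` A = P \<omega> \<inter> (B \<inter> b)" by (auto simp: ab)
      moreover have "finite (P \<omega> \<inter> (B \<inter> b))" using fin[OF that] by (rule rev_finite_subset) auto
      ultimately show ?thesis using True by simp
    qed (auto simp: ab)
    ultimately show ?case by (subst measurable_cong) auto
  next
    case empty
    then show ?case by simp
  next
    case (compl A)
    have A: "A \<subseteq> space N \<times> UNIV"
      using sigma_sets_into_sp[OF pair_measure_closed compl(1)] by simp
    have [measurable]: "(\<lambda>\<omega>. of_nat (card (P \<omega> \<inter> B)) :: ennreal) \<in> borel_measurable N"
      by (rule measurable_compose[OF measurable_card_void[OF P B]]) simp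
    note compl(2)[measurable]
    have "pcount (P \<omega> \<inter> B \<inter> Pair \<omega> -` (space N \<times> space borel - A))
        = of_nat (card (P \<omega> \<inter> B)) - pcount (P \<omega> \<inter> B \<inter> Pair \<omega> -` A)" if "\<omega> \<in> space N" for \<omega>
    proof -
      have "P \<omega> \<inter> B \<inter> Pair \<omega> -` (space N \<times> space borel - A) = P \<omega> \<inter> B - P \<omega> \<inter> B \<inter> Pair \<omega> -` A"
        using that by auto
      moreover have "emeasure (count_space UNIV) (P \<omega> \<inter> B - P \<omega> \<inter> B \<inter> Pair \<omega> -` A) =
         emeasure (count_space UNIV) (P \<omega> \<inter> B) - emeasure (count_space UNIV) (P \<omega> \<inter> B \<inter> Pair \<omega> -` A)"
        using fin[OF that] by (intro emeasure_Diff) auto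
      ultimately show ?thesis using fin[OF that] by (simp add: pcount_def)
    qed
    then show ?case by (subst measurable_cong) auto
  next
    case (union A)
    note union(3)[measurable]
    have "pcount (P \<omega> \<inter> B \<inter> Pair \<omega> -` (\<Union>i. A i)) = (\<Sum>i. pcount (P \<omega> \<inter> B \<inter> Pair \<omega> -` A i))" for \<omega>
    proof -
      have "disjoint_family (\<lambda>i. P \<omega> \<inter> B \<inter> Pair \<omega> -` A i)"
        using union(1) by (auto simp: disjoint_family_on_def)
      moreover have "P \<omega> \<inter> B \<inter> Pair \<omega> -` (\<Union>i. A i) = (\<Union>i. P \<omega> \<inter> B \<inter> Pair \<omega> -` A i)" by auto
      ultimately show ?thesis unfolding pcount_def by (simp add: suminf_emeasure)
    qed
    then show ?case by simp
  qed
qed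

lemma measurable_pcount_section:
  assumes P: "void_measurable N P" and S: "S \<in> sets (N \<Otimes>\<^sub>M borel)"
  shows "(\<lambda>\<omega>. pcount {x\<in>P \<omega>. (\<omega>, x) \<in> S}) \<in> borel_measurable N"
proof -
  have "pcount {x\<in>P \<omega>. (\<omega>, x) \<in> S} = (SUP n::nat. pcount (P \<omega> \<inter> cball 0 (real n) \<inter> Pair \<omega> -` S))" for \<omega>
  proof -
    have "(SUP n::nat. pcount (P \<omega> \<inter> cball 0 (real n) \<inter> Pair \<omega> -` S))
       = emeasure (count_space UNIV) (\<Union>n::nat. P \<omega> \<inter> cball 0 (real n) \<inter> Pair \<omega> -` S)"
      unfolding pcount_def by (rule SUP_emeasure_incseq) (auto simp: incseq_def)
    also have "(\<Union>n::nat. P \<omega> \<inter> cball 0 (real n) \<inter> Pair \<omega> -` S) = {x\<in>P \<omega>. (\<omega>, x) \<in> S}"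
      using real_arch_simple by auto
    finally show ?thesis by (simp add: pcount_def)
  qed
  moreover have "(\<lambda>\<omega>. SUP n::nat. pcount (P \<omega> \<inter> cball 0 (real n) \<inter> Pair \<omega> -` S)) \<in> borel_measurable N"
    by (intro borel_measurable_SUP measurable_pcount_section_bounded[OF P _ _ S]) auto
  ultimately show ?thesis by simp
qed

text \<open>A quantifier over the random points becomes measurable as the vanishing of a count; this
  takes the place of a measurable enumeration of the points.\<close>

lemma void_section_sets:
  assumes P: "void_measurable N P" and S: "S \<in> sets (N \<Otimes>\<^sub>M borel)"
  shows "{\<omega>\<in>space N. \<forall>x\<in>P \<omega>. (\<omega>, x) \<notin> S} \<in> sets N"
proof -
  note measurable_pcount_section[OF assms, measurable]
  have "{\<omega>\<in>space N. \<forall>x\<in>P \<omega>. (\<omega>, x) \<notin> S} = {\<omega>\<in>space N. pcount {x\<in>P \<omega>. (\<omega>, x) \<in> S} = 0}"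
    by (auto simp: pcount_def emeasure_count_space_eq_0)
  also have "\<dots> \<in> sets N" by measurable
  finally show ?thesis .
qed

section \<open>Measurability of the particle tracks\<close>

lemma measurable_centre_of_mass_section:
  assumes V: "V \<in> sets (L \<Otimes>\<^sub>M lborel)"
  shows "(\<lambda>p. centre_of_mass {y::'a::euclidean_space. (p, y) \<in> V}) \<in> borel_measurable L"
proof -
  note V[measurable]
  have 1: "(\<lambda>p. emeasure lborel (Pair p -` V)) \<in> borel_measurable L"
    by (rule lborel.measurable_emeasure_Pair[OF V])
  have 2: "(\<lambda>p. \<integral>y. indicator V (p, y) *\<^sub>R y \<partial>lborel) \<in> borel_measurable L"
    by (rule lborel.borel_measurable_lebesgue_integral) measurable
  have "centre_of_mass {y. (p, y) \<in> V} =
     inverse (enn2real (emeasure lborel (Pair p -` V))) *\<^sub>R (\<integral>y. indicator V (p, y) *\<^sub>R y \<partial>lborel)" for p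
    by (simp add: centre_of_mass_def measure_def vimage_def set_lebesgue_integral_def indicator_def)
  then show ?thesis using 1 2 by simp
qed

text \<open>The induction needs joint measurability in the sample point and the starting point,
  since the next cell is cut out by the positions \<open>T (\<omega>, q)\<close> of all random
  points \<open>q\<close>. That no such position is nearer is a void event over a product space.
  Hence the cells are the sections of a measurable set \<open>V\<close>, and their centres are
  measurable by Fubini's theorem.\<close>

lemma measurable_track:
  assumes P: "void_measurable N P"
  shows "(\<lambda>p. track (P (fst p)) k (snd p)) \<in> borel_measurable (N \<Otimes>\<^sub>M borel)"
proof (induction k)
  case (Suc k)
  define T where "T p = track (P (fst p)) k (snd p)" for p
  define L where "L = N \<Otimes>\<^sub>M (borel :: 'b measure)"
  have [measurable]: "T \<in> L \<rightarrow>\<^sub>M borel" using Suc by (simp add: T_def[abs_def] L_def)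
  define D :: "(('a \<times> 'b) \<times> 'b) measure" where "D = L \<Otimes>\<^sub>M lborel"
  define V where "V = {z\<in>space D. \<forall>q\<in>P (fst (fst z)). dist (snd z) (T (fst z)) \<le> dist (snd z) (T (fst (fst z), q))}"
  have VD: "V \<in> sets D"
  proof -
    define S where "S = {w\<in>space (D \<Otimes>\<^sub>M borel). dist (snd (fst w)) (T (fst (fst (fst w)), snd w)) < dist (snd (fst w)) (T (fst (fst w)))}"
    have [measurable]: "(\<lambda>w. T (fst (fst (fst w)), snd w)) \<in> borel_measurable (D \<Otimes>\<^sub>M (borel :: 'b measure))"
    proof (rule measurable_compose[of _ _ L T])
      show "(\<lambda>w. (fst (fst (fst w)), snd w)) \<in> D \<Otimes>\<^sub>M (borel :: 'b measure) \<rightarrow>\<^sub>M L"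
        unfolding D_def L_def by measurable
    qed measurable
    have [measurable]: "(\<lambda>w. T (fst (fst w))) \<in> borel_measurable (D \<Otimes>\<^sub>M (borel :: 'b measure))"
      "(\<lambda>w. snd (fst w)) \<in> borel_measurable (D \<Otimes>\<^sub>M (borel :: 'b measure))"
      unfolding D_def by measurable
    have S: "S \<in> sets (D \<Otimes>\<^sub>M borel)" unfolding S_def by measurable
    have "void_measurable D (\<lambda>z. P (fst (fst z)))"
      by (rule void_measurable_compose[OF P]) (simp add: D_def L_def)
    from void_section_sets[OF this S]
    have "{z\<in>space D. \<forall>q\<in>P (fst (fst z)). (z, q) \<notin> S} \<in> sets D" .
    also have "{z\<in>space D. \<forall>q\<in>P (fst (fst z)). (z, q) \<notin> S} = V"
      by (auto simp: V_def S_def space_pair_measure)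
    finally show ?thesis .
  qed
  define c where "c p = centre_of_mass {y. (p, y) \<in> V}" for p
  have [measurable]: "c \<in> borel_measurable L"
    unfolding c_def using VD by (intro measurable_centre_of_mass_section) (simp only: D_def)
  have [measurable]: "V \<in> sets (L \<Otimes>\<^sub>M lborel)" using VD unfolding D_def .
  have sec: "{y. (p, y) \<in> V} = vcell (T p) (T ` ({fst p} \<times> P (fst p)))" if "p \<in> space L" for p
    using that by (auto simp: V_def vcell_def D_def space_pair_measure)
  have "(\<lambda>p. if (p, c p) \<in> V then c p else T p) \<in> borel_measurable L" by measurable
  moreover have "track (P (fst p)) (Suc k) (snd p) = (if (p, c p) \<in> V then c p else T p)" if "p \<in> space L" for p
  proof -
    have "T ` ({fst p} \<times> P (fst p)) = track (P (fst p)) k ` P (fst p)" by (force simp: T_def)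
    then have v: "vcell (track (P (fst p)) k (snd p)) (track (P (fst p)) k ` P (fst p)) = {y. (p, y) \<in> V}"
      using sec[OF that] by (simp add: T_def)
    show ?thesis by (simp add: cell_centre_def v c_def Let_def T_def)
  qed
  ultimately show ?case unfolding L_def[symmetric] by (subst measurable_cong) auto
qed simp

lemma measurable_pcount_track:
  assumes P: "void_measurable N P" and "A \<in> sets borel" "B \<in> sets borel"
  shows "(\<lambda>\<omega>. pcount {x\<in>P \<omega>. x \<in> A \<and> track (P \<omega>) k x \<in> B}) \<in> borel_measurable N"
proof -
  note measurable_track[OF P, measurable] assms(2,3)[measurable]
  define S where "S = {p\<in>space (N \<Otimes>\<^sub>M borel). snd p \<in> A \<and> track (P (fst p)) k (snd p) \<in> B}"
  have "S \<in> sets (N \<Otimes>\<^sub>M borel)" unfolding S_def by measurable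
  from measurable_pcount_section[OF P this]
  show ?thesis
    by (rule measurable_cong[THEN iffD1, rotated])
       (auto simp: S_def space_pair_measure intro!: arg_cong[where f=pcount])
qed

section \<open>Cubes\<close>

definition cube_index :: "real \<Rightarrow> real ^ 'd \<Rightarrow> 'd::finite \<Rightarrow> int" where
  "cube_index s x = (\<lambda>i. \<lfloor>x $ i / s\<rfloor>)"

definition cube :: "real \<Rightarrow> ('d::finite \<Rightarrow> int) \<Rightarrow> (real ^ 'd) set" where
  "cube s z = {x. cube_index s x = z}"

lemma cube_disjoint: "z \<noteq> w \<Longrightarrow> cube s z \<inter> cube s w = {}"
  by (auto simp: cube_def)

lemma cube_index_coordinate:
  assumes "0 < s"
  shows "of_int (cube_index s x i) * s \<le> x $ i" "x $ i < (of_int (cube_index s x i) + 1) * s"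
proof -
  have "of_int (cube_index s x i) \<le> x $ i / s" "x $ i / s < of_int (cube_index s x i) + 1"
    unfolding cube_index_def by linarith+
  then show "of_int (cube_index s x i) * s \<le> x $ i" "x $ i < (of_int (cube_index s x i) + 1) * s"
    by (simp_all only: pos_le_divide_eq[OF assms] pos_divide_less_eq[OF assms])
qed

lemma cube_index_borel [measurable]:
  "(\<lambda>x. cube_index s x i) \<in> borel \<rightarrow>\<^sub>M count_space UNIV"
  unfolding cube_index_def by measurable

lemma cube_index_sets:
  "finite I \<Longrightarrow> {x. \<forall>i\<in>I. P i (cube_index s x i)} \<in> sets borel"
proof -
  assume "finite I"
  then have "{x\<in>space borel. \<forall>i\<in>I. P i (cube_index s x i)} \<in> sets borel"
    by (intro sets.sets_Collect_finite_All) measurable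
  then show ?thesis by simp
qed

lemma cube_borel [measurable, simp]: "cube s z \<in> sets borel"
  using cube_index_sets[of UNIV "\<lambda>i n. n = z i" s] by (simp add: cube_def fun_eq_iff)

lemma
  fixes z :: "'d::finite \<Rightarrow> int"
  assumes "0 < s"
  shows emeasure_cube: "emeasure lborel (cube s z) = ennreal (s ^ CARD('d))"
    and measure_cube: "measure lborel (cube s z) = s ^ CARD('d)"
    and bounded_cube: "bounded (cube s z)"
proof -
  define a :: "real ^ 'd" where "a = (\<chi> i. of_int (z i) * s)"
  define b :: "real ^ 'd" where "b = (\<chi> i. (of_int (z i) + 1) * s)"
  have sub: "cube s z \<subseteq> cbox a b"
    using cube_index_coordinate(1)[OF assms] less_imp_le[OF cube_index_coordinate(2)[OF assms]]
    by (auto simp: cube_def mem_box_cart a_def b_def)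
  have sup: "box a b \<subseteq> cube s z"
  proof
    fix x assume x: "x \<in> box a b"
    have "\<lfloor>x $ i / s\<rfloor> = z i" for i
      using x assms unfolding floor_eq_iff by (simp add: mem_box_cart a_def b_def field_simps less_imp_le)
    then show "x \<in> cube s z" by (simp add: cube_def cube_index_def fun_eq_iff)
  qed
  have "a \<in> cbox a b" using assms by (simp add: mem_box_cart a_def b_def)
  then have "measure lborel (cbox a b) = (\<Prod>i\<in>UNIV. b $ i - a $ i)"
    by (intro content_cbox_cart) auto
  also have "\<dots> = s ^ CARD('d)" by (simp add: a_def b_def algebra_simps)
  finally have "emeasure lborel (cbox a b) = ennreal (s ^ CARD('d))"
    by (simp add: emeasure_eq_ennreal_measure emeasure_lborel_cbox_finite[unfolded infinity_ennreal_def] less_imp_neq)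
  moreover have "emeasure lborel (box a b) = emeasure lborel (cbox a b)"
    by (simp add: emeasure_lborel_box_eq emeasure_lborel_cbox_eq)
  moreover have "emeasure lborel (box a b) \<le> emeasure lborel (cube s z)"
    "emeasure lborel (cube s z) \<le> emeasure lborel (cbox a b)"
    using sub sup by (auto intro: emeasure_mono)
  ultimately show "emeasure lborel (cube s z) = ennreal (s ^ CARD('d))" by simp
  then show "measure lborel (cube s z) = s ^ CARD('d)" using assms by (simp add: measure_def)
  show "bounded (cube s z)" using sub bounded_cbox bounded_subset by blast
qed

lemma dist_le_sum_coordinates:
  fixes x y :: "real ^ 'd::finite"
  assumes "\<And>i. \<bar>x $ i - y $ i\<bar> \<le> t"
  shows "dist x y \<le> real CARD('d) * t"
proof -
  have "dist x y \<le> (\<Sum>i\<in>UNIV. \<bar>(x - y) $ i\<bar>)" unfolding dist_norm by (rule norm_le_l1_cart)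
  also have "\<dots> \<le> (\<Sum>i\<in>(UNIV :: 'd set). t)" using assms by (intro sum_mono) simp
  finally show ?thesis by simp
qed

lemma dist_in_cube:
  fixes x y :: "real ^ 'd::finite"
  assumes "0 < s" "x \<in> cube s z" "y \<in> cube s z"
  shows "dist x y \<le> real CARD('d) * s"
proof (rule dist_le_sum_coordinates)
  fix i
  have "cube_index s x i = cube_index s y i" using assms by (simp add: cube_def)
  then show "\<bar>x $ i - y $ i\<bar> \<le> s"
    using cube_index_coordinate[OF assms(1), of x i] cube_index_coordinate[OF assms(1), of y i]
    by (simp add: algebra_simps)
qed

definition index_box :: "nat \<Rightarrow> ('d::finite \<Rightarrow> int) set" where
  "index_box K = PiE UNIV (\<lambda>_. {- int K..int K})"

lemma mem_index_box: "z \<in> index_box K \<longleftrightarrow> (\<forall>i. \<bar>z i\<bar> \<le> int K)"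
  by (auto simp: index_box_def abs_le_iff PiE_iff) (metis minus_le_iff)+

lemma finite_index_box [simp]: "finite (index_box K)"
  unfolding index_box_def by (intro finite_PiE) auto

lemma card_index_box: "card (index_box K :: ('d::finite \<Rightarrow> int) set) = (2 * K + 1) ^ CARD('d)"
  unfolding index_box_def by (subst card_PiE) (auto simp: nat_add_distrib nat_mult_distrib)

lemma cube_index_in_index_box:
  fixes x :: "real ^ 'd::finite"
  assumes "0 < s" "norm x \<le> real K * s"
  shows "cube_index s x \<in> index_box K"
  unfolding mem_index_box
proof
  fix i
  have "\<bar>x $ i\<bar> \<le> real K * s" using component_le_norm_cart[of x i] assms(2) by simp
  then have 1: "- real K \<le> x $ i / s" "x $ i / s \<le> real K" using assms(1) by (auto simp: field_simps abs_le_iff)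
  have "- int K \<le> \<lfloor>x $ i / s\<rfloor>" using 1 by (simp add: le_floor_iff)
  moreover have "\<lfloor>x $ i / s\<rfloor> \<le> int K" using 1 by (simp add: floor_le_iff)
  ultimately show "\<bar>cube_index s x i\<bar> \<le> int K" by (simp add: cube_index_def)
qed

text \<open>A block of cubes described through indices, so that disjointness of two windows is a
  condition on integer vectors.\<close>

definition window :: "real \<Rightarrow> nat \<Rightarrow> ('d::finite \<Rightarrow> int) \<Rightarrow> (real ^ 'd) set" where
  "window s J z = {x. \<forall>i. \<bar>cube_index s x i - z i\<bar> \<le> int J}"

lemma window_borel [measurable, simp]: "window s J z \<in> sets borel"
  using cube_index_sets[of UNIV "\<lambda>i n. \<bar>n - z i\<bar> \<le> int J" s] by (simp add: window_def)

lemma cube_subset_window: "cube s z \<subseteq> window s J z"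
  by (auto simp: cube_def window_def)

lemma cball_subset_window:
  assumes "0 < s" "x \<in> cube s z" "\<rho> \<le> real J * s"
  shows "cball x \<rho> \<subseteq> window s (J + 1) z"
proof
  fix y assume "y \<in> cball x \<rho>"
  then have d: "norm (x - y) \<le> real J * s" using assms(3) by (simp add: dist_norm)
  have "\<bar>cube_index s y i - cube_index s x i\<bar> \<le> int (J + 1)" for i
  proof -
    have "\<bar>x $ i - y $ i\<bar> \<le> real J * s"
      using component_le_norm_cart[of "x - y" i] d by simp
    then have "\<bar>x $ i / s - y $ i / s\<bar> \<le> real J"
      using assms(1) by (simp add: field_simps abs_le_iff)
    then show ?thesis unfolding cube_index_def by linarith
  qed
  then show "y \<in> window s (J + 1) z" using assms(2) by (auto simp: window_def cube_def)
qed

lemma windows_disjoint: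
  assumes "\<not> (\<lambda>i. w i - z i) \<in> index_box (2 * J)"
  shows "window s J z \<inter> window s J w = {}"
proof (rule ccontr)
  assume "\<not> ?thesis"
  then obtain x where x: "x \<in> window s J z" "x \<in> window s J w" by blast
  have "\<bar>w i - z i\<bar> \<le> int (2 * J)" for i
  proof -
    have "\<bar>cube_index s x i - z i\<bar> \<le> int J" "\<bar>cube_index s x i - w i\<bar> \<le> int J"
      using x by (auto simp: window_def)
    then show ?thesis by linarith
  qed
  then show False using assms by (simp add: mem_index_box)
qed

section \<open>Counting measures\<close>

lemma lfcm_sets: "locally_finite_counting_measure \<phi> \<Longrightarrow> sets \<phi> = sets borel"
  by (simp add: locally_finite_counting_measure_def)

lemma lfcm_natE:
  assumes "locally_finite_counting_measure \<phi>" "B \<in> sets borel" "bounded B"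
  obtains n :: nat where "emeasure \<phi> B = of_nat n"
  using assms unfolding locally_finite_counting_measure_def by blast

text \<open>The masses of \<open>C\<close> in shrinking balls around a point are natural numbers and
  converge to the mass of at most that point, which is zero; so one of them is zero. Lindelof's
  theorem then covers \<open>C\<close> by countably many null sets.\<close>

lemma lfcm_null_bounded:
  assumes \<phi>: "locally_finite_counting_measure \<phi>" and C: "C \<in> sets borel" "bounded C"
    and disj: "points \<phi> \<inter> C = {}"
  shows "emeasure \<phi> C = 0"
proof -
  note [simp] = lfcm_sets[OF \<phi>]
  have "\<exists>U. open U \<and> x \<in> U \<and> emeasure \<phi> (C \<inter> U) = 0" for x :: 'a
  proof -
    define A where "A i = C \<inter> ball x (1 / real (Suc i))" for i
    have "(\<lambda>i. emeasure \<phi> (A i)) \<longlonglongrightarrow> emeasure \<phi> (\<Inter>i. A i)"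
    proof (rule Lim_emeasure_decseq)
      show "range A \<subseteq> sets \<phi>" using C by (auto simp: A_def)
      show "decseq A"
        unfolding decseq_def
      proof (intro allI impI)
        fix m n :: nat assume "m \<le> n"
        then have "1 / real (Suc n) \<le> 1 / real (Suc m)" by (intro divide_left_mono) auto
        then show "A n \<subseteq> A m" unfolding A_def by (intro Int_mono subset_ball) auto
      qed
      fix i
      have "A i \<in> sets borel" "bounded (A i)" using C by (auto simp: A_def bounded_Int)
      then obtain n :: nat where "emeasure \<phi> (A i) = of_nat n" using lfcm_natE[OF \<phi>] by blast
      then show "emeasure \<phi> (A i) \<noteq> \<infinity>" by simp
    qed
    also have "(\<Inter>i. A i) = C \<inter> {x}"
    proof -
      have "y = x" if "\<And>i. y \<in> A i" for y
      proof (rule ccontr)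
        assume "y \<noteq> x"
        then obtain i where "inverse (real (Suc i)) < dist x y" using reals_Archimedean[of "dist x y"] by auto
        then show False using that[of i] by (simp add: A_def inverse_eq_divide)
      qed
      then show ?thesis by (auto simp: A_def)
    qed
    also have "emeasure \<phi> (C \<inter> {x}) = 0"
      using disj by (cases "x \<in> C") (auto simp: points_def)
    finally have "\<forall>\<^sub>F i in sequentially. emeasure \<phi> (A i) < 1"
      by (rule order_tendstoD) simp
    then obtain i where i: "emeasure \<phi> (A i) < 1" by (meson eventually_happens sequentially_bot)
    have "A i \<in> sets borel" "bounded (A i)" using C by (auto simp: A_def bounded_Int)
    then obtain n :: nat where "emeasure \<phi> (A i) = of_nat n" using lfcm_natE[OF \<phi>] by blast
    then have "emeasure \<phi> (A i) = 0" using i by (cases n) auto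
    then show ?thesis by (intro exI[of _ "ball x (1 / real (Suc i))"]) (auto simp: A_def)
  qed
  note ex = this
  define F where "F = {U. open U \<and> emeasure \<phi> (C \<inter> U) = 0}"
  obtain F' where F': "F' \<subseteq> F" "countable F'" "\<Union>F' = \<Union>F"
    using Lindelof[of F] by (auto simp: F_def)
  have "\<Union>F = UNIV" using ex unfolding F_def by blast
  then have "C = (\<Union>U\<in>F'. C \<inter> U)" using F'(3) by blast
  also have "\<dots> \<in> null_sets \<phi>"
    using F' C by (intro null_sets_UN') (auto simp: F_def null_sets_def)
  finally show ?thesis by auto
qed

lemma lfcm_null_iff:
  assumes \<phi>: "locally_finite_counting_measure \<phi>" and B: "B \<in> sets borel"
  shows "emeasure \<phi> B = 0 \<longleftrightarrow> points \<phi> \<inter> B = {}"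
proof
  note [simp] = lfcm_sets[OF \<phi>]
  show "points \<phi> \<inter> B = {}" if "emeasure \<phi> B = 0"
  proof (rule ccontr)
    assume "points \<phi> \<inter> B \<noteq> {}"
    then obtain x where x: "x \<in> B" "emeasure \<phi> {x} \<noteq> 0" by (auto simp: points_def)
    have "emeasure \<phi> {x} \<le> emeasure \<phi> B" using x B by (intro emeasure_mono) auto
    then show False using that x by simp
  qed
  show "emeasure \<phi> B = 0" if "points \<phi> \<inter> B = {}"
  proof -
    have "B \<inter> cball 0 (real n) \<in> null_sets \<phi>" for n :: nat
      using that B by (intro null_setsI lfcm_null_bounded[OF \<phi>]) (auto intro: bounded_Int)
    then have "(\<Union>n::nat. B \<inter> cball 0 (real n)) \<in> null_sets \<phi>" by (rule null_sets_UN)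
    moreover have "B \<subseteq> (\<Union>n::nat. B \<inter> cball 0 (real n))"
      using real_arch_simple by auto
    ultimately have "B \<in> null_sets \<phi>" using B by (auto intro: null_sets_subset)
    then show ?thesis by auto
  qed
qed

lemma lfcm_singleton_ge_1:
  assumes "locally_finite_counting_measure \<phi>" "x \<in> points \<phi>"
  shows "1 \<le> emeasure \<phi> {x}"
proof -
  obtain n :: nat where n: "emeasure \<phi> {x} = of_nat n" using lfcm_natE[OF assms(1), of "{x}"] by auto
  then have "1 \<le> n" using assms(2) by (cases n) (auto simp: points_def)
  then show ?thesis unfolding n by (metis of_nat_1 of_nat_le_iff)
qed

lemma lfcm_finite_points:
  assumes \<phi>: "locally_finite_counting_measure \<phi>" and "bounded B"
  shows "finite (points \<phi> \<inter> B)"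
proof -
  note [simp] = lfcm_sets[OF \<phi>]
  obtain R where R: "B \<subseteq> cball 0 R" using bounded_subset_ballD[OF assms(2), of 0] ball_subset_cball by blast
  obtain n :: nat where n: "emeasure \<phi> (cball 0 R) = of_nat n" using lfcm_natE[OF \<phi>, of "cball 0 R"] by auto
  have "finite (points \<phi> \<inter> cball 0 R)"
  proof (rule ccontr)
    assume "infinite (points \<phi> \<inter> cball 0 R)"
    then obtain F where F: "F \<subseteq> points \<phi> \<inter> cball 0 R" "finite F" "card F = Suc n"
      using infinite_arbitrarily_large by blast
    have "of_nat (Suc n) = (\<Sum>x\<in>F. (1::ennreal))" using F by simp
    also have "\<dots> \<le> (\<Sum>x\<in>F. emeasure \<phi> {x})"
      using F by (intro sum_mono lfcm_singleton_ge_1[OF \<phi>]) auto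
    also have "\<dots> = emeasure \<phi> F" by (rule emeasure_eq_sum_singleton[symmetric]) (use F in auto)
    also have "\<dots> \<le> emeasure \<phi> (cball 0 R)" using F by (intro emeasure_mono) auto
    finally have "(of_nat (Suc n) :: ennreal) \<le> of_nat n" unfolding n .
    then have "Suc n \<le> n" unfolding of_nat_le_iff .
    then show False by simp
  qed
  then show ?thesis by (rule rev_finite_subset) (use R in auto)
qed

lemma lfcm_simple_emeasure:
  assumes \<phi>: "locally_finite_counting_measure \<phi>" and simple: "\<And>x. emeasure \<phi> {x} \<le> 1"
    and B: "B \<in> sets borel" "bounded B"
  shows "emeasure \<phi> B = of_nat (card (points \<phi> \<inter> B))"
proof -
  note [simp] = lfcm_sets[OF \<phi>]
  define F where "F = points \<phi> \<inter> B"
  have fin: "finite F" using lfcm_finite_points[OF \<phi> B(2)] by (simp add: F_def)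
  then have FB: "F \<in> sets borel" by (rule finite_imp_closed[THEN borel_closed])
  have "emeasure \<phi> (B - F) = 0"
    using B FB by (subst lfcm_null_iff[OF \<phi>]) (auto simp: F_def)
  then have "emeasure \<phi> B = emeasure \<phi> F"
    using B FB by (intro emeasure_Un_null_set[of F \<phi> "B - F", simplified, THEN trans[rotated]])
      (auto simp: F_def intro!: arg_cong[where f="emeasure \<phi>"])
  also have "\<dots> = (\<Sum>x\<in>F. emeasure \<phi> {x})" using fin by (intro emeasure_eq_sum_singleton) auto
  also have "\<dots> = (\<Sum>x\<in>F. 1)"
    using simple lfcm_singleton_ge_1[OF \<phi>] by (intro sum.cong refl antisym) (auto simp: F_def)
  finally show ?thesis by (simp add: F_def)
qed

lemma space_configuration_algebra:
  "space configuration_algebra = {\<phi>. locally_finite_counting_measure \<phi>}"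
  by (auto simp: configuration_algebra_def space_Sup_eq_UN)

lemma measurable_emeasure_configuration:
  assumes "B \<in> sets borel"
  shows "(\<lambda>\<phi>. emeasure \<phi> B) \<in> borel_measurable configuration_algebra"
  unfolding configuration_algebra_def
  by (rule measurable_SUP1[OF assms]) (auto intro!: measurable_vimage_algebra1)

lemma measurable_configurationI:
  assumes "\<And>\<omega>. \<omega> \<in> space M \<Longrightarrow> locally_finite_counting_measure (\<Psi> \<omega>)"
    and "\<And>B. B \<in> sets borel \<Longrightarrow> (\<lambda>\<omega>. emeasure (\<Psi> \<omega>) B) \<in> borel_measurable M"
  shows "\<Psi> \<in> M \<rightarrow>\<^sub>M configuration_algebra"
  unfolding configuration_algebra_def
  using assms by (intro measurable_SUP2 measurable_vimage_algebra2) auto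

lemma point_process_lfcm:
  assumes "point_process M \<Phi>" "\<omega> \<in> space M"
  shows "locally_finite_counting_measure (\<Phi> \<omega>)"
  using measurable_space[of \<Phi> M configuration_algebra \<omega>] assms
  by (auto simp: point_process_def space_configuration_algebra)

lemma point_process_measurable:
  assumes "point_process M \<Phi>" "B \<in> sets borel"
  shows "(\<lambda>\<omega>. emeasure (\<Phi> \<omega>) B) \<in> borel_measurable M"
  using measurable_compose[OF _ measurable_emeasure_configuration[OF assms(2)]] assms(1)
  by (auto simp: point_process_def)

section \<open>Poisson variables\<close>

text \<open>The factor \<open>fact j * (n choose j)\<close> is the falling factorial, which cancels
  against \<open>fact n\<close> in the Poisson weight and leaves a shifted exponential series. All
  moments used later are reduced to these.\<close>

lemma poisson_factorial_moment_sums: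
  fixes m :: real
  shows "(\<lambda>n. fact j * real (n choose j) * (m ^ n / fact n * exp (- m))) sums m ^ j"
proof -
  let ?f = "\<lambda>n. fact j * real (n choose j) * (m ^ n / fact n * exp (- m))"
  have "?f (n + j) = m ^ j * exp (- m) * (m ^ n /\<^sub>R fact n)" for n
  proof -
    have "real (n + j choose j) = fact (n + j) / (fact j * fact n)"
      using binomial_fact[of j "n + j"] by simp
    then show ?thesis by (simp add: power_add field_simps)
  qed
  moreover have "(\<lambda>n. m ^ j * exp (- m) * (m ^ n /\<^sub>R fact n)) sums (m ^ j * exp (- m) * exp m)"
    by (intro sums_mult exp_converges)
  ultimately have "(\<lambda>n. ?f (n + j)) sums (m ^ j * exp (- m) * exp m)" by presburger
  then have "?f sums (m ^ j * exp (- m) * exp m)"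
    by (subst (asm) sums_zero_iff_shift) auto
  then show ?thesis by (simp add: exp_minus field_simps)
qed

context prob_space
begin

definition poisson_variable :: "real \<Rightarrow> ('a \<Rightarrow> nat) \<Rightarrow> bool" where
  "poisson_variable m N \<longleftrightarrow> 0 \<le> m \<and> N \<in> M \<rightarrow>\<^sub>M count_space UNIV \<and>
     (\<forall>n. prob {\<omega>\<in>space M. N \<omega> = n} = m ^ n / fact n * exp (- m))"

lemma nn_integral_nat_variable:
  assumes [measurable]: "N \<in> M \<rightarrow>\<^sub>M count_space (UNIV :: nat set)"
  shows "(\<integral>\<^sup>+\<omega>. f (N \<omega>) \<partial>M) = (\<Sum>n. f n * emeasure M {\<omega>\<in>space M. N \<omega> = n})"
proof -
  have "(\<integral>\<^sup>+\<omega>. f (N \<omega>) \<partial>M) = (\<integral>\<^sup>+\<omega>. (\<Sum>n. f n * indicator {\<omega>\<in>space M. N \<omega> = n} \<omega>) \<partial>M)"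
  proof (rule nn_integral_cong)
    fix \<omega> assume "\<omega> \<in> space M"
    then have "(\<Sum>n. f n * indicator {\<omega>\<in>space M. N \<omega> = n} \<omega>) = (\<Sum>n\<in>{N \<omega>}. f n * indicator {\<omega>\<in>space M. N \<omega> = n} \<omega>)"
      by (intro suminf_finite) auto
    then show "f (N \<omega>) = (\<Sum>n. f n * indicator {\<omega>\<in>space M. N \<omega> = n} \<omega>)"
      using \<open>\<omega> \<in> space M\<close> by simp
  qed
  also have "\<dots> = (\<Sum>n. \<integral>\<^sup>+\<omega>. f n * indicator {\<omega>\<in>space M. N \<omega> = n} \<omega> \<partial>M)"
    by (rule nn_integral_suminf) measurable
  also have "\<dots> = (\<Sum>n. f n * emeasure M {\<omega>\<in>space M. N \<omega> = n})"
    by (intro suminf_cong nn_integral_cmult_indicator) measurable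
  finally show ?thesis .
qed

lemma poisson_factorial_moment:
  assumes "poisson_variable m N"
  shows "(\<integral>\<^sup>+\<omega>. ennreal (fact j * real (N \<omega> choose j)) \<partial>M) = ennreal (m ^ j)"
proof -
  have m: "0 \<le> m" and N: "N \<in> M \<rightarrow>\<^sub>M count_space UNIV"
    and p: "\<And>n. emeasure M {\<omega>\<in>space M. N \<omega> = n} = ennreal (m ^ n / fact n * exp (- m))"
    using assms by (auto simp: poisson_variable_def emeasure_eq_measure)
  have "(\<integral>\<^sup>+\<omega>. ennreal (fact j * real (N \<omega> choose j)) \<partial>M)
     = (\<Sum>n. ennreal (fact j * real (n choose j)) * ennreal (m ^ n / fact n * exp (- m)))"
    using nn_integral_nat_variable[OF N, of "\<lambda>n. ennreal (fact j * real (n choose j))"] by (simp add: p)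
  also have "\<dots> = (\<Sum>n. ennreal (fact j * real (n choose j) * (m ^ n / fact n * exp (- m))))"
    using m by (simp add: ennreal_mult'[symmetric])
  also have "\<dots> = ennreal (m ^ j)"
    using poisson_factorial_moment_sums[of j m] m
    by (intro suminf_ennreal_eq) auto
  finally show ?thesis .
qed

lemma poisson_factorial_moment_real:
  assumes "poisson_variable m N"
  shows "integrable M (\<lambda>\<omega>. fact j * real (N \<omega> choose j))"
    and "expectation (\<lambda>\<omega>. fact j * real (N \<omega> choose j)) = m ^ j"
proof -
  have "has_bochner_integral M (\<lambda>\<omega>. fact j * real (N \<omega> choose j)) (m ^ j)"
  proof (rule has_bochner_integral_nn_integral)
    have [measurable]: "N \<in> M \<rightarrow>\<^sub>M count_space UNIV" "0 \<le> m" using assms by (auto simp: poisson_variable_def)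
    show "(\<lambda>\<omega>. fact j * real (N \<omega> choose j)) \<in> borel_measurable M" by measurable
    show "0 \<le> m ^ j" using \<open>0 \<le> m\<close> by simp
  qed (use poisson_factorial_moment[OF assms] in auto)
  then show "integrable M (\<lambda>\<omega>. fact j * real (N \<omega> choose j))"
    "expectation (\<lambda>\<omega>. fact j * real (N \<omega> choose j)) = m ^ j"
    by (auto simp: has_bochner_integral_iff)
qed

lemma real_choose_two: "(real n)\<^sup>2 = fact 2 * real (n choose 2) + real n"
proof -
  have "2 dvd n * (n - 1)" by (cases n) auto
  then have "2 * (n choose 2) = n * (n - 1)" unfolding choose_two by (rule dvd_mult_div_cancel)
  then have "2 * real (n choose 2) = real (n * (n - 1))" by (metis of_nat_mult of_nat_numeral)
  then show ?thesis by (cases n) (auto simp: power2_eq_square algebra_simps fact_2)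
qed

lemma poisson_moments:
  assumes "poisson_variable m N"
  shows "integrable M (\<lambda>\<omega>. real (N \<omega>))" "expectation (\<lambda>\<omega>. real (N \<omega>)) = m"
    and "integrable M (\<lambda>\<omega>. (real (N \<omega>))\<^sup>2)" "expectation (\<lambda>\<omega>. (real (N \<omega>))\<^sup>2) = m\<^sup>2 + m"
    and "variance (\<lambda>\<omega>. real (N \<omega>)) = m"
proof -
  show 1: "integrable M (\<lambda>\<omega>. real (N \<omega>))" and 2: "expectation (\<lambda>\<omega>. real (N \<omega>)) = m"
    using poisson_factorial_moment_real[OF assms, of 1] by simp_all
  note f2 = poisson_factorial_moment_real[OF assms, of 2]
  show 3: "integrable M (\<lambda>\<omega>. (real (N \<omega>))\<^sup>2)" and 4: "expectation (\<lambda>\<omega>. (real (N \<omega>))\<^sup>2) = m\<^sup>2 + m"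
    unfolding real_choose_two using f2 1 2 by auto
  show "variance (\<lambda>\<omega>. real (N \<omega>)) = m"
    unfolding variance_eq[OF 1 3] using 2 4 by simp
qed

text \<open>Below \<open>4\<close> the constant \<open>256 = 4 ^ 4\<close> suffices alone. For
  \<open>n = k + 4\<close> three of the factors satisfy \<open>k + 4 \<le> 4 * (k + i)\<close> with
  \<open>i = 1, 2, 3\<close>, which costs only \<open>64\<close>.\<close>

lemma fourth_power_le_choose: "(real n) ^ 4 \<le> 256 * (1 + fact 4 * real (n choose 4))"
proof (cases "n < 4")
  case True
  then have "real n ^ 4 \<le> 4 ^ 4" by (intro power_mono) auto
  also have "\<dots> \<le> 256 * (1 + fact 4 * real (n choose 4))" by simp
  finally show ?thesis .
next
  case False
  then obtain k where k: "n = k + 4" by (metis add.commute le_Suc_ex not_less)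
  have "real (k + 4 choose 4) = fact (k + 4) / (fact 4 * fact k)"
    using binomial_fact[of 4 "k + 4"] by simp
  then have "fact 4 * real (n choose 4) = fact (k + 4) / fact k" by (simp add: k field_simps)
  also have "\<dots> = (real k + 4) * (real k + 3) * (real k + 2) * (real k + 1)"
    by (simp add: numeral_eq_Suc field_simps)
  finally have eq: "fact 4 * real (n choose 4) = (real k + 4) * (real k + 3) * (real k + 2) * (real k + 1)" .
  have "real n ^ 4 = (real k + 4) * (real k + 4) * (real k + 4) * (real k + 4)"
    by (simp add: k power4_eq_xxxx)
  also have "\<dots> \<le> (real k + 4) * (4 * (real k + 3)) * (4 * (real k + 2)) * (4 * (real k + 1))"
    by (intro mult_mono) auto
  also have "\<dots> \<le> 256 * (1 + fact 4 * real (n choose 4))"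
    unfolding eq by (simp add: algebra_simps)
  finally show ?thesis .
qed

lemma poisson_fourth_moment:
  assumes "poisson_variable m N"
  shows "(\<integral>\<^sup>+\<omega>. ennreal ((real (N \<omega>)) ^ 4) \<partial>M) \<le> ennreal (256 * (1 + m ^ 4))"
proof -
  have N: "N \<in> M \<rightarrow>\<^sub>M count_space UNIV" and m: "0 \<le> m" using assms by (auto simp: poisson_variable_def)
  have "(\<integral>\<^sup>+\<omega>. ennreal ((real (N \<omega>)) ^ 4) \<partial>M) \<le> (\<integral>\<^sup>+\<omega>. ennreal (256 * (1 + fact 4 * real (N \<omega> choose 4))) \<partial>M)"
    by (intro nn_integral_mono ennreal_leI fourth_power_le_choose)
  also have "\<dots> = ennreal (expectation (\<lambda>\<omega>. 256 * (1 + fact 4 * real (N \<omega> choose 4))))"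
    using poisson_factorial_moment_real(1)[OF assms, of 4]
    by (intro nn_integral_eq_integral integrable_mult_right Bochner_Integration.integrable_add) auto
  also have "expectation (\<lambda>\<omega>. 256 * (1 + fact 4 * real (N \<omega> choose 4))) = 256 * (1 + m ^ 4)"
    using poisson_factorial_moment_real[OF assms, of 4] by (simp add: prob_space)
  finally show ?thesis .
qed

text \<open>Markov's inequality for the second factorial moment. The square of \<open>m\<close> is
  what makes multiple points in small cubes negligible.\<close>

lemma poisson_prob_ge_2:
  assumes "poisson_variable m N"
  shows "prob {\<omega>\<in>space M. 2 \<le> N \<omega>} \<le> m\<^sup>2"
proof -
  have [measurable]: "N \<in> M \<rightarrow>\<^sub>M count_space UNIV" using assms by (auto simp: poisson_variable_def)
  have "prob {\<omega>\<in>space M. 2 \<le> N \<omega>} = expectation (indicator {\<omega>\<in>space M. 2 \<le> N \<omega>})" by simp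
  also have "\<dots> \<le> expectation (\<lambda>\<omega>. fact 2 * real (N \<omega> choose 2))"
  proof (rule integral_mono[OF _ poisson_factorial_moment_real(1)[OF assms]])
    fix \<omega> show "indicator {\<omega>\<in>space M. 2 \<le> N \<omega>} \<omega> \<le> fact 2 * real (N \<omega> choose 2)"
    proof (cases "2 \<le> N \<omega>")
      case True
      then have "0 < N \<omega> choose 2" by simp
      then have "1 \<le> real (N \<omega> choose 2)" by linarith
      then show ?thesis by (auto simp: indicator_def fact_2)
    qed auto
  qed (simp add: emeasure_eq_measure)
  also have "\<dots> = m\<^sup>2" by (rule poisson_factorial_moment_real(2)[OF assms])
  finally show ?thesis .
qed

end

section \<open>The intensity measure of a stationary Poisson process\<close>

text \<open>The count with multiplicity, available before almost sure simplicity is known;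
  afterwards the cardinality of the set of points takes over.\<close>

definition point_count :: "'a::euclidean_space measure \<Rightarrow> 'a set \<Rightarrow> nat" where
  "point_count \<phi> B = (SOME n. emeasure \<phi> B = of_nat n)"

lemma emeasure_eq_point_count:
  assumes "locally_finite_counting_measure \<phi>" "B \<in> sets borel" "bounded B"
  shows "emeasure \<phi> B = of_nat (point_count \<phi> B)"
  unfolding point_count_def using lfcm_natE[OF assms] by (metis (mono_tags, lifting) someI_ex)

lemma poisson_variable_point_count:
  assumes "prob_space M"
    and lfcm: "\<And>\<omega>. \<omega> \<in> space M \<Longrightarrow> locally_finite_counting_measure (\<Phi> \<omega>)"
    and meas: "(\<lambda>\<omega>. emeasure (\<Phi> \<omega>) B) \<in> borel_measurable M"
    and B: "B \<in> sets borel" "bounded B" and "0 \<le> m"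
    and p: "\<And>n. measure M {\<omega>\<in>space M. emeasure (\<Phi> \<omega>) B = of_nat n} = m ^ n / fact n * exp (- m)"
  shows "prob_space.poisson_variable M m (\<lambda>\<omega>. point_count (\<Phi> \<omega>) B)"
proof -
  interpret prob_space M by fact
  note meas[measurable]
  have eq: "{\<omega>\<in>space M. point_count (\<Phi> \<omega>) B = n} = {\<omega>\<in>space M. emeasure (\<Phi> \<omega>) B = of_nat n}" for n
    using emeasure_eq_point_count[OF lfcm B] by auto
  have sets: "{\<omega>\<in>space M. point_count (\<Phi> \<omega>) B = n} \<in> sets M" for n
    unfolding eq by measurable
  have "(\<lambda>\<omega>. point_count (\<Phi> \<omega>) B) -` {n} \<inter> space M \<in> sets M" for n
    using sets[of n] by (rule back_subst[of "\<lambda>A. A \<in> sets M"]) auto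
  then have "(\<lambda>\<omega>. point_count (\<Phi> \<omega>) B) \<in> M \<rightarrow>\<^sub>M count_space UNIV"
    by (subst measurable_count_space_eq2_countable) auto
  then show ?thesis using p \<open>0 \<le> m\<close> by (simp add: poisson_variable_def eq)
qed

lemma poisson_process_mean:
  assumes P: "poisson_process M \<Lambda> \<Phi>" and B: "B \<in> sets borel" "bounded B"
  shows "(\<integral>\<^sup>+\<omega>. emeasure (\<Phi> \<omega>) B \<partial>M) = emeasure \<Lambda> B"
proof -
  have pp: "point_process M \<Phi>" and fin: "emeasure \<Lambda> B < \<infinity>"
    and p: "\<And>n. measure M {\<omega>\<in>space M. emeasure (\<Phi> \<omega>) B = of_nat n} = measure \<Lambda> B ^ n / fact n * exp (- measure \<Lambda> B)"
    using P B by (auto simp: poisson_process_def)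
  have ps: "prob_space M" using pp by (simp add: point_process_def)
  interpret prob_space M by (rule ps)
  have "poisson_variable (measure \<Lambda> B) (\<lambda>\<omega>. point_count (\<Phi> \<omega>) B)"
    by (rule poisson_variable_point_count[OF ps point_process_lfcm[OF pp] point_process_measurable[OF pp B(1)] B])
       (simp_all add: p)
  from poisson_factorial_moment[OF this, of 1]
  have "(\<integral>\<^sup>+\<omega>. of_nat (point_count (\<Phi> \<omega>) B) \<partial>M) = ennreal (measure \<Lambda> B)"
    by (simp add: ennreal_of_nat_eq_real_of_nat)
  also have "(\<integral>\<^sup>+\<omega>. of_nat (point_count (\<Phi> \<omega>) B) \<partial>M) = (\<integral>\<^sup>+\<omega>. emeasure (\<Phi> \<omega>) B \<partial>M)"
    using emeasure_eq_point_count[OF point_process_lfcm[OF pp] B] by (intro nn_integral_cong) simp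
  finally show ?thesis using fin by (simp add: emeasure_eq_ennreal_measure)
qed

lemma vimage_translation:
  fixes B :: "'a::euclidean_space set"
  shows "B \<in> sets borel \<Longrightarrow> (\<lambda>x. x + t) -` B \<in> sets borel"
    and "bounded B \<Longrightarrow> bounded ((\<lambda>x. x + t) -` B)"
proof -
  show "(\<lambda>x. x + t) -` B \<in> sets borel" if "B \<in> sets borel"
    using measurable_sets[of "\<lambda>x. x + t" borel borel B] that by simp
  have "(\<lambda>x. x + t) -` B = (+) (- t) ` B"
  proof (rule set_eqI)
    fix x show "x \<in> (\<lambda>x. x + t) -` B \<longleftrightarrow> x \<in> (+) (- t) ` B"
      by (auto simp: image_iff intro!: bexI[of _ "x + t"])
  qed
  then show "bounded ((\<lambda>x. x + t) -` B)" if "bounded B"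
    using bounded_translation[OF that, of "- t"] by (simp only:)
qed

lemma stationary_mean:
  fixes \<Phi> :: "'w \<Rightarrow> 'a::euclidean_space measure"
  assumes pp: "point_process M \<Phi>" and st: "stationary M \<Phi>" and B: "B \<in> sets borel"
  shows "(\<integral>\<^sup>+\<omega>. emeasure (\<Phi> \<omega>) ((\<lambda>x. x + t) -` B) \<partial>M) = (\<integral>\<^sup>+\<omega>. emeasure (\<Phi> \<omega>) B \<partial>M)"
proof -
  note lf = point_process_lfcm[OF pp]
  note vim = vimage_translation(1)[where t=t]
  have em: "emeasure (distr (\<Phi> \<omega>) borel (\<lambda>x. x + t)) A = emeasure (\<Phi> \<omega>) ((\<lambda>x. x + t) -` A)"
    if "\<omega> \<in> space M" "A \<in> sets borel" for \<omega> A
  proof -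
    have s: "sets (\<Phi> \<omega>) = sets borel" by (rule lfcm_sets[OF lf[OF that(1)]])
    then have "(\<lambda>x. x + t) \<in> \<Phi> \<omega> \<rightarrow>\<^sub>M borel" by (simp cong: measurable_cong_sets)
    moreover have "space (\<Phi> \<omega>) = UNIV" using sets_eq_imp_space_eq[OF s] by simp
    ultimately show ?thesis using that by (simp add: emeasure_distr)
  qed
  have shifted: "(\<lambda>\<omega>. distr (\<Phi> \<omega>) borel (\<lambda>x. x + t)) \<in> M \<rightarrow>\<^sub>M configuration_algebra"
  proof (rule measurable_configurationI)
    fix \<omega> assume \<omega>: "\<omega> \<in> space M"
    show "locally_finite_counting_measure (distr (\<Phi> \<omega>) borel (\<lambda>x. x + t))"
      unfolding locally_finite_counting_measure_def
    proof (intro conjI ballI impI)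
      fix A :: "'a set" assume A: "A \<in> sets borel" "bounded A"
      obtain n :: nat where "emeasure (\<Phi> \<omega>) ((\<lambda>x. x + t) -` A) = of_nat n"
        using lfcm_natE[OF lf[OF \<omega>] vim[OF A(1)] vimage_translation(2)[OF A(2)]] by blast
      then show "\<exists>n::nat. emeasure (distr (\<Phi> \<omega>) borel (\<lambda>x. x + t)) A = of_nat n"
        using em[OF \<omega> A(1)] by simp
    qed simp
  next
    fix A :: "'a set" assume A: "A \<in> sets borel"
    show "(\<lambda>\<omega>. emeasure (distr (\<Phi> \<omega>) borel (\<lambda>x. x + t)) A) \<in> borel_measurable M"
      using point_process_measurable[OF pp vim[OF A]] by (subst measurable_cong[OF em[OF _ A]])
  qed
  have "(\<integral>\<^sup>+\<omega>. emeasure (\<Phi> \<omega>) ((\<lambda>x. x + t) -` B) \<partial>M) = (\<integral>\<^sup>+\<omega>. emeasure (distr (\<Phi> \<omega>) borel (\<lambda>x. x + t)) B \<partial>M)"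
    by (intro nn_integral_cong) (simp add: em B)
  also have "\<dots> = (\<integral>\<^sup>+\<phi>. emeasure \<phi> B \<partial>distr M configuration_algebra (\<lambda>\<omega>. distr (\<Phi> \<omega>) borel (\<lambda>x. x + t)))"
    by (rule nn_integral_distr[symmetric, OF shifted]) (simp add: measurable_emeasure_configuration[OF B])
  also have "\<dots> = (\<integral>\<^sup>+\<phi>. emeasure \<phi> B \<partial>distr M configuration_algebra \<Phi>)"
    using st by (simp add: stationary_def)
  also have "\<dots> = (\<integral>\<^sup>+\<omega>. emeasure (\<Phi> \<omega>) B \<partial>M)"
    by (rule nn_integral_distr) (use pp measurable_emeasure_configuration[OF B] in \<open>auto simp: point_process_def\<close>)
  finally show ?thesis .
qed

text \<open>Fubini for the indicator of \<open>x \<in> C \<and> x + y \<in> B\<close>, where \<open>C\<close> is the unit cube.\<close>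

lemma translation_invariant_proportional_lborel:
  fixes \<Lambda> :: "'a::euclidean_space measure"
  assumes sets[simp]: "sets \<Lambda> = sets borel"
    and fin: "\<And>B. B \<in> sets borel \<Longrightarrow> bounded B \<Longrightarrow> emeasure \<Lambda> B < \<infinity>"
    and inv: "\<And>B t. B \<in> sets borel \<Longrightarrow> bounded B \<Longrightarrow> emeasure \<Lambda> ((\<lambda>x. x + t) -` B) = emeasure \<Lambda> B"
    and B: "B \<in> sets borel" "bounded B"
  shows "emeasure \<Lambda> B = emeasure \<Lambda> (cbox 0 One) * emeasure lborel B"
proof -
  interpret sigma_finite_measure \<Lambda>
  proof
    show "\<exists>A. countable A \<and> A \<subseteq> sets \<Lambda> \<and> \<Union>A = space \<Lambda> \<and> (\<forall>a\<in>A. emeasure \<Lambda> a \<noteq> \<infinity>)"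
    proof (intro exI[of _ "range (\<lambda>n::nat. cball 0 (real n))"] conjI)
      show "\<Union> (range (\<lambda>n::nat. cball 0 (real n))) = space \<Lambda>"
        using sets_eq_imp_space_eq[OF sets] real_arch_simple by auto
      show "\<forall>a\<in>range (\<lambda>n::nat. cball 0 (real n)). emeasure \<Lambda> a \<noteq> \<infinity>"
        using fin[of "cball 0 _"] by (auto simp: less_top)
    qed auto
  qed
  interpret pair_sigma_finite \<Lambda> lborel ..
  let ?C = "cbox 0 One :: 'a set"
  have [simp]: "space \<Lambda> = UNIV" using sets_eq_imp_space_eq[OF sets] by simp
  note B(1)[measurable]
  have cong: "borel_measurable (\<Lambda> \<Otimes>\<^sub>M lborel) = borel_measurable (borel \<Otimes>\<^sub>M (borel :: 'a measure))"
    by (intro measurable_cong_sets sets_pair_measure_cong) auto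
  have meas: "(\<lambda>(x, y). indicator ?C x * indicator B (x + y) :: ennreal) \<in> borel_measurable (\<Lambda> \<Otimes>\<^sub>M lborel)"
    unfolding cong by measurable
  note vim = vimage_translation(1)
  have lb: "emeasure lborel ((\<lambda>y. x + y) -` A) = emeasure lborel A" if [measurable]: "A \<in> sets borel" for A and x :: 'a
  proof -
    have "emeasure lborel A = emeasure (distr lborel borel ((+) x)) A" by (simp add: lborel_distr_plus)
    also have "\<dots> = emeasure lborel ((+) x -` A)" by (subst emeasure_distr) auto
    finally show ?thesis by simp
  qed
  have "emeasure \<Lambda> ?C * emeasure lborel B = (\<integral>\<^sup>+x. indicator ?C x * emeasure lborel B \<partial>\<Lambda>)"
    by (subst nn_integral_multc) (auto intro!: borel_measurable_indicator)
  also have "\<dots> = (\<integral>\<^sup>+x. (\<integral>\<^sup>+y. indicator ?C x * indicator B (x + y) \<partial>lborel) \<partial>\<Lambda>)"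
  proof (rule nn_integral_cong)
    fix x
    have "(\<integral>\<^sup>+y. indicator B (x + y) \<partial>lborel) = (\<integral>\<^sup>+y. indicator ((\<lambda>y. x + y) -` B) y \<partial>lborel)"
      by (simp add: indicator_def)
    also have "\<dots> = emeasure lborel B"
      using lb[OF B(1), of x] vim[OF B(1), of x] by (simp add: add.commute[of x])
    finally show "indicator ?C x * emeasure lborel B = (\<integral>\<^sup>+y. indicator ?C x * indicator B (x + y) \<partial>lborel)"
      by (subst nn_integral_cmult) auto
  qed
  also have "\<dots> = (\<integral>\<^sup>+y. (\<integral>\<^sup>+x. indicator ?C x * indicator B (x + y) \<partial>\<Lambda>) \<partial>lborel)"
    using Fubini'[OF meas] by simp
  \<comment> \<open>For fixed \<open>y\<close> the substitution \<open>u = x + y\<close> is allowed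
    by the invariance of \<open>\<Lambda>\<close>.\<close>
  also have "\<dots> = (\<integral>\<^sup>+y. (\<integral>\<^sup>+u. indicator B u * indicator ?C (u - y) \<partial>\<Lambda>) \<partial>lborel)"
  proof (rule nn_integral_cong)
    fix y
    define S where "S = B \<inter> (\<lambda>u. u + (- y)) -` ?C"
    have S: "S \<in> sets borel" "bounded S" using B vim[of ?C "- y"] by (auto simp: S_def bounded_Int)
    have "(\<integral>\<^sup>+x. indicator ?C x * indicator B (x + y) \<partial>\<Lambda>) = (\<integral>\<^sup>+x. indicator ((\<lambda>x. x + y) -` S) x \<partial>\<Lambda>)"
      by (intro nn_integral_cong) (auto simp: S_def indicator_def)
    also have "\<dots> = emeasure \<Lambda> S" using inv[OF S] vim[OF S(1)] by simp
    also have "\<dots> = (\<integral>\<^sup>+u. indicator S u \<partial>\<Lambda>)" using S by simp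
    also have "\<dots> = (\<integral>\<^sup>+u. indicator B u * indicator ?C (u - y) \<partial>\<Lambda>)"
      by (intro nn_integral_cong) (auto simp: S_def indicator_def)
    finally show "(\<integral>\<^sup>+x. indicator ?C x * indicator B (x + y) \<partial>\<Lambda>) = \<dots>" .
  qed
  also have "\<dots> = (\<integral>\<^sup>+u. (\<integral>\<^sup>+y. indicator B u * indicator ?C (u - y) \<partial>lborel) \<partial>\<Lambda>)"
  proof -
    have "(\<lambda>(u, y). indicator B u * indicator ?C (u - y) :: ennreal) \<in> borel_measurable (\<Lambda> \<Otimes>\<^sub>M lborel)"
      unfolding cong by measurable
    from Fubini'[OF this] show ?thesis by simp
  qed
  \<comment> \<open>For fixed \<open>u\<close> the inner integral is the volume of a reflected and
    shifted unit cube.\<close>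
  also have "\<dots> = (\<integral>\<^sup>+u. indicator B u \<partial>\<Lambda>)"
  proof (rule nn_integral_cong)
    fix u
    have "(\<lambda>y. u - y) -` ?C = cbox (u - One) u"
      by (auto simp: mem_box inner_diff_left algebra_simps)
    then have "(\<integral>\<^sup>+y. indicator ?C (u - y) \<partial>lborel) = (\<integral>\<^sup>+y. indicator (cbox (u - One) u) y \<partial>lborel)"
      by (intro nn_integral_cong) (auto simp: indicator_def)
    also have "\<dots> = 1" by (simp add: emeasure_lborel_cbox inner_diff_left)
    finally show "(\<integral>\<^sup>+y. indicator B u * indicator ?C (u - y) \<partial>lborel) = indicator B u"
      by (subst nn_integral_cmult) auto
  qed
  also have "\<dots> = emeasure \<Lambda> B" using B by simp
  finally show ?thesis by simp
qed

lemma stationary_poisson_intensity_measure: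
  fixes \<Lambda> :: "'a::euclidean_space measure"
  assumes P: "poisson_process M \<Lambda> \<Phi>" and st: "stationary M \<Phi>"
    and int: "intensity M \<Phi> = ennreal \<gamma>" and "0 < \<gamma>" and B: "B \<in> sets borel" "bounded B"
  shows "measure \<Lambda> B = \<gamma> * measure lborel B"
proof -
  have pp: "point_process M \<Phi>" and sets: "sets \<Lambda> = sets borel"
    and fin: "\<And>B. B \<in> sets borel \<Longrightarrow> bounded B \<Longrightarrow> emeasure \<Lambda> B < \<infinity>"
    using P by (auto simp: poisson_process_def)
  have inv: "emeasure \<Lambda> ((\<lambda>x. x + t) -` B) = emeasure \<Lambda> B" if B: "B \<in> sets borel" "bounded B" for B t
  proof -
    show ?thesis
      using stationary_mean[OF pp st B(1), of t] poisson_process_mean[OF P B]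
        poisson_process_mean[OF P vimage_translation(1)[OF B(1)] vimage_translation(2)[OF B(2)]] by simp
  qed
  have "emeasure \<Lambda> (cbox 0 One) = ennreal \<gamma>"
    unfolding int[symmetric] intensity_def by (rule poisson_process_mean[OF P, symmetric]) auto
  moreover have "emeasure \<Lambda> B = emeasure \<Lambda> (cbox 0 One) * emeasure lborel B"
    by (rule translation_invariant_proportional_lborel[OF sets fin inv B])
  ultimately have "emeasure \<Lambda> B = ennreal \<gamma> * emeasure lborel B" by (simp only:)
  then show ?thesis using \<open>0 < \<gamma>\<close> by (simp add: measure_def enn2real_mult)
qed

section \<open>Homogeneous Poisson processes\<close>

text \<open>Independence enters through pairs of void events alone; \<open>indep_windows\<close>
  extends it to everything that depends on the points in disjoint windows.\<close>

locale homogeneous_poisson = prob_space M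
  for M :: "'w measure" +
  fixes \<Phi> :: "'w \<Rightarrow> (real ^ 'd::finite) measure" and \<gamma> :: real
  assumes \<gamma>_pos: "0 < \<gamma>"
    and lfcm: "\<And>\<omega>. \<omega> \<in> space M \<Longrightarrow> locally_finite_counting_measure (\<Phi> \<omega>)"
    and measurable_\<Phi>: "\<And>B. B \<in> sets borel \<Longrightarrow> (\<lambda>\<omega>. emeasure (\<Phi> \<omega>) B) \<in> borel_measurable M"
    and poisson: "\<And>B n. B \<in> sets borel \<Longrightarrow> bounded B \<Longrightarrow>
      prob {\<omega>\<in>space M. emeasure (\<Phi> \<omega>) B = of_nat n} =
        (\<gamma> * measure lborel B) ^ n / fact n * exp (- (\<gamma> * measure lborel B))"
    and indep: "\<And>B C. B \<in> sets borel \<Longrightarrow> C \<in> sets borel \<Longrightarrow> B \<inter> C = {} \<Longrightarrow>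
      prob {\<omega>\<in>space M. emeasure (\<Phi> \<omega>) B = 0 \<and> emeasure (\<Phi> \<omega>) C = 0} =
        prob {\<omega>\<in>space M. emeasure (\<Phi> \<omega>) B = 0} * prob {\<omega>\<in>space M. emeasure (\<Phi> \<omega>) C = 0}"
begin

abbreviation P :: "'w \<Rightarrow> (real ^ 'd) set" where
  "P \<omega> \<equiv> points (\<Phi> \<omega>)"

lemma finite_P: "\<omega> \<in> space M \<Longrightarrow> bounded B \<Longrightarrow> finite (P \<omega> \<inter> B)"
  by (rule lfcm_finite_points[OF lfcm])

lemma void_event:
  assumes "B \<in> sets borel"
  shows "{\<omega>\<in>space M. P \<omega> \<inter> B = {}} = {\<omega>\<in>space M. emeasure (\<Phi> \<omega>) B = 0}"
  using lfcm_null_iff[OF lfcm assms] by auto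

lemma void_measurable_P: "void_measurable M P"
  unfolding void_measurable_def
proof (intro conjI ballI allI impI)
  fix B :: "(real ^ 'd) set" assume "B \<in> sets borel"
  note measurable_\<Phi>[OF this, measurable]
  show "{\<omega>\<in>space M. P \<omega> \<inter> B = {}} \<in> sets M"
    unfolding void_event[OF \<open>B \<in> sets borel\<close>] by measurable
qed (rule finite_P)

text \<open>The expected number of cubes of side \<open>s\<close> in a fixed ball with at least two points is of order
  \<open>s ^ d\<close>.\<close>

lemma AE_simple: "AE \<omega> in M. \<forall>x. emeasure (\<Phi> \<omega>) {x} \<le> 1"
proof -
  have "AE \<omega> in M. \<forall>x\<in>cball 0 (real R). emeasure (\<Phi> \<omega>) {x} \<le> 1" for R :: nat
  proof -
    let ?d = "CARD('d)"
    \<comment> \<open>With this side length \<open>Suc K\<close> cubes reach the distance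
      \<open>R\<close>, so the cubes with index in \<open>Z K\<close> cover the ball.\<close>
    define s where "s K = real R / real (Suc K)" for K
    define Z where "Z K = (index_box (Suc K) :: ('d \<Rightarrow> int) set)" for K
    define A where "A K z = {\<omega>\<in>space M. 2 \<le> point_count (\<Phi> \<omega>) (cube (s K) z)}" for K and z :: "'d \<Rightarrow> int"
    show ?thesis
    \<comment> \<open>For \<open>R = 0\<close> the side length degenerates; the single point of the
      ball carries no mass almost surely because its Lebesgue measure is zero.\<close>
    proof (cases "R = 0")
      case True
      have "prob {\<omega>\<in>space M. emeasure (\<Phi> \<omega>) {0} = of_nat 0} = 1"
        by (subst poisson) auto
      moreover have [measurable]: "(\<lambda>\<omega>. emeasure (\<Phi> \<omega>) {0}) \<in> borel_measurable M" by (rule measurable_\<Phi>) simp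
      ultimately have "AE \<omega> in M. emeasure (\<Phi> \<omega>) {0} = of_nat 0"
        by (subst (asm) prob_Collect_eq_1) auto
      then show ?thesis by eventually_elim (use True in auto)
    next
      case False
      then have s: "0 < s K" for K by (simp add: s_def)
      have pv: "poisson_variable (\<gamma> * s K ^ ?d) (\<lambda>\<omega>. point_count (\<Phi> \<omega>) (cube (s K) z))" for K z
        using poisson_variable_point_count[OF prob_space_axioms lfcm measurable_\<Phi>[OF cube_borel] cube_borel bounded_cube[OF s],
            of "\<gamma> * s K ^ ?d" K z] poisson[OF cube_borel bounded_cube[OF s], of K z] \<gamma>_pos s[of K]
        by (simp add: measure_cube[OF s])
      have [measurable]: "A K z \<in> sets M" for K z
      proof -
        have [measurable]: "(\<lambda>\<omega>. point_count (\<Phi> \<omega>) (cube (s K) z)) \<in> M \<rightarrow>\<^sub>M count_space UNIV"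
          using pv by (simp add: poisson_variable_def)
        show ?thesis unfolding A_def by measurable
      qed
      have bd: "prob (\<Union>z\<in>Z K. A K z) \<le> \<gamma>\<^sup>2 * (3 * (real R)\<^sup>2 * inverse (real (Suc K))) ^ ?d" for K
      proof -
        have "prob (\<Union>z\<in>Z K. A K z) \<le> (\<Sum>z\<in>Z K. prob (A K z))"
          by (rule finite_measure_subadditive_finite) (auto simp: Z_def)
        also have "\<dots> \<le> (\<Sum>z\<in>Z K. (\<gamma> * s K ^ ?d)\<^sup>2)"
          unfolding A_def by (intro sum_mono poisson_prob_ge_2 pv)
        also have "\<dots> = \<gamma>\<^sup>2 * (real (2 * Suc K + 1) * (s K)\<^sup>2) ^ ?d"
          by (simp add: Z_def card_index_box power_mult_distrib power_even_eq[symmetric] flip: power_mult)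
            (simp add: mult.commute)
        also have "\<dots> \<le> \<gamma>\<^sup>2 * (3 * (real R)\<^sup>2 * inverse (real (Suc K))) ^ ?d"
        proof (intro mult_left_mono power_mono)
          have "real (2 * Suc K + 1) * (s K)\<^sup>2 \<le> 3 * real (Suc K) * (s K)\<^sup>2"
            by (intro mult_right_mono) auto
          also have "\<dots> = 3 * (real R)\<^sup>2 * inverse (real (Suc K))"
          proof -
            have e: "3 * n * (real R / n)\<^sup>2 = 3 * (real R)\<^sup>2 * inverse n" if "0 < n" for n
              using that by (simp add: power2_eq_square field_simps)
            show ?thesis unfolding s_def by (rule e) simp
          qed
          finally show "real (2 * Suc K + 1) * (s K)\<^sup>2 \<le> 3 * (real R)\<^sup>2 * inverse (real (Suc K))" .
        qed auto
        finally show ?thesis .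
      qed
      have lim: "(\<lambda>K. \<gamma>\<^sup>2 * (3 * (real R)\<^sup>2 * inverse (real (Suc K))) ^ ?d) \<longlonglongrightarrow> \<gamma>\<^sup>2 * (3 * (real R)\<^sup>2 * 0) ^ ?d"
        by (intro tendsto_intros LIMSEQ_inverse_real_of_nat)
      have meas: "(\<Inter>K. \<Union>z\<in>Z K. A K z) \<in> sets M"
        by (intro sets.countable_INT sets.finite_UN) (auto simp: Z_def)
      have "prob (\<Inter>K. \<Union>z\<in>Z K. A K z) \<le> \<gamma>\<^sup>2 * (3 * (real R)\<^sup>2 * 0) ^ ?d"
      proof (rule LIMSEQ_le_const[OF lim], intro exI allI impI)
        fix K :: nat
        have "prob (\<Inter>K. \<Union>z\<in>Z K. A K z) \<le> prob (\<Union>z\<in>Z K. A K z)"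
          by (rule finite_measure_mono) (auto simp: Z_def)
        then show "prob (\<Inter>K. \<Union>z\<in>Z K. A K z) \<le> \<gamma>\<^sup>2 * (3 * (real R)\<^sup>2 * inverse (real (Suc K))) ^ ?d"
          using bd[of K] by linarith
      qed
      then have "prob (\<Inter>K. \<Union>z\<in>Z K. A K z) = 0"
        by (intro antisym measure_nonneg) (simp add: zero_power)
      then have "(\<Inter>K. \<Union>z\<in>Z K. A K z) \<in> null_sets M"
        using meas by (simp add: null_sets_def emeasure_eq_measure)
      from AE_not_in[OF this] AE_space show ?thesis
      proof eventually_elim
        case (elim \<omega>)
        show ?case
        proof (rule ccontr)
          assume "\<not> ?case"
          then obtain x where x: "norm x \<le> real R" "1 < emeasure (\<Phi> \<omega>) {x}" by (auto simp: not_le)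
          have "\<omega> \<in> (\<Union>z\<in>Z K. A K z)" for K
          proof -
            define z where "z = cube_index (s K) x"
            have "z \<in> Z K" unfolding z_def Z_def
              by (rule cube_index_in_index_box[OF s]) (use x in \<open>simp add: s_def\<close>)
            moreover have "emeasure (\<Phi> \<omega>) {x} \<le> emeasure (\<Phi> \<omega>) (cube (s K) z)"
            proof (rule emeasure_mono)
              show "{x} \<subseteq> cube (s K) z" by (simp add: cube_def z_def)
              show "cube (s K) z \<in> sets (\<Phi> \<omega>)" unfolding lfcm_sets[OF lfcm[OF elim(2)]] by (rule cube_borel)
            qed
            then have "1 < emeasure (\<Phi> \<omega>) (cube (s K) z)" by (rule less_le_trans[OF x(2)])
            then have "of_nat 1 < (of_nat (point_count (\<Phi> \<omega>) (cube (s K) z)) :: ennreal)"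
              unfolding emeasure_eq_point_count[OF lfcm[OF elim(2)] cube_borel bounded_cube[OF s]] of_nat_1 .
            then have "1 < point_count (\<Phi> \<omega>) (cube (s K) z)" unfolding of_nat_less_iff .
            then have "\<omega> \<in> A K z" using elim(2) by (simp add: A_def)
            ultimately show ?thesis by blast
          qed
          then show False using elim(1) by blast
        qed
      qed
    qed
  qed
  then have "AE \<omega> in M. \<forall>R::nat. \<forall>x\<in>cball 0 (real R). emeasure (\<Phi> \<omega>) {x} \<le> 1"
    by (subst AE_all_countable) blast
  then show ?thesis
    by eventually_elim (metis mem_cball_0 real_arch_simple)
qed

lemma AE_emeasure_eq_card:
  "AE \<omega> in M. \<forall>B\<in>sets borel. bounded B \<longrightarrow> emeasure (\<Phi> \<omega>) B = of_nat (card (P \<omega> \<inter> B))"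
  using AE_simple AE_space
  by eventually_elim (auto intro!: lfcm_simple_emeasure lfcm)

lemma measurable_card_P:
  assumes "B \<in> sets borel" "bounded B"
  shows "(\<lambda>\<omega>. card (P \<omega> \<inter> B)) \<in> M \<rightarrow>\<^sub>M count_space UNIV"
  by (rule measurable_card_void[OF void_measurable_P assms])

lemma poisson_variable_card:
  assumes B: "B \<in> sets borel" "bounded B"
  shows "poisson_variable (\<gamma> * measure lborel B) (\<lambda>\<omega>. card (P \<omega> \<inter> B))"
  unfolding poisson_variable_def
proof (intro conjI allI)
  show "0 \<le> \<gamma> * measure lborel B" using \<gamma>_pos by simp
  show [measurable]: "(\<lambda>\<omega>. card (P \<omega> \<inter> B)) \<in> M \<rightarrow>\<^sub>M count_space UNIV" by (rule measurable_card_P[OF B])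
  note measurable_\<Phi>[OF B(1), measurable]
  fix n
  have "prob {\<omega>\<in>space M. card (P \<omega> \<inter> B) = n} = prob {\<omega>\<in>space M. emeasure (\<Phi> \<omega>) B = of_nat n}"
    using AE_emeasure_eq_card B by (intro measure_eq_AE) (auto elim!: eventually_mono)
  then show "prob {\<omega>\<in>space M. card (P \<omega> \<inter> B) = n} =
      (\<gamma> * measure lborel B) ^ n / fact n * exp (- (\<gamma> * measure lborel B))"
    using poisson[OF B] by simp
qed

lemma prob_void:
  assumes "B \<in> sets borel" "bounded B"
  shows "prob {\<omega>\<in>space M. P \<omega> \<inter> B = {}} = exp (- (\<gamma> * measure lborel B))"
  using poisson[OF assms, of 0] unfolding void_event[OF assms(1)] by simp

text \<open>The void events are stable under intersection, and they determine \<open>P \<omega> \<inter> W\<close>.\<close>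

definition window_algebra :: "(real ^ 'd) set \<Rightarrow> 'w measure" where
  "window_algebra W = sigma (space M) {{\<omega>\<in>space M. P \<omega> \<inter> B = {}} |B. B \<in> sets borel \<and> B \<subseteq> W}"

lemma space_window_algebra [simp]: "space (window_algebra W) = space M"
  by (simp add: window_algebra_def space_measure_of_conv)

lemma sets_window_algebra:
  "sets (window_algebra W) = sigma_sets (space M) {{\<omega>\<in>space M. P \<omega> \<inter> B = {}} |B. B \<in> sets borel \<and> B \<subseteq> W}"
  unfolding window_algebra_def by (rule sets_measure_of) auto

lemma void_measurable_window:
  assumes "W \<in> sets borel"
  shows "void_measurable (window_algebra W) (\<lambda>\<omega>. P \<omega> \<inter> W)"
  unfolding void_measurable_def
proof (intro conjI ballI allI impI)
  fix \<omega> B assume "\<omega> \<in> space (window_algebra W)" "bounded (B :: (real ^ 'd) set)"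
  then have "finite (P \<omega> \<inter> B)" by (simp add: finite_P)
  then show "finite (P \<omega> \<inter> W \<inter> B)" by (rule rev_finite_subset) auto
next
  fix B :: "(real ^ 'd) set" assume "B \<in> sets borel"
  then have "{\<omega>\<in>space M. P \<omega> \<inter> (W \<inter> B) = {}} \<in> sets (window_algebra W)"
    unfolding sets_window_algebra using assms by (intro sigma_sets.Basic) auto
  then show "{\<omega>\<in>space (window_algebra W). P \<omega> \<inter> W \<inter> B = {}} \<in> sets (window_algebra W)"
    by (simp add: Int_assoc)
qed

lemma window_algebra_subset: "sets (window_algebra W) \<subseteq> sets M"
  unfolding sets_window_algebra
  using void_measurable_sets[OF void_measurable_P] by (intro sets.sigma_sets_subset) auto

lemma measurable_window_M: "f \<in> window_algebra W \<rightarrow>\<^sub>M N \<Longrightarrow> f \<in> M \<rightarrow>\<^sub>M N"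
  using window_algebra_subset by (auto simp: measurable_def)

text \<open>Two sets are both void exactly if their union is, so the generators of a window algebra
  form a pi-system, and independence passes from them to the generated sigma-algebras.\<close>

lemma indep_windows:
  assumes "W \<inter> W' = {}"
  shows "indep_set (sets (window_algebra W)) (sets (window_algebra W'))"
  unfolding sets_window_algebra
proof (rule indep_set_sigma_sets)
  let ?E = "\<lambda>B. {\<omega>\<in>space M. P \<omega> \<inter> B = {}}"
  have ev: "?E B \<in> events" if "B \<in> sets borel" for B
    using void_measurable_sets[OF void_measurable_P that] .
  show "indep_set {?E B |B. B \<in> sets borel \<and> B \<subseteq> W} {?E B |B. B \<in> sets borel \<and> B \<subseteq> W'}"
  proof (rule indep_setI)
    show "{?E B |B. B \<in> sets borel \<and> B \<subseteq> W} \<subseteq> events" "{?E B |B. B \<in> sets borel \<and> B \<subseteq> W'} \<subseteq> events"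
      using ev by auto
    fix a b assume "a \<in> {?E B |B. B \<in> sets borel \<and> B \<subseteq> W}" "b \<in> {?E B |B. B \<in> sets borel \<and> B \<subseteq> W'}"
    then obtain B C where BC: "a = ?E B" "b = ?E C" "B \<in> sets borel" "C \<in> sets borel" "B \<inter> C = {}"
      using assms by blast
    have "a \<inter> b = {\<omega>\<in>space M. emeasure (\<Phi> \<omega>) B = 0 \<and> emeasure (\<Phi> \<omega>) C = 0}"
      unfolding BC(1,2) void_event[OF BC(3)] void_event[OF BC(4)] by auto
    then show "prob (a \<inter> b) = prob a * prob b"
      using indep[OF BC(3-5)] unfolding BC(1,2) void_event[OF BC(3)] void_event[OF BC(4)] by simp
  qed
  show "Int_stable {?E B |B. B \<in> sets borel \<and> B \<subseteq> V}" for V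
  proof (rule Int_stableI)
    fix a b assume "a \<in> {?E B |B. B \<in> sets borel \<and> B \<subseteq> V}" "b \<in> {?E B |B. B \<in> sets borel \<and> B \<subseteq> V}"
    then obtain B C where "a = ?E B" "b = ?E C" "B \<in> sets borel" "C \<in> sets borel" "B \<subseteq> V" "C \<subseteq> V" by blast
    then show "a \<inter> b \<in> {?E B |B. B \<in> sets borel \<and> B \<subseteq> V}"
      by (intro CollectI exI[of _ "B \<union> C"]) auto
  qed
  then show "Int_stable {?E B |B. B \<in> sets borel \<and> B \<subseteq> W'}" .
qed

lemma indep_windows_expectation:
  fixes X Y :: "'w \<Rightarrow> real"
  assumes "W \<inter> W' = {}" and X: "X \<in> borel_measurable (window_algebra W)" "integrable M X"
    and Y: "Y \<in> borel_measurable (window_algebra W')" "integrable M Y"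
  shows "expectation (\<lambda>\<omega>. X \<omega> * Y \<omega>) = expectation X * expectation Y"
proof (rule indep_var_lebesgue_integral[OF _ X(2) Y(2)])
  show "indep_var borel X borel Y"
    unfolding indep_var_eq
  proof (intro conjI)
    show "X \<in> borel_measurable M" "Y \<in> borel_measurable M" using X Y by auto
    have gen: "sigma_sets (space M) {Z -` A \<inter> space M |A. A \<in> sets borel} \<subseteq> sets (window_algebra V)"
      if "Z \<in> borel_measurable (window_algebra V)" for Z :: "'w \<Rightarrow> real" and V
    proof -
      have "{Z -` A \<inter> space M |A. A \<in> sets borel} \<subseteq> sets (window_algebra V)"
        using measurable_sets[OF that] by auto
      from sets.sigma_sets_subset[OF this] show ?thesis by simp
    qed
    note 1 = gen[OF X(1)] and 2 = gen[OF Y(1)]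
    show "indep_set (sigma_sets (space M) {X -` A \<inter> space M |A. A \<in> sets borel})
       (sigma_sets (space M) {Y -` A \<inter> space M |A. A \<in> sets borel})"
      using indep_windows[OF assms(1)] 1 2 unfolding indep_sets2_eq by blast
  qed
qed

end

section \<open>Configurations without large holes\<close>

lemma good_in_subset:
  assumes "good_in c \<rho> a P" "cball c' \<rho>' \<subseteq> cball c \<rho>"
  shows "good_in c' \<rho>' a P"
  unfolding good_in_def
proof (intro conjI ballI)
  show "finite (P \<inter> cball c' \<rho>')"
    by (rule finite_subset[OF _ good_in_finite[OF assms(1)]]) (use assms(2) in auto)
  fix y assume "y \<in> cball c' \<rho>'"
  then show "\<exists>p\<in>P. dist y p \<le> a" using assms good_inE[OF assms(1), of y] by (metis mem_cball subsetD)
qed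

lemma exp_minus_le_inverse_power:
  fixes x :: real
  assumes "0 < x"
  shows "exp (- x) \<le> fact p / x ^ p"
proof -
  have "(\<Sum>i\<in>{p}. x ^ i /\<^sub>R fact i) \<le> (\<Sum>i. x ^ i /\<^sub>R fact i)"
    using assms by (intro sum_le_suminf summable_exp_generic) auto
  then have "x ^ p / fact p \<le> exp x" by (simp add: exp_def field_simps)
  then show ?thesis using assms by (simp add: exp_minus field_simps)
qed

context homogeneous_poisson
begin

text \<open>A side length that is large enough for empty cubes to be rare faster than any power of \<open>n\<close>, but
  for which \<open>scale n ^ (d + 1)\<close> is still \<open>o(n)\<close>.\<close>

definition scale :: "nat \<Rightarrow> real" where
  "scale n = root (2 * (CARD('d) + 1)) (real n)"

lemma scale_ge_1: "1 \<le> n \<Longrightarrow> 1 \<le> scale n"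
  by (simp add: scale_def)

lemma scale_pos: "1 \<le> n \<Longrightarrow> 0 < scale n"
  using scale_ge_1[of n] by simp

lemma scale_power: "scale n ^ (2 * (CARD('d) + 1)) = real n"
  unfolding scale_def by (rule real_root_pow_pos2) auto

lemma scale_power_sqrt: "scale n ^ (CARD('d) + 1) = sqrt (real n)"
proof -
  have "0 \<le> scale n" by (simp add: scale_def)
  moreover have "(scale n ^ (CARD('d) + 1))\<^sup>2 = real n"
    using scale_power[of n] by (simp only: power_mult[symmetric] mult.commute)
  ultimately show ?thesis by (metis real_sqrt_unique zero_le_power)
qed

lemma scale_le_sqrt:
  assumes "1 \<le> n"
  shows "scale n \<le> sqrt (real n)"
proof -
  have "scale n ^ 1 \<le> scale n ^ (CARD('d) + 1)"
    using scale_ge_1[OF assms] by (intro power_increasing) auto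
  then show ?thesis unfolding scale_power_sqrt by simp
qed

lemma eventually_scale_small:
  assumes "0 \<le> C"
  shows "\<forall>\<^sub>F n in sequentially. R + C * scale n \<le> real n"
proof -
  define K where "K = C + \<bar>R\<bar> + 1"
  have "\<forall>\<^sub>F n in sequentially. K\<^sup>2 \<le> real n"
    using filterlim_real_sequentially unfolding filterlim_at_top by blast
  then show ?thesis using eventually_ge_at_top[of 1]
  proof eventually_elim
    case (elim n)
    have "K \<le> sqrt (real n)" using elim by (simp add: real_le_rsqrt)
    then have "K * sqrt (real n) \<le> sqrt (real n) * sqrt (real n)" by (intro mult_right_mono) auto
    then have 1: "K * sqrt (real n) \<le> real n" by simp
    have "1 \<le> sqrt (real n)" using elim by simp
    then have "\<bar>R\<bar> * 1 \<le> \<bar>R\<bar> * sqrt (real n)" by (intro mult_left_mono) auto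
    moreover have "C * scale n \<le> C * sqrt (real n)" using scale_le_sqrt[OF elim(2)] assms by (rule mult_left_mono)
    ultimately have "R + C * scale n \<le> (C + \<bar>R\<bar>) * sqrt (real n)" by (simp add: algebra_simps)
    also have "\<dots> \<le> K * sqrt (real n)" unfolding K_def by (intro mult_right_mono) auto
    finally show ?case using 1 by linarith
  qed
qed

text \<open>As \<open>scale n \<ge> 1\<close> for \<open>n \<ge> 1\<close>, the cubes with index in
  \<open>index_box n\<close> cover the ball of radius \<open>n\<close>.\<close>

definition good :: "nat \<Rightarrow> 'w set" where
  "good n = {\<omega>\<in>space M. \<forall>z\<in>index_box n. P \<omega> \<inter> cube (scale n) z \<noteq> {}}"

text \<open>By \<open>dist_in_cube\<close> this bounds the diameter of a cube of side
  \<open>scale n\<close>; it is the hole size on \<open>good n\<close>.\<close>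

definition mesh :: "nat \<Rightarrow> real" where
  "mesh n = real CARD('d) * scale n"

lemma mesh_pos: "1 \<le> n \<Longrightarrow> 0 < mesh n"
  using scale_pos by (simp add: mesh_def)

lemma good_sets [measurable]: "good n \<in> sets M"
proof -
  have "{\<omega>\<in>space M. P \<omega> \<inter> cube (scale n) z \<noteq> {}} \<in> sets M" for z
    using void_measurable_sets[OF void_measurable_P cube_borel] by (rule sets.sets_Collect_neg)
  then show ?thesis unfolding good_def by (intro sets.sets_Collect_finite_All) auto
qed

lemma good_good_in:
  assumes "\<omega> \<in> good n" "1 \<le> n"
  shows "good_in 0 (real n) (mesh n) (P \<omega>)"
  unfolding good_in_def
proof (intro conjI ballI)
  have \<omega>: "\<omega> \<in> space M" using assms by (simp add: good_def)
  show "finite (P \<omega> \<inter> cball 0 (real n))" using finite_P[OF \<omega>] by simp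
  fix y :: "real ^ 'd" assume "y \<in> cball 0 (real n)"
  moreover have "real n * 1 \<le> real n * scale n" using scale_ge_1[OF assms(2)] by (intro mult_left_mono) auto
  ultimately have "norm y \<le> real n * scale n" by simp
  then have "cube_index (scale n) y \<in> index_box n" by (rule cube_index_in_index_box[OF scale_pos[OF assms(2)]])
  then obtain p where p: "p \<in> P \<omega>" "p \<in> cube (scale n) (cube_index (scale n) y)"
    using assms(1) by (auto simp: good_def)
  then have "dist y p \<le> mesh n" unfolding mesh_def
    by (intro dist_in_cube[OF scale_pos[OF assms(2)]]) (auto simp: cube_def)
  then show "\<exists>p\<in>P \<omega>. dist y p \<le> mesh n" using p by blast
qed

text \<open>A union bound over at most \<open>(3 * n) ^ d\<close> cubes. The exponential is
  estimated by a single term of its series, of order \<open>2 * (d + 1) * q\<close>, because this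
  power of \<open>scale n\<close> equals \<open>n ^ q\<close>; the exponent \<open>q\<close> is at
  the disposal of the application.\<close>

lemma prob_not_good:
  assumes "1 \<le> n"
  shows "prob (space M - good n) \<le> 3 ^ CARD('d) * fact (2 * (CARD('d) + 1) * q) / \<gamma> ^ (2 * (CARD('d) + 1) * q)
            * (real n ^ CARD('d) / real n ^ q)"
proof -
  let ?d = "CARD('d)" let ?p = "2 * (CARD('d) + 1) * q"
  note s = scale_pos[OF assms] scale_ge_1[OF assms]
  define E where "E z = {\<omega>\<in>space M. P \<omega> \<inter> cube (scale n) z = {}}" for z
  have E[measurable]: "E z \<in> sets M" for z
    unfolding E_def by (rule void_measurable_sets[OF void_measurable_P cube_borel])
  have pE: "prob (E z) \<le> fact ?p / \<gamma> ^ ?p / real n ^ q" for z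
  proof -
    have "prob (E z) = exp (- (\<gamma> * scale n ^ ?d))"
      unfolding E_def by (simp add: prob_void bounded_cube s measure_cube)
    also have "\<dots> \<le> exp (- (\<gamma> * scale n))"
    proof -
      have "scale n ^ 1 \<le> scale n ^ ?d" using s by (intro power_increasing) (auto simp: Suc_le_eq)
      then show ?thesis using \<gamma>_pos by simp
    qed
    also have "\<dots> \<le> fact ?p / (\<gamma> * scale n) ^ ?p" using \<gamma>_pos s by (intro exp_minus_le_inverse_power) simp
    also have "(\<gamma> * scale n) ^ ?p = \<gamma> ^ ?p * real n ^ q"
      unfolding power_mult_distrib using scale_power[of n] by (simp only: power_mult)
    finally show ?thesis by simp
  qed
  have "space M - good n = (\<Union>z\<in>index_box n. E z)" by (auto simp: good_def E_def)
  then have "prob (space M - good n) \<le> (\<Sum>z\<in>index_box n. prob (E z))"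
    by (simp only:) (rule finite_measure_subadditive_finite, auto)
  also have "\<dots> \<le> (\<Sum>z\<in>(index_box n :: ('d \<Rightarrow> int) set). fact ?p / \<gamma> ^ ?p / real n ^ q)"
    by (intro sum_mono pE)
  also have "\<dots> = real (2 * n + 1) ^ ?d * (fact ?p / \<gamma> ^ ?p / real n ^ q)"
    by (simp add: card_index_box)
  also have "\<dots> \<le> (3 * real n) ^ ?d * (fact ?p / \<gamma> ^ ?p / real n ^ q)"
    using assms \<gamma>_pos by (intro mult_right_mono power_mono) auto
  finally show ?thesis by (simp add: power_mult_distrib mult_ac)
qed

section \<open>Counts in large balls on rare events\<close>

definition ball_count :: "nat \<Rightarrow> 'w \<Rightarrow> nat" where
  "ball_count j \<omega> = card (P \<omega> \<inter> cball 0 (real j))"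

lemma measurable_ball_count [measurable]: "ball_count j \<in> M \<rightarrow>\<^sub>M count_space UNIV"
  unfolding ball_count_def[abs_def] by (rule measurable_card_P) auto

text \<open>The radius \<open>j + 1\<close> anticipates \<open>remainder_bound\<close>: if
  \<open>j + 1\<close> is the first good index after a bad one, the count in radius
  \<open>j + 1\<close> comes with the event that \<open>j\<close> is not good.\<close>

lemma ball_count_fourth_moment:
  obtains C where "0 \<le> C"
    "\<And>j. 1 \<le> j \<Longrightarrow> (\<integral>\<^sup>+\<omega>. ennreal (real (ball_count (j + 1) \<omega>) ^ 4) \<partial>M) \<le> ennreal (C * real j ^ (4 * CARD('d)))"
proof
  let ?d = "CARD('d)"
  define \<kappa> where "\<kappa> = unit_ball_vol (real ?d)"
  define C where "C = 256 * (1 + (\<gamma> * \<kappa> * 2 ^ ?d) ^ 4)"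
  have \<kappa>: "0 \<le> \<kappa>" by (simp add: \<kappa>_def)
  show "0 \<le> C" by (simp add: C_def)
  fix j :: nat assume j: "1 \<le> j"
  have "measure lborel (cball (0 :: real ^ 'd) (real (j + 1))) = \<kappa> * real (j + 1) ^ ?d"
    by (simp add: content_cball \<kappa>_def)
  then have pv: "poisson_variable (\<gamma> * (\<kappa> * real (j + 1) ^ ?d)) (ball_count (j + 1))"
    unfolding ball_count_def[abs_def] using poisson_variable_card[of "cball 0 (real (j + 1))"] by simp
  have "real (j + 1) ^ ?d \<le> (2 * real j) ^ ?d" using j by (intro power_mono) auto
  then have "\<gamma> * (\<kappa> * real (j + 1) ^ ?d) \<le> \<gamma> * (\<kappa> * (2 * real j) ^ ?d)"
    using \<gamma>_pos \<kappa> by (intro mult_left_mono) auto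
  also have "\<dots> = \<gamma> * \<kappa> * 2 ^ ?d * real j ^ ?d" by (simp add: power_mult_distrib)
  finally have "(\<gamma> * (\<kappa> * real (j + 1) ^ ?d)) ^ 4 \<le> (\<gamma> * \<kappa> * 2 ^ ?d * real j ^ ?d) ^ 4"
    using \<gamma>_pos \<kappa> by (intro power_mono) auto
  also have "\<dots> = (\<gamma> * \<kappa> * 2 ^ ?d) ^ 4 * real j ^ (4 * ?d)"
    by (simp add: power_mult_distrib mult.commute[of 4] flip: power_mult)
  finally have "256 * (1 + (\<gamma> * (\<kappa> * real (j + 1) ^ ?d)) ^ 4) \<le> 256 * (real j ^ (4 * ?d) + (\<gamma> * \<kappa> * 2 ^ ?d) ^ 4 * real j ^ (4 * ?d))"
    using j by (intro mult_left_mono add_mono one_le_power) auto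
  also have "\<dots> = C * real j ^ (4 * ?d)" by (simp add: C_def algebra_simps)
  finally show "(\<integral>\<^sup>+\<omega>. ennreal (real (ball_count (j + 1) \<omega>) ^ 4) \<partial>M) \<le> ennreal (C * real j ^ (4 * ?d))"
    using poisson_fourth_moment[OF pv] by (meson ennreal_leI order_trans)
qed

text \<open>The second moment on a rare event is split by \<open>N\<^sup>2 \<le> c\<inverse> N\<^sup>4 + c\<close> with \<open>c = j\<^sup>q\<close>.\<close>

lemma not_good_second_moment:
  obtains C where "0 \<le> C"
    "\<And>j. 1 \<le> j \<Longrightarrow> (\<integral>\<^sup>+\<omega>. ennreal ((real (ball_count (j + 1) \<omega>))\<^sup>2) * indicator (space M - good j) \<omega> \<partial>M)
        \<le> ennreal (C * inverse ((real j)\<^sup>2))"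
proof -
  let ?d = "CARD('d)"
  obtain C1 where C1: "0 \<le> C1"
    "\<And>j. 1 \<le> j \<Longrightarrow> (\<integral>\<^sup>+\<omega>. ennreal (real (ball_count (j + 1) \<omega>) ^ 4) \<partial>M) \<le> ennreal (C1 * real j ^ (4 * ?d))"
    by (rule ball_count_fourth_moment) (rule that)
  \<comment> \<open>Chosen so that both terms decay like \<open>1 / j ^ 2\<close>:
    \<open>j ^ (4 * d) / j ^ q\<close> from the fourth moment, and
    \<open>j ^ q * j ^ d / j ^ q'\<close> from the rare event.\<close>
  define q where "q = 4 * ?d + 2"
  define q' where "q' = q + ?d + 2"
  define C2 where "C2 = 3 ^ ?d * fact (2 * (?d + 1) * q') / \<gamma> ^ (2 * (?d + 1) * q')"
  have C2: "0 \<le> C2" using \<gamma>_pos by (simp add: C2_def)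
  show ?thesis
  proof (rule that[of "C1 + C2"])
    show "0 \<le> C1 + C2" using C1 C2 by simp
    fix j :: nat assume j: "1 \<le> j"
    let ?N = "\<lambda>\<omega>. real (ball_count (j + 1) \<omega>)"
    define c where "c = real j ^ q"
    have c: "0 < c" using j by (simp add: c_def)
    have "(\<integral>\<^sup>+\<omega>. ennreal ((?N \<omega>)\<^sup>2) * indicator (space M - good j) \<omega> \<partial>M)
      \<le> (\<integral>\<^sup>+\<omega>. ennreal (inverse c) * ennreal (?N \<omega> ^ 4) + ennreal c * indicator (space M - good j) \<omega> \<partial>M)"
    proof (rule nn_integral_mono)
      fix \<omega>
      have "0 \<le> (?N \<omega> ^ 2 - c)\<^sup>2" by simp
      then have "2 * c * (?N \<omega>)\<^sup>2 \<le> ?N \<omega> ^ 4 + c\<^sup>2"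
        by (simp add: power2_diff power4_eq_xxxx power2_eq_square algebra_simps)
      moreover have "c * (?N \<omega>)\<^sup>2 \<le> 2 * c * (?N \<omega>)\<^sup>2" using c by simp
      ultimately have "c * (?N \<omega>)\<^sup>2 \<le> ?N \<omega> ^ 4 + c\<^sup>2" by linarith
      then have "(?N \<omega>)\<^sup>2 \<le> inverse c * ?N \<omega> ^ 4 + c" using c by (simp add: field_simps power2_eq_square)
      then have "ennreal ((?N \<omega>)\<^sup>2) \<le> ennreal (inverse c * ?N \<omega> ^ 4 + c)" by (rule ennreal_leI)
      also have "\<dots> = ennreal (inverse c) * ennreal (?N \<omega> ^ 4) + ennreal c"
        using c by (simp add: ennreal_plus ennreal_mult'')
      finally show "ennreal ((?N \<omega>)\<^sup>2) * indicator (space M - good j) \<omega>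
          \<le> ennreal (inverse c) * ennreal (?N \<omega> ^ 4) + ennreal c * indicator (space M - good j) \<omega>"
        by (simp add: indicator_def)
    qed
    also have "\<dots> = ennreal (inverse c) * (\<integral>\<^sup>+\<omega>. ennreal (?N \<omega> ^ 4) \<partial>M) + ennreal c * emeasure M (space M - good j)"
      by (subst nn_integral_add) (auto simp: nn_integral_cmult)
    also have "\<dots> \<le> ennreal (inverse c) * ennreal (C1 * real j ^ (4 * ?d)) + ennreal c * ennreal (C2 * (real j ^ ?d / real j ^ q'))"
      using prob_not_good[OF j, of q'] C1(2)[OF j]
      by (intro add_mono mult_left_mono) (auto simp: emeasure_eq_measure C2_def intro!: ennreal_leI)
    also have "\<dots> = ennreal (inverse c * (C1 * real j ^ (4 * ?d)) + c * (C2 * (real j ^ ?d / real j ^ q')))"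
    proof -
      have "ennreal (inverse c) * ennreal x + ennreal c * ennreal y = ennreal (inverse c * x + c * y)"
        if "0 \<le> x" "0 \<le> y" for x y
        using c that by (simp add: ennreal_plus ennreal_mult)
      then show ?thesis using C1(1) C2 by simp
    qed
    also have "inverse c * (C1 * real j ^ (4 * ?d)) = C1 * inverse ((real j)\<^sup>2)"
      using j by (simp add: c_def q_def power_add field_simps power2_eq_square)
    also have "c * (C2 * (real j ^ ?d / real j ^ q')) = C2 * inverse ((real j)\<^sup>2)"
      using j by (simp add: c_def q'_def power_add field_simps power2_eq_square)
    finally show "(\<integral>\<^sup>+\<omega>. ennreal ((?N \<omega>)\<^sup>2) * indicator (space M - good j) \<omega> \<partial>M)
        \<le> ennreal ((C1 + C2) * inverse ((real j)\<^sup>2))" by (simp add: algebra_simps)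
  qed
qed

lemma AE_eventually_good: "AE \<omega> in M. \<forall>\<^sub>F n in sequentially. \<omega> \<in> good n"
proof -
  let ?d = "CARD('d)"
  define C where "C = 3 ^ ?d * fact (2 * (?d + 1) * (?d + 2)) / \<gamma> ^ (2 * (?d + 1) * (?d + 2))"
  have "summable (\<lambda>n. prob (space M - good n))"
  proof (rule summable_comparison_test_ev)
    show "summable (\<lambda>n. C * (inverse (real n ^ 2)))"
      by (intro summable_mult inverse_power_summable) simp
    show "\<forall>\<^sub>F n in sequentially. norm (prob (space M - good n)) \<le> C * inverse (real n ^ 2)"
      using eventually_ge_at_top[of 1]
    proof eventually_elim
      case (elim n)
      have "real n ^ ?d / real n ^ (?d + 2) = inverse (real n ^ 2)"
        using elim by (simp add: power_add field_simps power2_eq_square)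
      then show ?case using prob_not_good[OF elim, of "?d + 2"] by (simp add: C_def)
    qed
  qed
  then have "AE \<omega> in M. \<forall>\<^sub>F n in sequentially. \<omega> \<in> space M - (space M - good n)"
    by (intro borel_cantelli_AE1) (auto simp: emeasure_eq_measure)
  then show ?thesis by eventually_elim (auto elim: eventually_mono)
qed

text \<open>For large \<open>n\<close> the hole size \<open>mesh n\<close> will do, because it is of
  smaller order than the radius \<open>n\<close> of the region without larger holes.\<close>

lemma AE_globally_good: "AE \<omega> in M. globally_good (P \<omega>)"
  using AE_eventually_good
proof eventually_elim
  case (elim \<omega>)
  show ?case unfolding globally_good_def
  proof (intro allI impI)
    fix C R :: real assume C: "0 \<le> C"
    have "\<forall>\<^sub>F n in sequentially. R + (C * real CARD('d)) * scale n \<le> real n"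
      using C by (intro eventually_scale_small) simp
    with elim eventually_ge_at_top[of 1]
    have "\<forall>\<^sub>F n in sequentially. good_in 0 (R + C * mesh n) (mesh n) (P \<omega>) \<and> 0 < mesh n"
    proof eventually_elim
      case (elim n)
      then show ?case
        using good_good_in[OF elim(1,2)] mesh_pos[of n]
        by (auto simp: mesh_def mult.assoc intro!: good_in_subset[of 0 "real n"])
    qed
    then show "\<exists>a>0. good_in 0 (R + C * a) a (P \<omega>)"
      using eventually_happens'[OF sequentially_bot] by blast
  qed
qed

end

section \<open>Variance estimates\<close>

context prob_space
begin

lemma square_integrable_mult:
  fixes X Y :: "'a \<Rightarrow> real"
  assumes [measurable]: "X \<in> borel_measurable M" "Y \<in> borel_measurable M"
    and "integrable M (\<lambda>\<omega>. (X \<omega>)\<^sup>2)" "integrable M (\<lambda>\<omega>. (Y \<omega>)\<^sup>2)"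
  shows "integrable M (\<lambda>\<omega>. X \<omega> * Y \<omega>)"
proof (rule Bochner_Integration.integrable_bound)
  show "integrable M (\<lambda>\<omega>. (X \<omega>)\<^sup>2 + (Y \<omega>)\<^sup>2)" using assms by simp
  have "\<bar>x * y\<bar> \<le> x\<^sup>2 + y\<^sup>2" for x y :: real
  proof -
    have "2 * (\<bar>x\<bar> * \<bar>y\<bar>) \<le> x\<^sup>2 + y\<^sup>2"
      using sum_squares_bound[of "\<bar>x\<bar>" "\<bar>y\<bar>"] by (simp add: mult.assoc)
    moreover have "0 \<le> \<bar>x\<bar> * \<bar>y\<bar>" by simp
    ultimately show ?thesis unfolding abs_mult by linarith
  qed
  then show "AE \<omega> in M. norm (X \<omega> * Y \<omega>) \<le> norm ((X \<omega>)\<^sup>2 + (Y \<omega>)\<^sup>2)" by simp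
qed simp

lemma square_integrable_imp_integrable':
  fixes X :: "'a \<Rightarrow> real"
  assumes "X \<in> borel_measurable M" "integrable M (\<lambda>\<omega>. (X \<omega>)\<^sup>2)"
  shows "integrable M X"
  using square_integrable_mult[OF assms(1) borel_measurable_const assms(2), of 1] by simp

lemma variance_le_second_moment:
  fixes X :: "'a \<Rightarrow> real"
  assumes "X \<in> borel_measurable M" "integrable M (\<lambda>\<omega>. (X \<omega>)\<^sup>2)"
  shows "variance X \<le> expectation (\<lambda>\<omega>. (X \<omega>)\<^sup>2)"
  using variance_eq[OF square_integrable_imp_integrable'[OF assms] assms(2)] by simp

lemma square_integrable_add:
  fixes X Y :: "'a \<Rightarrow> real"
  assumes "X \<in> borel_measurable M" "Y \<in> borel_measurable M"
    and "integrable M (\<lambda>\<omega>. (X \<omega>)\<^sup>2)" "integrable M (\<lambda>\<omega>. (Y \<omega>)\<^sup>2)"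
  shows "integrable M (\<lambda>\<omega>. (X \<omega> + Y \<omega>)\<^sup>2)"
  unfolding power2_sum using assms square_integrable_mult[OF assms]
  by (simp add: mult.assoc)

lemma square_integrable_sum:
  fixes X :: "'i \<Rightarrow> 'a \<Rightarrow> real"
  assumes "finite I" "\<And>i. i \<in> I \<Longrightarrow> X i \<in> borel_measurable M" "\<And>i. i \<in> I \<Longrightarrow> integrable M (\<lambda>\<omega>. (X i \<omega>)\<^sup>2)"
  shows "integrable M (\<lambda>\<omega>. (\<Sum>i\<in>I. X i \<omega>)\<^sup>2)"
  using assms by (induction I rule: finite_induct) (auto intro!: square_integrable_add)

text \<open>Covariances vanish unless \<open>j\<close> lies in the dependency neighbourhood
  \<open>nb i\<close>, and the remaining ones are at most \<open>v\<close> by the inequality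
  \<open>2 * a * b \<le> a ^ 2 + b ^ 2\<close> for the centred variables.\<close>

lemma variance_sum_local_dependence:
  fixes X :: "'i \<Rightarrow> 'a \<Rightarrow> real"
  assumes I: "finite I" and meas[measurable]: "\<And>i. i \<in> I \<Longrightarrow> X i \<in> borel_measurable M"
    and sq: "\<And>i. i \<in> I \<Longrightarrow> integrable M (\<lambda>\<omega>. (X i \<omega>)\<^sup>2)"
    and v: "\<And>i. i \<in> I \<Longrightarrow> expectation (\<lambda>\<omega>. (X i \<omega>)\<^sup>2) \<le> v"
    and nbr: "\<And>i. i \<in> I \<Longrightarrow> finite (nb i) \<and> card (nb i) \<le> c"
    and uncorr: "\<And>i j. i \<in> I \<Longrightarrow> j \<in> I \<Longrightarrow> j \<notin> nb i \<Longrightarrow>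
      expectation (\<lambda>\<omega>. X i \<omega> * X j \<omega>) = expectation (X i) * expectation (X j)"
  shows "variance (\<lambda>\<omega>. \<Sum>i\<in>I. X i \<omega>) \<le> real (card I) * real c * v"
proof -
  define Y where "Y i \<omega> = X i \<omega> - expectation (X i)" for i \<omega>
  have intX: "integrable M (X i)" if "i \<in> I" for i
    using square_integrable_imp_integrable' meas sq that by blast
  have [measurable]: "Y i \<in> borel_measurable M" if "i \<in> I" for i
    unfolding Y_def[abs_def] using meas that by measurable
  have sqY: "integrable M (\<lambda>\<omega>. (Y i \<omega>)\<^sup>2)" if "i \<in> I" for i
    using square_integrable_add[of "X i" "\<lambda>_. - expectation (X i)"] meas sq that by (simp add: Y_def)
  have vY: "expectation (\<lambda>\<omega>. (Y i \<omega>)\<^sup>2) \<le> v" if "i \<in> I" for i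
    using variance_le_second_moment[OF meas[OF that] sq[OF that]] v[OF that] by (simp add: Y_def)
  have intXX: "integrable M (\<lambda>\<omega>. X i \<omega> * X j \<omega>)" if "i \<in> I" "j \<in> I" for i j
    using square_integrable_mult meas sq that by blast
  have intYY: "integrable M (\<lambda>\<omega>. Y i \<omega> * Y j \<omega>)" if "i \<in> I" "j \<in> I" for i j
    using that by (intro square_integrable_mult sqY) auto
  have cov: "expectation (\<lambda>\<omega>. Y i \<omega> * Y j \<omega>) = expectation (\<lambda>\<omega>. X i \<omega> * X j \<omega>) - expectation (X i) * expectation (X j)"
    if "i \<in> I" "j \<in> I" for i j
  proof -
    have "expectation (\<lambda>\<omega>. Y i \<omega> * Y j \<omega>) = expectation (\<lambda>\<omega>. X i \<omega> * X j \<omega> - expectation (X j) * X i \<omega>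
        - expectation (X i) * X j \<omega> + expectation (X i) * expectation (X j))"
      by (intro Bochner_Integration.integral_cong) (auto simp: Y_def algebra_simps)
    also have "\<dots> = expectation (\<lambda>\<omega>. X i \<omega> * X j \<omega>) - expectation (X i) * expectation (X j)"
      using intX[OF that(1)] intX[OF that(2)] intXX[OF that] by (simp add: prob_space)
    finally show ?thesis .
  qed
  have bound: "expectation (\<lambda>\<omega>. Y i \<omega> * Y j \<omega>) \<le> (if j \<in> nb i then v else 0)" if "i \<in> I" "j \<in> I" for i j
  proof (cases "j \<in> nb i")
    case True
    have "expectation (\<lambda>\<omega>. Y i \<omega> * Y j \<omega>) \<le> expectation (\<lambda>\<omega>. ((Y i \<omega>)\<^sup>2 + (Y j \<omega>)\<^sup>2) / 2)"
    proof (rule integral_mono[OF intYY[OF that]])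
      show "integrable M (\<lambda>\<omega>. ((Y i \<omega>)\<^sup>2 + (Y j \<omega>)\<^sup>2) / 2)" using sqY that by simp
      show "Y i \<omega> * Y j \<omega> \<le> ((Y i \<omega>)\<^sup>2 + (Y j \<omega>)\<^sup>2) / 2" for \<omega>
        using sum_squares_bound[of "Y i \<omega>" "Y j \<omega>"] by simp
    qed
    also have "\<dots> = (expectation (\<lambda>\<omega>. (Y i \<omega>)\<^sup>2) + expectation (\<lambda>\<omega>. (Y j \<omega>)\<^sup>2)) / 2"
      using sqY that by simp
    also have "\<dots> \<le> v" using vY[OF that(1)] vY[OF that(2)] by simp
    finally show ?thesis using True by simp
  next
    case False
    then show ?thesis using cov[OF that] uncorr[OF that] by simp
  qed
  have v0: "0 \<le> v" if "i \<in> I" for i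
    using order_trans[OF _ vY[OF that]] by (simp add: integral_nonneg_AE)
  have "variance (\<lambda>\<omega>. \<Sum>i\<in>I. X i \<omega>) = expectation (\<lambda>\<omega>. (\<Sum>i\<in>I. Y i \<omega>)\<^sup>2)"
    using intX by (simp add: Y_def sum_subtractf Bochner_Integration.integral_sum)
  also have "\<dots> = expectation (\<lambda>\<omega>. \<Sum>i\<in>I. \<Sum>j\<in>I. Y i \<omega> * Y j \<omega>)"
    by (simp add: power2_eq_square sum_product)
  also have "\<dots> = (\<Sum>i\<in>I. \<Sum>j\<in>I. expectation (\<lambda>\<omega>. Y i \<omega> * Y j \<omega>))"
    using intYY by (subst Bochner_Integration.integral_sum; simp add: Bochner_Integration.integral_sum Bochner_Integration.integrable_sum)
  also have "\<dots> \<le> (\<Sum>i\<in>I. \<Sum>j\<in>I. if j \<in> nb i then v else 0)"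
    by (intro sum_mono bound)
  also have "\<dots> \<le> (\<Sum>i\<in>I. real c * v)"
  proof (rule sum_mono)
    fix i assume i: "i \<in> I"
    have "(\<Sum>j\<in>I. if j \<in> nb i then v else 0) = real (card (I \<inter> nb i)) * v"
      using I by (simp add: sum.If_cases)
    also have "\<dots> \<le> real c * v"
    proof (rule mult_right_mono[OF _ v0[OF i]])
      have "card (I \<inter> nb i) \<le> card (nb i)" using nbr[OF i] by (intro card_mono) auto
      then show "real (card (I \<inter> nb i)) \<le> real c" using nbr[OF i] by simp
    qed
    finally show "(\<Sum>j\<in>I. if j \<in> nb i then v else 0) \<le> real c * v" .
  qed
  finally show ?thesis by (simp add: mult.assoc)
qed

text \<open>The Cauchy-Schwarz estimate of the mixed term in Young's form,
  \<open>2 * x * u \<le> \<epsilon> * x ^ 2 + u ^ 2 / \<epsilon>\<close>, which is linear in the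
  variances. \<open>D\<close> stands for the boundary term, controlled by its variance only, and
  \<open>R\<close> for the error, small in second moment.\<close>

lemma variance_add_bound:
  fixes X D R :: "'a \<Rightarrow> real"
  assumes X: "X \<in> borel_measurable M" "integrable M (\<lambda>\<omega>. (X \<omega>)\<^sup>2)"
    and D: "D \<in> borel_measurable M" "integrable M (\<lambda>\<omega>. (D \<omega>)\<^sup>2)"
    and R: "R \<in> borel_measurable M" "integrable M (\<lambda>\<omega>. (R \<omega>)\<^sup>2)"
    and "0 < \<epsilon>"
  shows "\<bar>variance (\<lambda>\<omega>. X \<omega> + D \<omega> + R \<omega>) - variance X\<bar>
     \<le> \<epsilon> * variance X + (1 + 1 / \<epsilon>) * (2 * variance D + 2 * expectation (\<lambda>\<omega>. (R \<omega>)\<^sup>2))"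
proof -
  define x where "x \<omega> = X \<omega> - expectation X" for \<omega>
  define e where "e \<omega> = D \<omega> - expectation D" for \<omega>
  define r where "r \<omega> = R \<omega> - expectation R" for \<omega>
  define u where "u \<omega> = e \<omega> + r \<omega>" for \<omega>
  note iX = square_integrable_imp_integrable'[OF X] and iD = square_integrable_imp_integrable'[OF D]
    and iR = square_integrable_imp_integrable'[OF R]
  have mx: "x \<in> borel_measurable M" and me: "e \<in> borel_measurable M" and mr: "r \<in> borel_measurable M"
    using X D R by (auto simp: x_def[abs_def] e_def[abs_def] r_def[abs_def])
  then have mu: "u \<in> borel_measurable M" by (auto simp: u_def[abs_def])
  have sx: "integrable M (\<lambda>\<omega>. (x \<omega>)\<^sup>2)"
    using square_integrable_add[of X "\<lambda>_. - expectation X"] X by (simp add: x_def)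
  have se: "integrable M (\<lambda>\<omega>. (e \<omega>)\<^sup>2)"
    using square_integrable_add[of D "\<lambda>_. - expectation D"] D by (simp add: e_def)
  have sr: "integrable M (\<lambda>\<omega>. (r \<omega>)\<^sup>2)"
    using square_integrable_add[of R "\<lambda>_. - expectation R"] R by (simp add: r_def)
  have su: "integrable M (\<lambda>\<omega>. (u \<omega>)\<^sup>2)"
    unfolding u_def by (rule square_integrable_add[OF me mr se sr])
  have sxu: "integrable M (\<lambda>\<omega>. x \<omega> * u \<omega>)" by (rule square_integrable_mult[OF mx mu sx su])
  have "expectation (\<lambda>\<omega>. X \<omega> + D \<omega> + R \<omega>) = expectation X + expectation D + expectation R"
    using iX iD iR by simp
  then have "variance (\<lambda>\<omega>. X \<omega> + D \<omega> + R \<omega>) = expectation (\<lambda>\<omega>. (x \<omega>)\<^sup>2 + 2 * (x \<omega> * u \<omega>) + (u \<omega>)\<^sup>2)"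
    by (intro Bochner_Integration.integral_cong) (auto simp: x_def e_def r_def u_def power2_eq_square algebra_simps)
  also have "\<dots> = variance X + 2 * expectation (\<lambda>\<omega>. x \<omega> * u \<omega>) + expectation (\<lambda>\<omega>. (u \<omega>)\<^sup>2)"
    using sx sxu su by (simp add: x_def[symmetric])
  finally have eq: "variance (\<lambda>\<omega>. X \<omega> + D \<omega> + R \<omega>) - variance X = 2 * expectation (\<lambda>\<omega>. x \<omega> * u \<omega>) + expectation (\<lambda>\<omega>. (u \<omega>)\<^sup>2)"
    by simp
  have "\<bar>2 * expectation (\<lambda>\<omega>. x \<omega> * u \<omega>)\<bar> = \<bar>expectation (\<lambda>\<omega>. 2 * (x \<omega> * u \<omega>))\<bar>" by simp
  also have "\<dots> \<le> expectation (\<lambda>\<omega>. \<bar>2 * (x \<omega> * u \<omega>)\<bar>)"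
    by (rule integral_abs_bound)
  also have "\<dots> \<le> expectation (\<lambda>\<omega>. \<epsilon> * (x \<omega>)\<^sup>2 + 1 / \<epsilon> * (u \<omega>)\<^sup>2)"
  proof (rule integral_mono)
    show "integrable M (\<lambda>\<omega>. \<bar>2 * (x \<omega> * u \<omega>)\<bar>)" using sxu by (intro integrable_abs integrable_mult_right)
    show "integrable M (\<lambda>\<omega>. \<epsilon> * (x \<omega>)\<^sup>2 + 1 / \<epsilon> * (u \<omega>)\<^sup>2)" using sx su by simp
    fix \<omega>
    have "2 * (\<epsilon> * \<bar>x \<omega>\<bar>) * \<bar>u \<omega>\<bar> \<le> (\<epsilon> * \<bar>x \<omega>\<bar>)\<^sup>2 + \<bar>u \<omega>\<bar>\<^sup>2" by (rule sum_squares_bound)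
    then show "\<bar>2 * (x \<omega> * u \<omega>)\<bar> \<le> \<epsilon> * (x \<omega>)\<^sup>2 + 1 / \<epsilon> * (u \<omega>)\<^sup>2"
      using \<open>0 < \<epsilon>\<close> by (simp add: field_simps abs_mult power2_eq_square)
  qed
  also have "\<dots> = \<epsilon> * variance X + 1 / \<epsilon> * expectation (\<lambda>\<omega>. (u \<omega>)\<^sup>2)"
    using sx su by (simp add: x_def[symmetric])
  finally have 1: "\<bar>2 * expectation (\<lambda>\<omega>. x \<omega> * u \<omega>)\<bar> \<le> \<epsilon> * variance X + 1 / \<epsilon> * expectation (\<lambda>\<omega>. (u \<omega>)\<^sup>2)" .
  have "expectation (\<lambda>\<omega>. (u \<omega>)\<^sup>2) \<le> expectation (\<lambda>\<omega>. 2 * (e \<omega>)\<^sup>2 + 2 * (r \<omega>)\<^sup>2)"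
  proof (rule integral_mono[OF su])
    show "integrable M (\<lambda>\<omega>. 2 * (e \<omega>)\<^sup>2 + 2 * (r \<omega>)\<^sup>2)" using se sr by simp
    fix \<omega> show "(u \<omega>)\<^sup>2 \<le> 2 * (e \<omega>)\<^sup>2 + 2 * (r \<omega>)\<^sup>2"
      using sum_squares_bound[of "e \<omega>" "r \<omega>"] by (simp add: u_def power2_sum)
  qed
  also have "\<dots> = 2 * variance D + 2 * variance R" using se sr by (simp add: e_def[symmetric] r_def[symmetric])
  also have "\<dots> \<le> 2 * variance D + 2 * expectation (\<lambda>\<omega>. (R \<omega>)\<^sup>2)"
    using variance_le_second_moment[OF R] by simp
  finally have 2: "expectation (\<lambda>\<omega>. (u \<omega>)\<^sup>2) \<le> 2 * variance D + 2 * expectation (\<lambda>\<omega>. (R \<omega>)\<^sup>2)" .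
  have 3: "0 \<le> expectation (\<lambda>\<omega>. (u \<omega>)\<^sup>2)" by simp
  have "\<bar>variance (\<lambda>\<omega>. X \<omega> + D \<omega> + R \<omega>) - variance X\<bar> \<le> \<epsilon> * variance X + (1 + 1 / \<epsilon>) * expectation (\<lambda>\<omega>. (u \<omega>)\<^sup>2)"
    unfolding eq distrib_right mult_1 using 1 3 by linarith
  also have "\<dots> \<le> \<epsilon> * variance X + (1 + 1 / \<epsilon>) * (2 * variance D + 2 * expectation (\<lambda>\<omega>. (R \<omega>)\<^sup>2))"
    using 2 \<open>0 < \<epsilon>\<close> by (intro add_left_mono mult_left_mono) auto
  finally show ?thesis .
qed

end

section \<open>Localisation at the boundary of the ball\<close>

lemma real_card_eq_pcount: "real (card S) = enn2real (pcount S)"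
  by (cases "finite S") (auto simp: pcount_def)

lemma one_plus_power_le:
  fixes t :: real
  assumes "0 \<le> t" "t \<le> 1"
  shows "(1 + t) ^ d \<le> 1 + (2 ^ d - 1) * t"
proof (induction d)
  case (Suc d)
  have "(1 + t) ^ Suc d \<le> (1 + (2 ^ d - 1) * t) * (1 + t)"
    using mult_right_mono[OF Suc, of "1 + t"] assms by (simp add: mult.commute)
  also have "\<dots> = 1 + 2 ^ d * t + (2 ^ d - 1) * (t * t)" by (simp add: algebra_simps)
  also have "\<dots> \<le> 1 + 2 ^ d * t + (2 ^ d - 1) * t"
    using assms by (intro add_left_mono mult_left_mono mult_left_le) auto
  also have "\<dots> = 1 + (2 ^ Suc d - 1) * t" by (simp add: algebra_simps)
  finally show ?case .
qed simp

text \<open>After division by \<open>r\<close>, the upper power is estimated by a chord of a convex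
  function and the lower one by its tangent, so the volume of an annulus is linear in its relative
  width.\<close>

lemma shell_power_le:
  fixes r h :: real
  assumes "0 \<le> h" "h \<le> r" "0 < r"
  shows "(r + h) ^ d - (r - h) ^ d \<le> (2 ^ d + real d) * r ^ d * (h / r)"
proof -
  define t where "t = h / r"
  have t: "0 \<le> t" "t \<le> 1" using assms by (auto simp: t_def)
  have "(1 + t) ^ d \<le> 1 + 2 ^ d * t"
    using one_plus_power_le[OF t, of d] t by (simp add: algebra_simps)
  moreover have "1 - real d * t \<le> (1 - t) ^ d"
    using Bernoulli_inequality[of "- t" d] t by simp
  ultimately have "(1 + t) ^ d - (1 - t) ^ d \<le> (2 ^ d + real d) * t" by (simp add: algebra_simps)
  then have "r ^ d * ((1 + t) ^ d - (1 - t) ^ d) \<le> r ^ d * ((2 ^ d + real d) * t)"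
    using assms by (intro mult_left_mono) auto
  moreover have "r + h = r * (1 + t)" "r - h = r * (1 - t)" using assms by (simp_all add: t_def field_simps)
  then have "(r + h) ^ d = r ^ d * (1 + t) ^ d" "(r - h) ^ d = r ^ d * (1 - t) ^ d"
    by (simp_all only: power_mult_distrib)
  ultimately show ?thesis unfolding t_def[symmetric] by (simp add: algebra_simps)
qed

context homogeneous_poisson
begin

definition moved :: "nat \<Rightarrow> real \<Rightarrow> 'w \<Rightarrow> (real ^ 'd) set" where
  "moved k r \<omega> = {x\<in>P \<omega>. track (P \<omega>) k x \<in> cball 0 r}"

text \<open>On \<open>good n\<close> a particle near the ball moves by at most
  \<open>2 ^ k * mesh n\<close>, so one that crosses the sphere starts in such a cube.\<close>

definition shell :: "nat \<Rightarrow> real \<Rightarrow> nat \<Rightarrow> ('d \<Rightarrow> int) set" where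
  "shell k r n = {z\<in>index_box n. \<exists>x\<in>cube (scale n) z. \<bar>norm x - r\<bar> \<le> 2 ^ k * mesh n}"

text \<open>The domain of dependence has radius \<open>6 * 2 ^ k * mesh n\<close>, which is
  \<open>6 * 2 ^ k * CARD('d)\<close> side lengths; the added one comes from
  \<open>cball_subset_window\<close>.\<close>

definition width :: "nat \<Rightarrow> nat" where
  "width k = 6 * 2 ^ k * CARD('d) + 1"

definition local_window :: "nat \<Rightarrow> nat \<Rightarrow> ('d \<Rightarrow> int) \<Rightarrow> (real ^ 'd) set" where
  "local_window k n z = window (scale n) (width k) z"

text \<open>The contribution of a cube to the difference of the two counts, where the particles are moved as if
  the configuration were empty outside the window. Thus it only depends on the points in the window.\<close>

definition local_diff :: "nat \<Rightarrow> real \<Rightarrow> nat \<Rightarrow> ('d \<Rightarrow> int) \<Rightarrow> 'w \<Rightarrow> real" where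
  "local_diff k r n z \<omega> =
     real (card {x\<in>P \<omega> \<inter> local_window k n z. x \<in> cube (scale n) z \<and>
       track (P \<omega> \<inter> local_window k n z) k x \<in> cball 0 r}) -
     real (card (P \<omega> \<inter> local_window k n z \<inter> (cube (scale n) z \<inter> cball 0 r)))"

text \<open>The constant is \<open>8 = 2 + 6\<close>: points of shell cubes lie within
  \<open>2 * 2 ^ k * mesh n\<close> of the sphere, and the domain of dependence around them has
  radius \<open>6 * 2 ^ k * mesh n\<close>.\<close>

definition admissible :: "nat \<Rightarrow> real \<Rightarrow> nat \<Rightarrow> bool" where
  "admissible k r n \<longleftrightarrow> 1 \<le> n \<and> 0 < r \<and> r + 8 * 2 ^ k * mesh n \<le> real n"

lemma admissible_scale: "admissible k r n \<Longrightarrow> 0 < scale n" "admissible k r n \<Longrightarrow> 0 < mesh n"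
  using scale_pos mesh_pos by (auto simp: admissible_def)

lemma admissible_bounds:
  assumes "admissible k r n"
  shows "r + 2 ^ k * mesh n \<le> real n" "r + 2 * 2 ^ k * mesh n \<le> real n"
    "r + 6 * 2 ^ k * mesh n \<le> real n" "r + 2 * 2 ^ k * mesh n + 6 * 2 ^ k * mesh n \<le> real n"
proof -
  define b where "b = 2 ^ k * mesh n"
  have b: "0 \<le> b" "r + 8 * b \<le> real n"
    using assms admissible_scale(2)[OF assms] by (auto simp: admissible_def b_def)
  have e: "c * 2 ^ k * mesh n = c * b" for c by (simp add: b_def)
  show "r + 2 ^ k * mesh n \<le> real n" "r + 2 * 2 ^ k * mesh n \<le> real n"
    "r + 6 * 2 ^ k * mesh n \<le> real n" "r + 2 * 2 ^ k * mesh n + 6 * 2 ^ k * mesh n \<le> real n"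
    unfolding e b_def[symmetric] using b by linarith+
qed

lemma mesh_le_pow: "admissible k r n \<Longrightarrow> mesh n \<le> 2 ^ k * mesh n"
  using admissible_scale(2)[of k r n] mult_right_mono[of 1 "2 ^ k" "mesh n"] by simp

lemma finite_shell [simp]: "finite (shell k r n)"
  by (simp add: shell_def)

lemma local_window_borel [measurable, simp]: "local_window k n z \<in> sets borel"
  by (simp add: local_window_def)

section \<open>Pathwise properties of the local contributions\<close>

lemma measurable_local_diff:
  "local_diff k r n z \<in> borel_measurable (window_algebra (local_window k n z))"
proof -
  let ?W = "local_window k n z"
  note v = void_measurable_window[of ?W, OF local_window_borel]
  have 1: "(\<lambda>\<omega>. pcount {x\<in>P \<omega> \<inter> ?W. x \<in> cube (scale n) z \<and> track (P \<omega> \<inter> ?W) k x \<in> cball 0 r})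
     \<in> borel_measurable (window_algebra ?W)"
    by (rule measurable_pcount_track[OF v]) auto
  have 2: "(\<lambda>\<omega>. card (P \<omega> \<inter> ?W \<inter> (cube (scale n) z \<inter> cball 0 r))) \<in> window_algebra ?W \<rightarrow>\<^sub>M count_space UNIV"
    by (rule measurable_card_void[OF v]) (auto intro: bounded_Int)
  show ?thesis
    unfolding local_diff_def[abs_def] real_card_eq_pcount[of "{x\<in>_. _ x}"]
    using 1 measurable_compose[OF 2, of real borel] by (intro borel_measurable_diff) auto
qed

lemma measurable_moved:
  "(\<lambda>\<omega>. real (card (moved k r \<omega>))) \<in> borel_measurable M"
proof -
  have "(\<lambda>\<omega>. pcount {x\<in>P \<omega>. x \<in> UNIV \<and> track (P \<omega>) k x \<in> cball 0 r}) \<in> borel_measurable M"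
    by (rule measurable_pcount_track[OF void_measurable_P]) auto
  then show ?thesis unfolding moved_def real_card_eq_pcount by simp
qed

lemma abs_local_diff_le:
  assumes "admissible k r n" "\<omega> \<in> space M"
  shows "\<bar>local_diff k r n z \<omega>\<bar> \<le> real (card (P \<omega> \<inter> cube (scale n) z))"
proof -
  have fin: "finite (P \<omega> \<inter> cube (scale n) z)"
    by (rule finite_P[OF assms(2) bounded_cube[OF admissible_scale(1)[OF assms(1)]]])
  have "card {x\<in>P \<omega> \<inter> local_window k n z. x \<in> cube (scale n) z \<and>
       track (P \<omega> \<inter> local_window k n z) k x \<in> cball 0 r} \<le> card (P \<omega> \<inter> cube (scale n) z)"
    "card (P \<omega> \<inter> local_window k n z \<inter> (cube (scale n) z \<inter> cball 0 r)) \<le> card (P \<omega> \<inter> cube (scale n) z)"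
    using fin by (auto intro!: card_mono)
  then show ?thesis unfolding local_diff_def by linarith
qed

lemma shell_cube_norm:
  assumes "admissible k r n" "z \<in> shell k r n" "y \<in> cube (scale n) z"
  shows "\<bar>norm y - r\<bar> \<le> 2 * 2 ^ k * mesh n"
proof -
  obtain x where x: "x \<in> cube (scale n) z" "\<bar>norm x - r\<bar> \<le> 2 ^ k * mesh n"
    using assms(2) by (auto simp: shell_def)
  have "norm (x - y) \<le> mesh n"
    using dist_in_cube[OF admissible_scale(1)[OF assms(1)] x(1) assms(3)] by (simp add: mesh_def dist_norm)
  then show ?thesis
    using x(2) norm_triangle_ineq3[of x y] mesh_le_pow[OF assms(1)] by linarith
qed

text \<open>The domain of dependence of \<open>k\<close> steps is a ball around \<open>x\<close>
  that lies both in the region without large holes and in the window of the cube.\<close>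

lemma track_in_local_window:
  assumes adm: "admissible k r n" and \<omega>: "\<omega> \<in> good n" and z: "z \<in> shell k r n"
    and x: "x \<in> P \<omega>" "x \<in> cube (scale n) z"
  shows "track (P \<omega> \<inter> local_window k n z) k x = track (P \<omega>) k x"
proof (rule track_local)
  let ?\<rho> = "6 * 2 ^ k * mesh n"
  have n: "1 \<le> n" using adm by (simp add: admissible_def)
  show "0 < mesh n" by (rule admissible_scale(2)[OF adm])
  have "norm x + ?\<rho> \<le> real n"
    using shell_cube_norm[OF adm z x(2)] admissible_bounds(4)[OF adm] by linarith
  then have "cball x ?\<rho> \<subseteq> cball 0 (real n)" by (simp add: cball_subset_cball_iff)
  then show "good_in x ?\<rho> (mesh n) (P \<omega>)" by (rule good_in_subset[OF good_good_in[OF \<omega> n]])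
  have "?\<rho> \<le> real (6 * 2 ^ k * CARD('d)) * scale n" by (simp add: mesh_def)
  then have "cball x ?\<rho> \<subseteq> local_window k n z"
    unfolding local_window_def width_def by (rule cball_subset_window[OF admissible_scale(1)[OF adm] x(2)])
  then show "P \<omega> \<inter> cball x ?\<rho> = P \<omega> \<inter> local_window k n z \<inter> cball x ?\<rho>" by blast
qed (rule x(1))

lemma good_track_near:
  assumes adm: "admissible k r n" and \<omega>: "\<omega> \<in> good n" and x: "x \<in> P \<omega>"
    and "norm x \<le> r \<or> norm (track (P \<omega>) k x) \<le> r"
  shows "dist (track (P \<omega>) k x) x \<le> 2 ^ k * mesh n"
proof (rule track_near[where c=0 and \<rho>=r])
  have n: "1 \<le> n" using adm by (simp add: admissible_def)
  show "0 < mesh n" by (rule admissible_scale(2)[OF adm])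
  have "cball 0 (r + 6 * 2 ^ k * mesh n) \<subseteq> cball (0 :: real ^ 'd) (real n)"
    by (intro subset_cball admissible_bounds(3)[OF adm])
  then show "good_in 0 (r + 6 * 2 ^ k * mesh n) (mesh n) (P \<omega>)"
    by (rule good_in_subset[OF good_good_in[OF \<omega> n]])
qed (use assms in auto)

lemma moved_subset_ball:
  assumes adm: "admissible k r n" and \<omega>: "\<omega> \<in> good n"
  shows "moved k r \<omega> \<subseteq> P \<omega> \<inter> cball 0 (real n)"
proof
  fix x assume "x \<in> moved k r \<omega>"
  then have x: "x \<in> P \<omega>" "norm (track (P \<omega>) k x) \<le> r" by (auto simp: moved_def)
  have "dist (track (P \<omega>) k x) x \<le> 2 ^ k * mesh n" by (rule good_track_near[OF adm \<omega> x(1)]) (simp add: x)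
  then have "norm x \<le> r + 2 ^ k * mesh n"
    using x(2) norm_triangle_ineq3[of "track (P \<omega>) k x" x] by (simp add: dist_norm)
  then have "norm x \<le> real n" using admissible_bounds(1)[OF adm] by linarith
  then show "x \<in> P \<omega> \<inter> cball 0 (real n)" using x by simp
qed

lemma card_moved_le:
  assumes "admissible k r n" "\<omega> \<in> good n"
  shows "card (moved k r \<omega>) \<le> ball_count n \<omega>"
proof -
  have "\<omega> \<in> space M" using assms(2) by (simp add: good_def)
  then show ?thesis unfolding ball_count_def
    by (intro card_mono moved_subset_ball[OF assms] finite_P) auto
qed

lemma card_ball_le:
  assumes "r \<le> real n" "\<omega> \<in> space M"
  shows "card (P \<omega> \<inter> cball 0 r) \<le> ball_count n \<omega>"
  unfolding ball_count_def using assms by (intro card_mono finite_P) auto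

lemma ball_count_mono:
  assumes "m \<le> n" "\<omega> \<in> space M"
  shows "ball_count m \<omega> \<le> ball_count n \<omega>"
  using card_ball_le[of "real m" n \<omega>] assms by (simp add: ball_count_def)

text \<open>A crude bound that also holds off \<open>good n\<close>, where the windowed tracks may
  differ from the true ones; the error on the exceptional event is estimated with it.\<close>

lemma sum_local_diff_le:
  assumes adm: "admissible k r n" and \<omega>: "\<omega> \<in> space M"
  shows "\<bar>\<Sum>z\<in>shell k r n. local_diff k r n z \<omega>\<bar> \<le> real (ball_count n \<omega>)"
proof -
  have fin: "finite (P \<omega> \<inter> cube (scale n) z)" for z
    by (rule finite_P[OF \<omega> bounded_cube[OF admissible_scale(1)[OF adm]]])
  have "\<bar>\<Sum>z\<in>shell k r n. local_diff k r n z \<omega>\<bar> \<le> (\<Sum>z\<in>shell k r n. \<bar>local_diff k r n z \<omega>\<bar>)"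
    by (rule sum_abs)
  also have "\<dots> \<le> (\<Sum>z\<in>shell k r n. real (card (P \<omega> \<inter> cube (scale n) z)))"
    by (intro sum_mono abs_local_diff_le[OF adm \<omega>])
  also have "\<dots> = real (card (\<Union>z\<in>shell k r n. P \<omega> \<inter> cube (scale n) z))"
  proof (subst card_UN_disjoint)
    show "\<forall>z\<in>shell k r n. \<forall>w\<in>shell k r n. z \<noteq> w \<longrightarrow>
        (P \<omega> \<inter> cube (scale n) z) \<inter> (P \<omega> \<inter> cube (scale n) w) = {}" using cube_disjoint by blast
  qed (use fin in auto)
  also have "\<dots> \<le> real (ball_count n \<omega>)"
  proof -
    have "(\<Union>z\<in>shell k r n. P \<omega> \<inter> cube (scale n) z) \<subseteq> P \<omega> \<inter> cball 0 (real n)"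
    proof clarify
      fix y z assume y: "y \<in> P \<omega>" "z \<in> shell k r n" "y \<in> cube (scale n) z"
      have "norm y \<le> real n"
        using shell_cube_norm[OF adm y(2,3)] admissible_bounds(2)[OF adm] by linarith
      then show "y \<in> cball 0 (real n)" by simp
    qed
    then show ?thesis unfolding ball_count_def using finite_P[OF \<omega>] by (simp add: card_mono)
  qed
  finally show ?thesis .
qed

text \<open>A particle in exactly one of the two sets has crossed the sphere, hence started in a
  cube of the shell, and outside the shell the counts cancel. Inside the shell the windowed tracks
  are the true ones.\<close>

lemma moved_decomposition:
  assumes adm: "admissible k r n" and \<omega>: "\<omega> \<in> good n"
  shows "real (card (moved k r \<omega>)) - real (card (P \<omega> \<inter> cball 0 r)) = (\<Sum>z\<in>shell k r n. local_diff k r n z \<omega>)"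
proof -
  have sp: "\<omega> \<in> space M" using \<omega> by (simp add: good_def)
  let ?S1 = "moved k r \<omega>" let ?S2 = "P \<omega> \<inter> cball 0 r" let ?Z = "shell k r n"
  let ?Q = "cube (scale n)"
  define U where "U = (\<Union>z\<in>?Z. ?Q z)"
  have fin1: "finite ?S1"
    using finite_subset[OF moved_subset_ball[OF adm \<omega>]] finite_P[OF sp] by simp
  have fin2: "finite ?S2" using finite_P[OF sp] by simp
  have inU: "x \<in> U" if "x \<in> P \<omega>" "(x \<in> ?S1) \<noteq> (x \<in> ?S2)" for x
  proof -
    have xor: "(norm (track (P \<omega>) k x) \<le> r) \<noteq> (norm x \<le> r)" using that by (auto simp: moved_def)
    then have "dist (track (P \<omega>) k x) x \<le> 2 ^ k * mesh n" by (intro good_track_near[OF adm \<omega> that(1)]) auto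
    then have d: "\<bar>norm x - r\<bar> \<le> 2 ^ k * mesh n"
      using xor norm_triangle_ineq3[of "track (P \<omega>) k x" x] unfolding dist_norm by linarith
    have pos: "0 < mesh n" "0 < scale n" "1 \<le> scale n"
      using admissible_scale[OF adm] scale_ge_1[of n] adm by (auto simp: admissible_def)
    have "norm x \<le> real n * 1" using d admissible_bounds(1)[OF adm] by linarith
    also have "\<dots> \<le> real n * scale n" using pos by (intro mult_left_mono) auto
    finally have "cube_index (scale n) x \<in> index_box n" by (rule cube_index_in_index_box[OF pos(2)])
    then have "cube_index (scale n) x \<in> ?Z" using d by (auto simp: shell_def cube_def)
    then show ?thesis by (auto simp: U_def cube_def)
  qed
  have split: "real (card S) = real (card (S - U)) + (\<Sum>z\<in>?Z. real (card (S \<inter> ?Q z)))" if "finite S" for S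
  proof -
    have "card S = card (S - U) + card (S \<inter> U)"
      using that by (metis Int_Diff_Un Int_Diff_disjoint add.commute card_Un_disjoint finite_Diff finite_Int)
    also have "S \<inter> U = (\<Union>z\<in>?Z. S \<inter> ?Q z)" by (auto simp: U_def)
    also have "card \<dots> = (\<Sum>z\<in>?Z. card (S \<inter> ?Q z))"
    proof (rule card_UN_disjoint)
      show "\<forall>z\<in>?Z. \<forall>w\<in>?Z. z \<noteq> w \<longrightarrow> (S \<inter> ?Q z) \<inter> (S \<inter> ?Q w) = {}" using cube_disjoint by blast
    qed (use that in auto)
    finally show ?thesis by simp
  qed
  have "?S1 \<subseteq> P \<omega>" by (auto simp: moved_def)
  then have "?S1 - U = ?S2 - U" using inU by blast
  then have "real (card ?S1) - real (card ?S2) = (\<Sum>z\<in>?Z. real (card (?S1 \<inter> ?Q z)) - real (card (?S2 \<inter> ?Q z)))"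
    using split[OF fin1] split[OF fin2] by (simp add: sum_subtractf)
  also have "\<dots> = (\<Sum>z\<in>?Z. local_diff k r n z \<omega>)"
  proof (rule sum.cong[OF refl])
    fix z assume z: "z \<in> ?Z"
    have "?Q z \<subseteq> local_window k n z" unfolding local_window_def by (rule cube_subset_window)
    then have "?S2 \<inter> ?Q z = P \<omega> \<inter> local_window k n z \<inter> (?Q z \<inter> cball 0 r)"
      and "?S1 \<inter> ?Q z = {x\<in>P \<omega> \<inter> local_window k n z. x \<in> ?Q z \<and> track (P \<omega> \<inter> local_window k n z) k x \<in> cball 0 r}"
      using track_in_local_window[OF adm \<omega> z] by (auto simp: moved_def)
    then show "real (card (?S1 \<inter> ?Q z)) - real (card (?S2 \<inter> ?Q z)) = local_diff k r n z \<omega>"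
      by (simp add: local_diff_def)
  qed
  finally show ?thesis .
qed

section \<open>Size of the shell and variance of the boundary term\<close>

lemma card_shell_le:
  assumes adm: "admissible k r n" and h: "2 * 2 ^ k * mesh n \<le> r"
  shows "real (card (shell k r n)) * scale n ^ CARD('d)
    \<le> measure lborel (cball (0 :: real ^ 'd) r) * ((2 ^ CARD('d) + real CARD('d)) * (2 * 2 ^ k * mesh n / r))"
proof -
  let ?d = "CARD('d)" let ?Z = "shell k r n" let ?Q = "cube (scale n) :: ('d \<Rightarrow> int) \<Rightarrow> _"
  define h where "h = 2 * 2 ^ k * mesh n"
  have s: "0 < scale n" and hr: "0 \<le> h" "h \<le> r" "0 < r"
    using admissible_scale[OF adm] adm h by (auto simp: h_def admissible_def)
  define A where "A = cball (0 :: real ^ 'd) (r + h) - ball 0 (r - h)"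
  have "real (card ?Z) * scale n ^ ?d = (\<Sum>z\<in>?Z. measure lborel (?Q z))"
    by (simp add: measure_cube[OF s])
  also have "\<dots> = measure lborel (\<Union>z\<in>?Z. ?Q z)"
  proof (rule measure_finite_Union[symmetric])
    show "disjoint_family_on ?Q ?Z" using cube_disjoint by (auto simp: disjoint_family_on_def)
    show "emeasure lborel (?Q z) \<noteq> \<infinity>" for z by (simp add: emeasure_cube[OF s])
  qed auto
  also have "\<dots> \<le> measure lborel A"
  proof (rule measure_mono_fmeasurable)
    show "(\<Union>z\<in>?Z. ?Q z) \<subseteq> A"
    proof clarify
      fix y z assume "z \<in> ?Z" "y \<in> ?Q z"
      from shell_cube_norm[OF adm this] show "y \<in> A" by (auto simp: A_def h_def)
    qed
    have "bounded A" unfolding A_def by (rule bounded_diff) simp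
    then show "A \<in> fmeasurable lborel"
      by (intro fmeasurableI emeasure_bounded_finite) (auto simp: A_def)
  qed auto
  also have "measure lborel A = measure lborel (cball (0 :: real ^ 'd) (r + h)) - measure lborel (ball (0 :: real ^ 'd) (r - h))"
    unfolding A_def
    by (rule measure_Diff)
      (use hr in \<open>auto simp: emeasure_lborel_cball_finite[unfolded infinity_ennreal_def] less_imp_neq\<close>)
  also have "\<dots> = unit_ball_vol (real ?d) * ((r + h) ^ ?d - (r - h) ^ ?d)"
    using hr by (simp add: content_cball content_ball algebra_simps)
  also have "\<dots> \<le> unit_ball_vol (real ?d) * ((2 ^ ?d + real ?d) * r ^ ?d * (h / r))"
    by (intro mult_left_mono shell_power_le hr) auto
  also have "\<dots> = measure lborel (cball (0 :: real ^ 'd) r) * ((2 ^ ?d + real ?d) * (h / r))"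
    using hr by (simp add: content_cball)
  finally show ?thesis unfolding h_def .
qed

lemma variance_shell_le:
  assumes adm: "admissible k r n"
  shows "(\<lambda>\<omega>. \<Sum>z\<in>shell k r n. local_diff k r n z \<omega>) \<in> borel_measurable M"
    and "integrable M (\<lambda>\<omega>. (\<Sum>z\<in>shell k r n. local_diff k r n z \<omega>)\<^sup>2)"
    and "variance (\<lambda>\<omega>. \<Sum>z\<in>shell k r n. local_diff k r n z \<omega>)
      \<le> real (card (shell k r n)) * real ((4 * width k + 1) ^ CARD('d)) *
        ((\<gamma> * scale n ^ CARD('d))\<^sup>2 + \<gamma> * scale n ^ CARD('d))"
proof -
  let ?X = "local_diff k r n" let ?W = "local_window k n"
  let ?Q = "cube (scale n) :: ('d \<Rightarrow> int) \<Rightarrow> _"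
  note s = admissible_scale(1)[OF adm]
  note mW = measurable_local_diff
  have mX[measurable]: "?X z \<in> borel_measurable M" for z by (rule measurable_window_M[OF mW])
  have pv: "poisson_variable (\<gamma> * scale n ^ CARD('d)) (\<lambda>\<omega>. card (P \<omega> \<inter> ?Q z))" for z
    using poisson_variable_card[OF cube_borel bounded_cube[OF s], of z] by (simp add: measure_cube[OF s])
  have le: "(?X z \<omega>)\<^sup>2 \<le> (real (card (P \<omega> \<inter> ?Q z)))\<^sup>2" if "\<omega> \<in> space M" for z \<omega>
    using power_mono[OF abs_local_diff_le[OF adm that, of z], of 2] by simp
  have sq: "integrable M (\<lambda>\<omega>. (?X z \<omega>)\<^sup>2)" for z
    by (rule Bochner_Integration.integrable_bound[OF poisson_moments(3)[OF pv[of z]]])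
      (use le in auto)
  have v: "expectation (\<lambda>\<omega>. (?X z \<omega>)\<^sup>2) \<le> (\<gamma> * scale n ^ CARD('d))\<^sup>2 + \<gamma> * scale n ^ CARD('d)" for z
    unfolding poisson_moments(4)[OF pv[of z], symmetric]
    by (rule integral_mono[OF sq poisson_moments(3)[OF pv[of z]] le])
  show "(\<lambda>\<omega>. \<Sum>z\<in>shell k r n. ?X z \<omega>) \<in> borel_measurable M" by measurable
  show "integrable M (\<lambda>\<omega>. (\<Sum>z\<in>shell k r n. ?X z \<omega>)\<^sup>2)"
    by (rule square_integrable_sum) (auto intro: sq)
  \<comment> \<open>These are the indices whose windows can meet that of \<open>z\<close>. Offsets
    of size at most \<open>2 * width k\<close> take \<open>4 * width k + 1\<close> values in each
    coordinate.\<close>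
  define nb where "nb z = {w :: 'd \<Rightarrow> int. (\<lambda>i. w i - z i) \<in> index_box (2 * width k)}" for z
  have nb: "bij_betw (\<lambda>w i. w i - z i) (nb z) (index_box (2 * width k))" for z
    by (rule bij_betwI[where g="\<lambda>u i. u i + z i"]) (auto simp: nb_def)
  show "variance (\<lambda>\<omega>. \<Sum>z\<in>shell k r n. ?X z \<omega>)
      \<le> real (card (shell k r n)) * real ((4 * width k + 1) ^ CARD('d)) *
        ((\<gamma> * scale n ^ CARD('d))\<^sup>2 + \<gamma> * scale n ^ CARD('d))"
  proof (rule variance_sum_local_dependence[where nb=nb])
    show "finite (nb z) \<and> card (nb z) \<le> (4 * width k + 1) ^ CARD('d)" for z
      using bij_betw_finite[OF nb[of z]] bij_betw_same_card[OF nb[of z]] by (simp add: card_index_box)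
    fix z w assume "w \<notin> nb z"
    then have "?W z \<inter> ?W w = {}" unfolding local_window_def nb_def by (intro windows_disjoint) simp
    then show "expectation (\<lambda>\<omega>. ?X z \<omega> * ?X w \<omega>) = expectation (?X z) * expectation (?X w)"
      by (rule indep_windows_expectation[OF _ mW square_integrable_imp_integrable'[OF mX sq]
            mW square_integrable_imp_integrable'[OF mX sq]])
  qed (auto intro: sq v)
qed

end

section \<open>The asymptotic variance\<close>

context homogeneous_poisson
begin

text \<open>About twice \<open>r\<close>: the surplus leaves room for displacements and domains of
  dependence beyond the sphere, while the scale stays comparable to \<open>r\<close>.\<close>

definition radius :: "real \<Rightarrow> nat" where
  "radius r = 2 * nat \<lceil>r\<rceil>"

lemma radius_bounds:
  assumes "0 \<le> r"
  shows "2 * r \<le> real (radius r)" "real (radius r) \<le> 2 * r + 2"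
proof -
  have "real (radius r) = 2 * of_int \<lceil>r\<rceil>" using assms by (simp add: radius_def)
  then show "2 * r \<le> real (radius r)" "real (radius r) \<le> 2 * r + 2"
    using ceiling_correct[of r] by linarith+
qed

lemma filterlim_radius: "filterlim radius at_top at_top"
  unfolding filterlim_at_top
proof
  fix N :: nat
  show "\<forall>\<^sub>F r in at_top. N \<le> radius r"
    using eventually_ge_at_top[of "real N"]
  proof eventually_elim
    case (elim r)
    then have "real N \<le> real (radius r)" using radius_bounds(1)[of r] by linarith
    then show ?case by simp
  qed
qed

lemma eventually_admissible:
  "\<forall>\<^sub>F r in at_top. 1 \<le> r \<and> (\<forall>j\<ge>radius r. admissible k r j) \<and> 2 * 2 ^ k * mesh (radius r) \<le> r"
proof -
  have "\<forall>\<^sub>F n in sequentially. 0 + (16 * 2 ^ k * real CARD('d)) * scale n \<le> real n"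
    by (rule eventually_scale_small) simp
  then obtain N where N: "\<And>n. N \<le> n \<Longrightarrow> 16 * (2 ^ k * mesh n) \<le> real n"
    unfolding eventually_sequentially mesh_def by (auto simp: mult.assoc)
  have "\<forall>\<^sub>F r in at_top. N \<le> radius r"
    using filterlim_radius unfolding filterlim_at_top by blast
  then show ?thesis using eventually_ge_at_top[of 1]
  proof eventually_elim
    case (elim r)
    note rb = radius_bounds[of r]
    have "admissible k r j" if j: "radius r \<le> j" for j
    proof -
      have "real (radius r) \<le> real j" using j by simp
      then have "2 * r \<le> real j" using rb elim by linarith
      \<comment> \<open>The mean of this and \<open>2 * r \<le> real j\<close> is the inequality in
        \<open>admissible\<close>; hence the constant \<open>16\<close>.\<close>
      moreover have "16 * (2 ^ k * mesh j) \<le> real j" using N elim j by simp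
      ultimately have "r + 8 * (2 ^ k * mesh j) \<le> real j" by linarith
      moreover have "1 \<le> j" using \<open>2 * r \<le> real j\<close> elim by linarith
      ultimately show ?thesis using elim by (simp add: admissible_def mult.assoc)
    qed
    moreover have "2 * (2 ^ k * mesh (radius r)) \<le> r" using N[OF elim(1)] rb elim by linarith
    ultimately show ?case using elim by (simp add: mult.assoc)
  qed
qed

section \<open>The error on configurations with large holes\<close>

definition remainder :: "nat \<Rightarrow> real \<Rightarrow> 'w \<Rightarrow> real" where
  "remainder k r \<omega> = real (card (moved k r \<omega>)) - real (card (P \<omega> \<inter> cball 0 r))
     - (\<Sum>z\<in>shell k r (radius r). local_diff k r (radius r) z \<omega>)"

lemma measurable_card_ball: "(\<lambda>\<omega>. real (card (P \<omega> \<inter> cball 0 r))) \<in> borel_measurable M"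
  by (rule measurable_compose[OF measurable_card_P]) auto

lemma measurable_remainder:
  assumes "admissible k r (radius r)"
  shows "remainder k r \<in> borel_measurable M"
  unfolding remainder_def[abs_def]
  by (intro borel_measurable_diff measurable_moved measurable_card_ball variance_shell_le(1)[OF assms])

text \<open>If \<open>radius r\<close> is not good, let \<open>j\<close> be the first later good
  index, which almost surely exists. Then \<open>j - 1\<close> is not good, and the points in radius
  \<open>j\<close> bound every count in the remainder. As \<open>j\<close> is random, one sums over
  its possible values \<open>i + radius r + 1\<close>. The factor \<open>4\<close> is a square: the
  two counts differ by at most \<open>ball_count j \<omega>\<close>, and the local sum adds at most
  the same amount.\<close>

lemma remainder_bound:
  assumes adm: "\<And>j. radius r \<le> j \<Longrightarrow> admissible k r j"
  shows "AE \<omega> in M. ennreal ((remainder k r \<omega>)\<^sup>2) \<le>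
    (\<Sum>i. 4 * (ennreal ((real (ball_count (i + radius r + 1) \<omega>))\<^sup>2) * indicator (space M - good (i + radius r)) \<omega>))"
  using AE_eventually_good AE_space
proof eventually_elim
  case (elim \<omega>)
  let ?n = "radius r"
  let ?f = "\<lambda>i. 4 * (ennreal ((real (ball_count (i + ?n + 1) \<omega>))\<^sup>2) * indicator (space M - good (i + ?n)) \<omega>)"
  show ?case
  proof (cases "\<omega> \<in> good ?n")
    case True
    then have "remainder k r \<omega> = 0"
      using moved_decomposition[OF adm[OF order_refl] True] by (simp add: remainder_def)
    then show ?thesis by simp
  next
    case False
    define Q where "Q j \<longleftrightarrow> ?n \<le> j \<and> \<omega> \<in> good j" for j
    obtain N where "\<forall>j\<ge>N. \<omega> \<in> good j" using elim(1) by (auto simp: eventually_sequentially)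
    then have "Q (max N ?n)" by (simp add: Q_def)
    then have QL: "Q (LEAST j. Q j)" by (rule LeastI)
    define j where "j = (LEAST j. Q j)"
    have j: "?n \<le> j" "\<omega> \<in> good j" using QL by (auto simp: Q_def j_def)
    have "j \<noteq> ?n" using j False by auto
    define i where "i = j - 1 - ?n"
    have ji: "j = i + ?n + 1" using j \<open>j \<noteq> ?n\<close> by (simp add: i_def)
    have "\<not> Q (i + ?n)" unfolding j_def[symmetric] using not_less_Least[of "i + ?n" Q] ji j_def by simp
    then have ng: "\<omega> \<notin> good (i + ?n)" by (simp add: Q_def)
    note aj = adm[OF j(1)] and an = adm[OF order_refl]
    have "0 \<le> 2 ^ k * mesh ?n" using admissible_scale(2)[OF an] by simp
    then have "r \<le> real ?n" using admissible_bounds(1)[OF an] by linarith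
    then have "r \<le> real j" using j(1) by linarith
    have m: "card (moved k r \<omega>) \<le> ball_count j \<omega>" by (rule card_moved_le[OF aj j(2)])
    have b: "card (P \<omega> \<inter> cball 0 r) \<le> ball_count j \<omega>" by (rule card_ball_le[OF \<open>r \<le> real j\<close> elim(2)])
    have "\<bar>\<Sum>z\<in>shell k r ?n. local_diff k r ?n z \<omega>\<bar> \<le> real (ball_count ?n \<omega>)"
      by (rule sum_local_diff_le[OF an elim(2)])
    also have "real (ball_count ?n \<omega>) \<le> real (ball_count j \<omega>)"
      using ball_count_mono[OF j(1) elim(2)] by simp
    finally have "\<bar>remainder k r \<omega>\<bar> \<le> 2 * real (ball_count j \<omega>)"
      using m b unfolding remainder_def by linarith
    then have "\<bar>remainder k r \<omega>\<bar>\<^sup>2 \<le> (2 * real (ball_count j \<omega>))\<^sup>2" by (intro power_mono) auto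
    then have "(remainder k r \<omega>)\<^sup>2 \<le> 4 * (real (ball_count j \<omega>))\<^sup>2" by (simp add: power_mult_distrib)
    then have "ennreal ((remainder k r \<omega>)\<^sup>2) \<le> ennreal (4 * (real (ball_count j \<omega>))\<^sup>2)" by (rule ennreal_leI)
    also have "\<dots> = ?f i" using ng elim(2) by (simp add: ji ennreal_mult')
    also have "\<dots> = sum ?f {i}" by simp
    also have "\<dots> \<le> (\<Sum>i. ?f i)" by (rule sum_le_suminf) auto
    finally show ?thesis .
  qed
qed

definition inverse_square_tail :: "nat \<Rightarrow> real" where
  "inverse_square_tail n = (\<Sum>i. inverse ((real (i + n))\<^sup>2))"

lemma summable_inverse_square: "summable (\<lambda>i. inverse ((real i)\<^sup>2))"
  using inverse_power_summable[of 2] by simp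

lemma inverse_square_tail_tendsto: "inverse_square_tail \<longlonglongrightarrow> 0"
  unfolding inverse_square_tail_def[abs_def] by (rule suminf_exist_split2[OF summable_inverse_square])

lemma inverse_square_tail_nonneg: "0 \<le> inverse_square_tail n"
  unfolding inverse_square_tail_def
  by (rule suminf_nonneg[OF summable_ignore_initial_segment[OF summable_inverse_square]]) simp

text \<open>The estimates for the single scales are summable, so the error is bounded by the tail of
  a convergent series. It tends to zero even before division by the volume.\<close>

lemma remainder_second_moment:
  obtains C where "0 \<le> C"
    "\<And>r. (\<And>j. radius r \<le> j \<Longrightarrow> admissible k r j) \<Longrightarrow>
       integrable M (\<lambda>\<omega>. (remainder k r \<omega>)\<^sup>2) \<and>
       expectation (\<lambda>\<omega>. (remainder k r \<omega>)\<^sup>2) \<le> C * inverse_square_tail (radius r)"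
proof -
  obtain C where C: "0 \<le> C"
    "\<And>j. 1 \<le> j \<Longrightarrow> (\<integral>\<^sup>+\<omega>. ennreal ((real (ball_count (j + 1) \<omega>))\<^sup>2) * indicator (space M - good j) \<omega> \<partial>M)
        \<le> ennreal (C * inverse ((real j)\<^sup>2))"
    by (rule not_good_second_moment) (rule that)
  show ?thesis
  proof (rule that[of "4 * C"])
    show "0 \<le> 4 * C" using C by simp
    fix r assume adm: "\<And>j. radius r \<le> j \<Longrightarrow> admissible k r j"
    let ?n = "radius r"
    have n: "1 \<le> ?n" using adm[OF order_refl] by (simp add: admissible_def)
    have [measurable]: "remainder k r \<in> borel_measurable M" by (rule measurable_remainder[OF adm[OF order_refl]])
    have summ: "summable (\<lambda>i. inverse ((real (i + ?n))\<^sup>2))"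
      by (rule summable_ignore_initial_segment[OF summable_inverse_square])
    have "(\<integral>\<^sup>+\<omega>. ennreal ((remainder k r \<omega>)\<^sup>2) \<partial>M) \<le>
      (\<integral>\<^sup>+\<omega>. (\<Sum>i. 4 * (ennreal ((real (ball_count (i + ?n + 1) \<omega>))\<^sup>2) * indicator (space M - good (i + ?n)) \<omega>)) \<partial>M)"
      by (rule nn_integral_mono_AE[OF remainder_bound[OF adm]])
    also have "\<dots> = (\<Sum>i. \<integral>\<^sup>+\<omega>. 4 * (ennreal ((real (ball_count (i + ?n + 1) \<omega>))\<^sup>2) * indicator (space M - good (i + ?n)) \<omega>) \<partial>M)"
      by (rule nn_integral_suminf) measurable
    also have "\<dots> = (\<Sum>i. 4 * (\<integral>\<^sup>+\<omega>. ennreal ((real (ball_count (i + ?n + 1) \<omega>))\<^sup>2) * indicator (space M - good (i + ?n)) \<omega> \<partial>M))"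
      by (intro suminf_cong nn_integral_cmult) measurable
    also have "\<dots> \<le> (\<Sum>i. ennreal (4 * C * inverse ((real (i + ?n))\<^sup>2)))"
    proof (intro suminf_le)
      fix i
      have "4 * (\<integral>\<^sup>+\<omega>. ennreal ((real (ball_count (i + ?n + 1) \<omega>))\<^sup>2) * indicator (space M - good (i + ?n)) \<omega> \<partial>M)
        \<le> 4 * ennreal (C * inverse ((real (i + ?n))\<^sup>2))"
        using C(2)[of "i + ?n"] n by (intro mult_left_mono) auto
      also have "\<dots> = ennreal (4 * C * inverse ((real (i + ?n))\<^sup>2))"
        using ennreal_mult[of 4 "C * inverse ((real (i + ?n))\<^sup>2)"] C(1) by (simp add: mult.assoc)
      finally show "4 * (\<integral>\<^sup>+\<omega>. ennreal ((real (ball_count (i + ?n + 1) \<omega>))\<^sup>2) * indicator (space M - good (i + ?n)) \<omega> \<partial>M)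
        \<le> ennreal (4 * C * inverse ((real (i + ?n))\<^sup>2))" .
    qed auto
    also have "\<dots> = ennreal (4 * C * inverse_square_tail ?n)"
      unfolding inverse_square_tail_def suminf_mult[OF summ, symmetric]
      using C(1) summ by (intro suminf_ennreal2 summable_mult) auto
    finally have le: "(\<integral>\<^sup>+\<omega>. ennreal ((remainder k r \<omega>)\<^sup>2) \<partial>M) \<le> ennreal (4 * C * inverse_square_tail ?n)" .
    have int: "integrable M (\<lambda>\<omega>. (remainder k r \<omega>)\<^sup>2)"
      by (rule integrableI_bounded) (use le in \<open>auto intro: le_less_trans\<close>)
    have "ennreal (expectation (\<lambda>\<omega>. (remainder k r \<omega>)\<^sup>2)) \<le> ennreal (4 * C * inverse_square_tail ?n)"
      using le nn_integral_eq_integral[OF int] by simp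
    then have "expectation (\<lambda>\<omega>. (remainder k r \<omega>)\<^sup>2) \<le> 4 * C * inverse_square_tail ?n"
      using C(1) inverse_square_tail_nonneg by (subst (asm) ennreal_le_iff) auto
    with int show "integrable M (\<lambda>\<omega>. (remainder k r \<omega>)\<^sup>2) \<and>
       expectation (\<lambda>\<omega>. (remainder k r \<omega>)\<^sup>2) \<le> 4 * C * inverse_square_tail (radius r)" by simp
  qed
qed

text \<open>With \<open>b\<close> the volume of the ball and \<open>s\<close> the side length, the
  shell has of order \<open>b * s / (r * s ^ d)\<close> cubes, each with second moment of order
  \<open>s ^ (2 * d)\<close> and boundedly many dependent neighbours. This gives
  \<open>b * s ^ (d + 1) / r\<close>, where \<open>s ^ (d + 1) = sqrt n \<le> 2 * sqrt r\<close>
  because \<open>n \<le> 4 * r\<close>.\<close>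

lemma variance_shell_rate:
  obtains K where "0 \<le> K"
    "\<And>r. admissible k r (radius r) \<Longrightarrow> 1 \<le> r \<Longrightarrow> 2 * 2 ^ k * mesh (radius r) \<le> r \<Longrightarrow>
      variance (\<lambda>\<omega>. \<Sum>z\<in>shell k r (radius r). local_diff k r (radius r) z \<omega>)
        \<le> measure lborel (cball (0 :: real ^ 'd) r) * (K * (2 / sqrt r))"
proof -
  let ?d = "CARD('d)"
  define c0 where "c0 = real ((4 * width k + 1) ^ ?d)"
  define K where "K = (2 ^ ?d + real ?d) * 2 * 2 ^ k * real ?d * c0 * (\<gamma>\<^sup>2 + \<gamma>)"
  show ?thesis
  proof (rule that[of K])
    show "0 \<le> K" using \<gamma>_pos by (simp add: K_def c0_def)
    fix r assume adm: "admissible k r (radius r)" and r: "1 \<le> r" and h: "2 * 2 ^ k * mesh (radius r) \<le> r"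
    define n where "n = radius r"
    define s where "s = scale n"
    define b where "b = measure lborel (cball (0 :: real ^ 'd) r)"
    define q where "q = real (card (shell k r n))"
    have n: "1 \<le> n" using adm by (simp add: admissible_def n_def)
    have s: "1 \<le> s" using scale_ge_1[OF n] by (simp add: s_def)
    have b: "0 \<le> b" by (simp add: b_def)
    have sd: "1 \<le> s ^ ?d" using s by (rule one_le_power)
    have "variance (\<lambda>\<omega>. \<Sum>z\<in>shell k r n. local_diff k r n z \<omega>) \<le> q * c0 * ((\<gamma> * s ^ ?d)\<^sup>2 + \<gamma> * s ^ ?d)"
      using variance_shell_le(3)[OF adm] by (simp add: q_def c0_def s_def n_def)
    also have "\<dots> \<le> q * c0 * ((\<gamma>\<^sup>2 + \<gamma>) * (s ^ ?d * s ^ ?d))"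
    proof (rule mult_left_mono)
      have "\<gamma> * s ^ ?d * 1 \<le> \<gamma> * s ^ ?d * s ^ ?d" using sd \<gamma>_pos s by (intro mult_left_mono) auto
      then show "(\<gamma> * s ^ ?d)\<^sup>2 + \<gamma> * s ^ ?d \<le> (\<gamma>\<^sup>2 + \<gamma>) * (s ^ ?d * s ^ ?d)"
        by (simp add: power2_eq_square algebra_simps)
    qed (simp add: q_def c0_def)
    also have "\<dots> = (q * s ^ ?d) * (c0 * (\<gamma>\<^sup>2 + \<gamma>) * s ^ ?d)" by simp
    also have "\<dots> \<le> (b * ((2 ^ ?d + real ?d) * (2 * 2 ^ k * mesh n / r))) * (c0 * (\<gamma>\<^sup>2 + \<gamma>) * s ^ ?d)"
      using card_shell_le[OF adm h] \<gamma>_pos s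
      by (intro mult_right_mono) (auto simp: q_def s_def b_def n_def c0_def)
    also have "\<dots> = b * (K * (s ^ (?d + 1) / r))"
      by (simp add: K_def mesh_def s_def power_add mult_ac)
    also have "\<dots> \<le> b * (K * (2 / sqrt r))"
    proof (intro mult_left_mono b \<open>0 \<le> K\<close>)
      have "real n \<le> 4 * r" using radius_bounds(2)[of r] r by (simp add: n_def)
      then have "sqrt (real n) \<le> sqrt (4 * r)" by (rule real_sqrt_le_mono)
      then have "s ^ (?d + 1) \<le> 2 * sqrt r"
        unfolding s_def scale_power_sqrt by (simp add: real_sqrt_mult)
      then have "s ^ (?d + 1) / r \<le> 2 * sqrt r / r" using r by (intro divide_right_mono) auto
      also have "\<dots> = 2 * sqrt r / (sqrt r * sqrt r)" using r by simp
      also have "\<dots> = 2 / sqrt r" using r by (simp add: field_simps del: real_sqrt_mult_self)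
      finally show "s ^ (?d + 1) / r \<le> 2 / sqrt r" .
    qed
    finally show "variance (\<lambda>\<omega>. \<Sum>z\<in>shell k r (radius r). local_diff k r (radius r) z \<omega>)
        \<le> measure lborel (cball (0 :: real ^ 'd) r) * (K * (2 / sqrt r))"
      by (simp add: n_def b_def)
  qed
qed

theorem variance_moved_tendsto:
  "((\<lambda>r. variance (\<lambda>\<omega>. real (card (moved k r \<omega>))) / measure lborel (cball (0 :: real ^ 'd) r)) \<longlongrightarrow> \<gamma>) at_top"
proof -
  obtain C where C: "0 \<le> C"
    "\<And>r. (\<And>j. radius r \<le> j \<Longrightarrow> admissible k r j) \<Longrightarrow>
       integrable M (\<lambda>\<omega>. (remainder k r \<omega>)\<^sup>2) \<and>
       expectation (\<lambda>\<omega>. (remainder k r \<omega>)\<^sup>2) \<le> C * inverse_square_tail (radius r)"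
    by (rule remainder_second_moment[of k]) (rule that; blast)
  obtain K where K: "0 \<le> K"
    "\<And>r. admissible k r (radius r) \<Longrightarrow> 1 \<le> r \<Longrightarrow> 2 * 2 ^ k * mesh (radius r) \<le> r \<Longrightarrow>
      variance (\<lambda>\<omega>. \<Sum>z\<in>shell k r (radius r). local_diff k r (radius r) z \<omega>)
        \<le> measure lborel (cball (0 :: real ^ 'd) r) * (K * (2 / sqrt r))"
    by (rule variance_shell_rate[of k]) (rule that; blast)
  define \<kappa> where "\<kappa> = unit_ball_vol (real CARD('d))"
  have \<kappa>: "0 < \<kappa>" by (simp add: \<kappa>_def)
  define b where "b r = measure lborel (cball (0 :: real ^ 'd) r)" for r
  define f where "f r = 2 * (K * (2 / sqrt r)) + 2 * (C * inverse_square_tail (radius r)) / \<kappa>" for r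
  have "((\<lambda>r. 2 / sqrt r) \<longlongrightarrow> 0) at_top"
    by (intro tendsto_divide_0[OF tendsto_const] filterlim_at_top_imp_at_infinity sqrt_at_top)
  moreover have "((\<lambda>r. inverse_square_tail (radius r)) \<longlongrightarrow> 0) at_top"
    by (rule filterlim_compose[OF inverse_square_tail_tendsto filterlim_radius])
  ultimately have "(f \<longlongrightarrow> 2 * (K * 0) + 2 * (C * 0) / \<kappa>) at_top"
    unfolding f_def[abs_def] using \<kappa> by (intro tendsto_intros) auto
  then have f0: "(f \<longlongrightarrow> 0) at_top" by simp
  have bound: "\<bar>variance (\<lambda>\<omega>. real (card (moved k r \<omega>))) / b r - \<gamma>\<bar> \<le> \<epsilon> * \<gamma> + (1 + 1 / \<epsilon>) * f r"
    if r: "1 \<le> r" and adm: "\<And>j. radius r \<le> j \<Longrightarrow> admissible k r j"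
      and h: "2 * 2 ^ k * mesh (radius r) \<le> r" and \<epsilon>: "0 < \<epsilon>" for r \<epsilon>
  proof -
    note an = adm[OF order_refl]
    let ?X = "\<lambda>\<omega>. real (card (P \<omega> \<inter> cball 0 r))"
    let ?D = "\<lambda>\<omega>. \<Sum>z\<in>shell k r (radius r). local_diff k r (radius r) z \<omega>"
    let ?R = "remainder k r"
    have pv: "poisson_variable (\<gamma> * b r) (\<lambda>\<omega>. card (P \<omega> \<inter> cball 0 r))"
      unfolding b_def by (rule poisson_variable_card) auto
    have br: "b r = \<kappa> * r ^ CARD('d)" using r by (simp add: b_def \<kappa>_def content_cball)
    \<comment> \<open>Since \<open>b r\<close> is bounded away from zero, the absolute bound on the
      remainder becomes a relative one.\<close>
    have "\<kappa> * 1 \<le> b r" unfolding br using r \<kappa> by (intro mult_left_mono one_le_power) auto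
    then have b\<kappa>: "\<kappa> \<le> b r" "0 < b r" using \<kappa> by auto
    have eq: "real (card (moved k r \<omega>)) = ?X \<omega> + ?D \<omega> + ?R \<omega>" for \<omega>
      by (simp add: remainder_def)
    have "\<bar>variance (\<lambda>\<omega>. real (card (moved k r \<omega>))) - variance ?X\<bar>
        \<le> \<epsilon> * variance ?X + (1 + 1 / \<epsilon>) * (2 * variance ?D + 2 * expectation (\<lambda>\<omega>. (?R \<omega>)\<^sup>2))"
      unfolding eq
      by (rule variance_add_bound[OF measurable_card_ball poisson_moments(3)[OF pv]
            variance_shell_le(1,2)[OF an] measurable_remainder[OF an] _ \<epsilon>]) (use C(2)[OF adm] in blast)
    also have "variance ?X = \<gamma> * b r" by (rule poisson_moments(5)[OF pv])
    also have "\<epsilon> * (\<gamma> * b r) + (1 + 1 / \<epsilon>) * (2 * variance ?D + 2 * expectation (\<lambda>\<omega>. (?R \<omega>)\<^sup>2))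
        \<le> \<epsilon> * (\<gamma> * b r) + (1 + 1 / \<epsilon>) * (b r * f r)"
    proof (intro add_left_mono mult_left_mono)
      have "variance ?D \<le> b r * (K * (2 / sqrt r))" using K(2)[OF an r h] by (simp add: b_def)
      moreover have "expectation (\<lambda>\<omega>. (?R \<omega>)\<^sup>2) \<le> b r * (C * inverse_square_tail (radius r) / \<kappa>)"
      proof -
        have "expectation (\<lambda>\<omega>. (?R \<omega>)\<^sup>2) \<le> \<kappa> * (C * inverse_square_tail (radius r) / \<kappa>)"
          using C(2)[OF adm] \<kappa> by simp
        also have "\<dots> \<le> b r * (C * inverse_square_tail (radius r) / \<kappa>)"
          using b\<kappa> C(1) \<kappa> inverse_square_tail_nonneg by (intro mult_right_mono divide_nonneg_nonneg mult_nonneg_nonneg) auto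
        finally show ?thesis .
      qed
      ultimately have "2 * variance ?D + 2 * expectation (\<lambda>\<omega>. (?R \<omega>)\<^sup>2)
          \<le> 2 * (b r * (K * (2 / sqrt r))) + 2 * (b r * (C * inverse_square_tail (radius r) / \<kappa>))" by linarith
      also have "\<dots> = b r * f r" by (simp add: f_def algebra_simps)
      finally show "2 * variance ?D + 2 * expectation (\<lambda>\<omega>. (?R \<omega>)\<^sup>2) \<le> b r * f r" .
    qed (use \<epsilon> in auto)
    finally have *: "\<bar>variance (\<lambda>\<omega>. real (card (moved k r \<omega>))) - \<gamma> * b r\<bar> \<le> b r * (\<epsilon> * \<gamma> + (1 + 1 / \<epsilon>) * f r)"
      by (simp add: algebra_simps)
    have "\<bar>variance (\<lambda>\<omega>. real (card (moved k r \<omega>))) / b r - \<gamma>\<bar> = \<bar>variance (\<lambda>\<omega>. real (card (moved k r \<omega>))) - \<gamma> * b r\<bar> / b r"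
    proof -
      have "\<bar>v / c - g\<bar> = \<bar>v - g * c\<bar> / c" if "0 < c" for v c g :: real
      proof -
        have "v / c - g = (v - g * c) / c" using that by (simp add: diff_divide_distrib)
        then show ?thesis by (simp only: abs_divide abs_of_pos[OF that])
      qed
      from this[OF b\<kappa>(2)] show ?thesis .
    qed
    also have "\<dots> \<le> \<epsilon> * \<gamma> + (1 + 1 / \<epsilon>) * f r"
      using * b\<kappa>(2) by (simp only: pos_divide_le_eq mult.commute)
    finally show ?thesis .
  qed
  show ?thesis unfolding b_def[symmetric]
  proof (rule tendstoI)
    fix \<delta> :: real assume \<delta>: "0 < \<delta>"
    \<comment> \<open>Half of \<open>\<delta>\<close> is spent on the term
      \<open>\<epsilon> * \<gamma>\<close>, which does not vanish as \<open>r\<close> grows; once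
      \<open>\<epsilon>\<close> is fixed, \<open>1 + 1 / \<epsilon>\<close> is a constant in front
      of \<open>f\<close>.\<close>
    define \<epsilon> where "\<epsilon> = \<delta> / (2 * \<gamma>)"
    have \<epsilon>: "0 < \<epsilon>" "\<epsilon> * \<gamma> = \<delta> / 2" using \<delta> \<gamma>_pos by (auto simp: \<epsilon>_def)
    have "((\<lambda>r. (1 + 1 / \<epsilon>) * f r) \<longlongrightarrow> (1 + 1 / \<epsilon>) * 0) at_top" by (intro tendsto_intros f0)
    then have "\<forall>\<^sub>F r in at_top. (1 + 1 / \<epsilon>) * f r < \<delta> / 2"
      using \<delta> by (intro order_tendstoD(2)) auto
    then show "\<forall>\<^sub>F r in at_top. dist (variance (\<lambda>\<omega>. real (card (moved k r \<omega>))) / b r) \<gamma> < \<delta>"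
      using eventually_admissible[of k]
    proof eventually_elim
      case (elim r)
      then show ?case using bound[of r \<epsilon>] \<epsilon> unfolding dist_real_def by force
    qed
  qed
qed

end

section \<open>Passage to the completion\<close>

text \<open>On the exceptional set \<open>f\<close> is arbitrary, but its preimages there are
  subsets of a null set and hence measurable in the completion.\<close>

lemma borel_measurable_completion_AE_eq:
  fixes f g :: "'a \<Rightarrow> real"
  assumes g: "g \<in> borel_measurable M" and ae: "AE x in M. f x = g x"
  shows "f \<in> borel_measurable (completion M)"
proof -
  obtain N where N: "{x\<in>space M. f x \<noteq> g x} \<subseteq> N" "N \<in> null_sets M"
    using ae by (auto simp: eventually_ae_filter)
  show ?thesis
  proof (rule measurableI)
    fix A :: "real set" assume A: "A \<in> sets borel"
    have "f -` A \<inter> space M = (g -` A \<inter> space M - N) \<union> (f -` A \<inter> space M \<inter> N)"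
      using N(1) by auto
    moreover have "g -` A \<inter> space M - N \<in> sets (completion M)"
      using measurable_sets[OF g A] N(2) by auto
    moreover have "f -` A \<inter> space M \<inter> N \<in> sets (completion M)"
      by (rule sets_completionI_sub[OF N(2)]) auto
    ultimately have "f -` A \<inter> space M \<in> sets (completion M)" by (metis sets.Un)
    then show "f -` A \<inter> space (completion M) \<in> sets (completion M)" by simp
  qed simp
qed

lemma integral_completion_AE_eq:
  fixes f g :: "'a \<Rightarrow> real"
  assumes g: "g \<in> borel_measurable M" and ae: "AE x in M. f x = g x"
  shows "integral\<^sup>L (completion M) f = integral\<^sup>L M g"
proof -
  have "integral\<^sup>L (completion M) f = integral\<^sup>L (completion M) g"
    using borel_measurable_completion_AE_eq[OF assms] AE_completion[OF ae] measurable_completion[OF g]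
    by (intro integral_cong_AE) auto
  then show ?thesis by (simp add: integral_completion[OF g])
qed

lemma count_variance_AE_eq:
  assumes g: "g \<in> borel_measurable M" and ae: "AE \<omega> in M. measure (\<Psi> \<omega>) B = g \<omega>"
  shows "count_variance M \<Psi> B = prob_space.variance M g"
proof -
  have "integral\<^sup>L (completion M) (\<lambda>\<omega>. measure (\<Psi> \<omega>) B) = integral\<^sup>L M g"
    by (rule integral_completion_AE_eq[OF g ae])
  moreover have "integral\<^sup>L (completion M) (\<lambda>\<omega>. (measure (\<Psi> \<omega>) B - integral\<^sup>L M g)\<^sup>2) =
      integral\<^sup>L M (\<lambda>\<omega>. (g \<omega> - integral\<^sup>L M g)\<^sup>2)"
    by (rule integral_completion_AE_eq) (use g ae in \<open>auto elim!: eventually_mono\<close>)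
  ultimately show ?thesis by (simp add: count_variance_def)
qed

lemma poisson_process_homogeneous:
  fixes \<Lambda> :: "(real ^ 'd::finite) measure"
  assumes P: "poisson_process M \<Lambda> \<Phi>" and "stationary M \<Phi>" "intensity M \<Phi> = ennreal \<gamma>" "0 < \<gamma>"
  shows "homogeneous_poisson M \<Phi> \<gamma>"
proof -
  have pp: "point_process M \<Phi>"
    and fin: "\<And>B. B \<in> sets borel \<Longrightarrow> bounded B \<Longrightarrow> emeasure \<Lambda> B < \<infinity>"
    and p: "\<And>B n. B \<in> sets borel \<Longrightarrow> emeasure \<Lambda> B < \<infinity> \<Longrightarrow>
      measure M {\<omega>\<in>space M. emeasure (\<Phi> \<omega>) B = of_nat n} = measure \<Lambda> B ^ n / fact n * exp (- measure \<Lambda> B)"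
    and ind: "\<And>(n::nat) B. (\<forall>i<n. B i \<in> sets borel) \<Longrightarrow> disjoint_family_on B {..<n} \<Longrightarrow>
        prob_space.indep_vars M (\<lambda>_. borel) (\<lambda>i \<omega>. emeasure (\<Phi> \<omega>) (B i)) {..<n}"
    using P unfolding poisson_process_def by blast+
  interpret prob_space M using pp by (simp add: point_process_def)
  show ?thesis
  proof unfold_locales
    show "0 < \<gamma>" by fact
    show "locally_finite_counting_measure (\<Phi> \<omega>)" if "\<omega> \<in> space M" for \<omega>
      by (rule point_process_lfcm[OF pp that])
    show "(\<lambda>\<omega>. emeasure (\<Phi> \<omega>) B) \<in> borel_measurable M" if "B \<in> sets borel" for B
      by (rule point_process_measurable[OF pp that])
    show "prob {\<omega>\<in>space M. emeasure (\<Phi> \<omega>) B = of_nat n} =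
        (\<gamma> * measure lborel B) ^ n / fact n * exp (- (\<gamma> * measure lborel B))"
      if "B \<in> sets borel" "bounded B" for B n
      using p[OF that(1) fin[OF that]] stationary_poisson_intensity_measure[OF assms that] by simp
    fix B C :: "(real ^ 'd) set" assume BC: "B \<in> sets borel" "C \<in> sets borel" "B \<inter> C = {}"
    define D where "D i = (if i = 0 then B else C)" for i :: nat
    have "indep_vars (\<lambda>_. borel) (\<lambda>i \<omega>. emeasure (\<Phi> \<omega>) (D i)) {..<2}"
      by (rule ind) (use BC in \<open>auto simp: D_def disjoint_family_on_def\<close>)
    have "prob (\<Inter>i\<in>{..<2}. (\<lambda>\<omega>. emeasure (\<Phi> \<omega>) (D i)) -` {0} \<inter> space M) =
        (\<Prod>i\<in>{..<2}. prob ((\<lambda>\<omega>. emeasure (\<Phi> \<omega>) (D i)) -` {0} \<inter> space M))"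
    proof (rule indep_varsD_finite)
      have "(0::nat) \<in> {..<2}" by simp
      then show "{..<2::nat} \<noteq> {}" by blast
    qed (use \<open>indep_vars _ _ {..<2}\<close> in auto)
    moreover have "{..<2} = {0, 1 :: nat}" by auto
    moreover have "(\<lambda>\<omega>. emeasure (\<Phi> \<omega>) A) -` {0} \<inter> space M = {\<omega>\<in>space M. emeasure (\<Phi> \<omega>) A = 0}" for A by auto
    ultimately show "prob {\<omega>\<in>space M. emeasure (\<Phi> \<omega>) B = 0 \<and> emeasure (\<Phi> \<omega>) C = 0} =
        prob {\<omega>\<in>space M. emeasure (\<Phi> \<omega>) B = 0} * prob {\<omega>\<in>space M. emeasure (\<Phi> \<omega>) C = 0}"
      by (simp add: D_def Collect_conj_eq[symmetric] Int_def conj_ac cong: conj_cong)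
  qed
qed

lemma (in homogeneous_poisson) count_variance_process:
  "0 \<le> r \<Longrightarrow> count_variance M \<Phi> (cball 0 r) = \<gamma> * measure lborel (cball (0 :: real ^ 'd) r)"
proof -
  have "AE \<omega> in M. measure (\<Phi> \<omega>) (cball 0 r) = real (card (P \<omega> \<inter> cball 0 r))"
    using AE_emeasure_eq_card by eventually_elim (simp add: measure_def)
  from count_variance_AE_eq[OF measurable_card_ball this]
  have "count_variance M \<Phi> (cball 0 r) = variance (\<lambda>\<omega>. real (card (P \<omega> \<inter> cball 0 r)))" .
  also have "\<dots> = \<gamma> * measure lborel (cball (0 :: real ^ 'd) r)"
    by (rule poisson_moments(5)[OF poisson_variable_card]) auto
  finally show ?thesis .
qed

text \<open>Placed outside the locale because the iterates require a linear order on the index type,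
  whereas the index type of the locale is merely finite.\<close>

lemma count_variance_lloyd_Suc:
  fixes \<Phi> :: "'w \<Rightarrow> (real ^ ('d::{finite,linorder})) measure"
  assumes "homogeneous_poisson M \<Phi> \<gamma>"
  shows "count_variance M (\<lambda>\<omega>. lloyd (Suc k) (\<Phi> \<omega>)) (cball 0 r) =
    prob_space.variance M (\<lambda>\<omega>. real (card (homogeneous_poisson.moved \<Phi> (Suc k) r \<omega>)))"
proof -
  interpret homogeneous_poisson M \<Phi> \<gamma> by fact
  show ?thesis
  proof (rule count_variance_AE_eq[OF measurable_moved])
    show "AE \<omega> in M. measure (lloyd (Suc k) (\<Phi> \<omega>)) (cball 0 r) = real (card (moved (Suc k) r \<omega>))"
      using AE_globally_good
    proof eventually_elim
      case (elim \<omega>)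
      show ?case unfolding moved_def by (rule measure_lloyd_Suc[OF elim]) simp
    qed
  qed
qed

theorem proposition7p5:
  fixes M :: "'w measure"
    and \<Lambda> :: "(real ^ ('d::{finite,linorder})) measure"
    and \<Phi> :: "'w \<Rightarrow> (real ^ ('d::{finite,linorder})) measure"
    and \<gamma> :: real
  assumes "poisson_process M \<Lambda> \<Phi>"
    and "stationary M \<Phi>"
    and "intensity M \<Phi> = ennreal \<gamma>"
    and "\<gamma> > 0"
  shows "\<forall>k::nat.
    ((\<lambda>r::real. count_variance M (\<lambda>\<omega>. lloyd k (\<Phi> \<omega>)) (cball 0 r) / measure lborel (cball (0 :: real ^ ('d::{finite,linorder})) r))
       \<longlongrightarrow> \<gamma>) at_top \<and>
    ((\<lambda>r::real. count_variance M \<Phi> (cball 0 r) / measure lborel (cball (0 :: real ^ ('d::{finite,linorder})) r))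
       \<longlongrightarrow> \<gamma>) at_top"
proof -
  interpret homogeneous_poisson M \<Phi> \<gamma> by (rule poisson_process_homogeneous[OF assms])
  have "\<forall>\<^sub>F r in at_top. count_variance M \<Phi> (cball 0 r) / measure lborel (cball (0 :: real ^ ('d::{finite,linorder})) r) = \<gamma>"
    using eventually_gt_at_top[of 0]
  proof eventually_elim
    case (elim r)
    then have "measure lborel (cball (0 :: real ^ ('d::{finite,linorder})) r) \<noteq> 0" using content_cball_pos[of r "0 :: real ^ ('d::{finite,linorder})"] by simp
    then show ?case using elim by (simp add: count_variance_process)
  qed
  then have base: "((\<lambda>r. count_variance M \<Phi> (cball 0 r) / measure lborel (cball (0 :: real ^ ('d::{finite,linorder})) r)) \<longlongrightarrow> \<gamma>) at_top"
    by (rule tendsto_eventually)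
  have "((\<lambda>r. count_variance M (\<lambda>\<omega>. lloyd k (\<Phi> \<omega>)) (cball 0 r) / measure lborel (cball (0 :: real ^ ('d::{finite,linorder})) r)) \<longlongrightarrow> \<gamma>) at_top" for k
  proof (cases k)
    case 0
    then show ?thesis using base by simp
  next
    case (Suc j)
    show ?thesis
      unfolding Suc count_variance_lloyd_Suc[OF homogeneous_poisson_axioms] by (rule variance_moved_tendsto)
  qed
  with base show ?thesis by blast
qed

end
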